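(* Suppose the kernel $\beta$ satisfies $0\le\widehat\beta(\xi)\le\|\widehat\beta\|_{L^\infty}<\infty$ for all $\xi\in\mathbb{R}$, $\int_{\mathbb{R}}\beta\,dx=1$ and $\int_{\mathbb{R}}x^2|\beta|\,dx<\infty$. Let $u_0,v_0\in H^{s+\theta}$ with $s>5/2$ and $0<\theta\le 2$. Let $$u^\delta,v^\delta,u,v\in C\big([0,\tfrac{T}{\epsilon^n}],H^{s+\theta}\big)\cap C^1\big([0,\tfrac{T}{\epsilon^n}],H^{s+\theta-1}\big)$$ satisfy, respectively, the system $$u^\delta_t=K_\delta v^\delta_x,\qquad v^\delta_t=K_\delta\big(u^\delta+\epsilon^n(u^\delta)^{n+1}\big)_x$$ and the system $$u_t=v_x,\qquad v_t=\big(1+(n+1)\epsilon^n u^n\big)u_x,$$ with the same initial data $u^\delta(x,0)=u(x,0)=u_0(x)$ and $v^\delta(x,0)=v(x,0)=v_0(x)$. Then, for all $t\in[0,\tfrac{T}{\epsilon^n}]$, $$\|u^\delta(t)-u(t)\|_{H^{s-1}}+\|v^\delta(t)-v(t)\|_{H^{s-1}}\le C\,\delta^\theta\,t\,e^{C\epsilon^n t},$$ where $C$ is a constant independent of $\delta$ and $\epsilon$.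
   Context: $H^s=H^s(\mathbb{R})$ is the $L^2$-based Sobolev space with norm $\|u\|_{H^s}=\big(\int_{\mathbb{R}}(1+\xi^2)^s|\widehat u(\xi)|^2d\xi\big)^{1/2}$, where $\widehat u(\xi)=\int_{\mathbb{R}}u(x)e^{-i\xi x}dx$. The kernel $\beta$ is an even integrable function or, more generally, a finite measure on $\mathbb{R}$. The numbers $\delta>0$ and $\epsilon>0$ are small parameters, $n\ge1$ is an integer (the exponent of the power nonlinearity $u^{n+1}$), and $T>0$. $K_\delta$ is the Fourier multiplier operator $K_\delta v=\mathcal{F}^{-1}\big(k(\delta\xi)\widehat v(\xi)\big)$ with $k(\xi)=(\widehat\beta(\xi))^{1/2}$. The first system is equivalent to the nonlocal equation $u^\delta_{tt}=\beta_\delta*\big(u^\delta+\epsilon^n(u^\delta)^{n+1}\big)_{xx}$ with $\beta_\delta(x)=\frac1\delta\beta(\frac x\delta)$, and the second to the classical elasticity equation $u_{tt}=(u+\epsilon^n u^{n+1})_{xx}$.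
   Formalization: The solutions are assumed bounded by a common M in C([0,T/ε^n],H^{s+θ}), and C depends on M (near blow-up no C independent of δ and ε exists otherwise); "small" ε means 0<ε≤ε₀, with ε₀ independent of δ, ε and the particular solutions. *)

theory Defs
  imports "HOL-Probability.Probability"
begin

subsection \<open>The Fourier transform on \<open>L\<^sup>2\<close> and Sobolev spaces\<close>

text \<open>
  Elements of \<open>L\<^sup>2\<close> and of the Sobolev spaces are represented by Borel functions \<open>real \<Rightarrow> real\<close>;
  equality of such elements is equality almost everywhere.
\<close>

definition square_integrable :: "(real \<Rightarrow> 'a::{banach, second_countable_topology}) \<Rightarrow> bool" where
  "square_integrable f \<longleftrightarrow> f \<in> borel_measurable lborel \<and> integrable lborel (\<lambda>x. (norm (f x))\<^sup>2)"

definition fourier_cutoff :: "real \<Rightarrow> (real \<Rightarrow> real) \<Rightarrow> real \<Rightarrow> complex" where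
  "fourier_cutoff R f \<xi> =
     (CLINT x|lborel. indicator {-R..R} x * complex_of_real (f x) * exp (- (\<i> * complex_of_real (\<xi> * x))))"

text \<open>
  The Fourier transform \<open>\<integral> f(x) exp (- i \<xi> x) dx\<close> of a square integrable \<open>f\<close>, which need not be integrable,
  is the limit in \<open>L\<^sup>2\<close> of the integrals over \<open>[-R, R]\<close> (Plancherel).  It is determined up to a
  null set.  The \<open>L\<^sup>2\<close> distance is written with the nonnegative integral, so that no integrability
  convention can make the limit hold vacuously.
\<close>

definition has_fourier :: "(real \<Rightarrow> real) \<Rightarrow> (real \<Rightarrow> complex) \<Rightarrow> bool" where
  "has_fourier f g \<longleftrightarrow> square_integrable g \<and>
     ((\<lambda>R. \<integral>\<^sup>+\<xi>. ennreal ((cmod (fourier_cutoff R f \<xi> - g \<xi>))\<^sup>2) \<partial>lborel) \<longlongrightarrow> 0) at_top"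

definition fourier :: "(real \<Rightarrow> real) \<Rightarrow> real \<Rightarrow> complex" where
  "fourier f = (SOME g. has_fourier f g)"

text \<open>Only used for \<open>s \<ge> 0\<close>, where \<open>H\<^sup>s\<close> is a subspace of \<open>L\<^sup>2\<close>.\<close>

definition Hs :: "real \<Rightarrow> (real \<Rightarrow> real) set" where
  "Hs s = {f. square_integrable f \<and>
              integrable lborel (\<lambda>\<xi>. (1 + \<xi>\<^sup>2) powr s * (cmod (fourier f \<xi>))\<^sup>2)}"

definition Hs_norm :: "real \<Rightarrow> (real \<Rightarrow> real) \<Rightarrow> real" where
  "Hs_norm s f = sqrt (LINT \<xi>|lborel. (1 + \<xi>\<^sup>2) powr s * (cmod (fourier f \<xi>))\<^sup>2)"

definition test_function :: "(real \<Rightarrow> real) \<Rightarrow> bool" where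
  "test_function \<phi> \<longleftrightarrow> (\<forall>k x. ((deriv ^^ k) \<phi>) differentiable at x) \<and> (\<exists>R. \<forall>x. \<bar>x\<bar> > R \<longrightarrow> \<phi> x = 0)"

text \<open>\<open>g\<close> is the distributional derivative of \<open>f\<close>.\<close>

definition weak_deriv :: "(real \<Rightarrow> real) \<Rightarrow> (real \<Rightarrow> real) \<Rightarrow> bool" where
  "weak_deriv f g \<longleftrightarrow>
     (\<forall>a b. set_integrable lborel {a..b} f \<and> set_integrable lborel {a..b} g) \<and>
     (\<forall>\<phi>. test_function \<phi> \<longrightarrow> (LINT x|lborel. f x * deriv \<phi> x) = - (LINT x|lborel. g x * \<phi> x))"

subsection \<open>Paths \<open>t \<mapsto> u(t)\<close> in Sobolev spaces\<close>

text \<open>\<open>u t x\<close> is the value at time \<open>t\<close> and position \<open>x\<close>.\<close>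

definition C_path :: "real set \<Rightarrow> real \<Rightarrow> (real \<Rightarrow> real \<Rightarrow> real) \<Rightarrow> bool" where
  "C_path I s u \<longleftrightarrow>
     (\<forall>t\<in>I. u t \<in> Hs s \<and> ((\<lambda>\<tau>. Hs_norm s (\<lambda>x. u \<tau> x - u t x)) \<longlongrightarrow> 0) (at t within I))"

text \<open>\<open>u\<close> is of class \<open>C\<^sup>1\<close> with values in \<open>H\<^sup>s\<close>, and \<open>u'\<close> is its time derivative.\<close>

definition C1_path :: "real set \<Rightarrow> real \<Rightarrow> (real \<Rightarrow> real \<Rightarrow> real) \<Rightarrow> (real \<Rightarrow> real \<Rightarrow> real) \<Rightarrow> bool" where
  "C1_path I s u u' \<longleftrightarrow> C_path I s u \<and> C_path I s u' \<and>
     (\<forall>t\<in>I. ((\<lambda>\<tau>. Hs_norm s (\<lambda>x. (u \<tau> x - u t x) / (\<tau> - t) - u' t x)) \<longlongrightarrow> 0) (at t within I))"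

subsection \<open>The kernel and the operator \<open>K\<^sub>\<delta>\<close>\<close>

text \<open>
  The kernel \<open>\<beta>\<close> is a finite (signed) Borel measure, given by its Jordan decomposition
  \<open>\<beta> = bp - bm\<close>, so that \<open>\<bar>\<beta>\<bar> = bp + bm\<close>.  An integrable function \<open>b\<close> is the special case
  in which \<open>bp\<close> and \<open>bm\<close> have its positive and negative parts as densities.
\<close>

definition finite_signed_measure :: "real measure \<Rightarrow> real measure \<Rightarrow> bool" where
  "finite_signed_measure bp bm \<longleftrightarrow> finite_borel_measure bp \<and> finite_borel_measure bm \<and>
     (\<exists>A\<in>sets borel. measure bp (- A) = 0 \<and> measure bm A = 0)"

definition even_kernel :: "real measure \<Rightarrow> real measure \<Rightarrow> bool" where
  "even_kernel bp bm \<longleftrightarrow>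
     (\<forall>A\<in>sets borel. measure bp (uminus ` A) - measure bm (uminus ` A) = measure bp A - measure bm A)"

text \<open>
  \<open>char M t\<close> is the integral of \<open>exp (i t x)\<close> with respect to \<open>M\<close>, whence the sign.  The transform
  of an even kernel is real, so that taking the real part loses nothing.
\<close>

definition kernel_hat :: "real measure \<Rightarrow> real measure \<Rightarrow> real \<Rightarrow> real" where
  "kernel_hat bp bm \<xi> = Re (char bp (- \<xi>) - char bm (- \<xi>))"

text \<open>\<open>g = K\<^sub>\<delta> f\<close>, the Fourier multiplier with symbol \<open>k(\<delta> \<xi>)\<close>, where \<open>k\<close> is the square root of the transform.\<close>

definition is_K :: "real measure \<Rightarrow> real measure \<Rightarrow> real \<Rightarrow> (real \<Rightarrow> real) \<Rightarrow> (real \<Rightarrow> real) \<Rightarrow> bool" where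
  "is_K bp bm \<delta> f g \<longleftrightarrow> square_integrable f \<and> square_integrable g \<and>
     (AE \<xi> in lborel. fourier g \<xi> = complex_of_real (sqrt (kernel_hat bp bm (\<delta> * \<xi>))) * fourier f \<xi>)"

text \<open>The case of an integrable kernel function \<open>b\<close>.\<close>

lemma
  fixes b :: "real \<Rightarrow> real"
  assumes b: "integrable lborel b"
  defines "bp \<equiv> density lborel (\<lambda>x. ennreal (b x))"
    and "bm \<equiv> density lborel (\<lambda>x. ennreal (- b x))"
  shows finite_signed_measure_density: "finite_signed_measure bp bm"
    and kernel_hat_density: "kernel_hat bp bm \<xi> =
      Re (CLINT x|lborel. complex_of_real (b x) * exp (- (\<i> * complex_of_real (\<xi> * x))))"
    and second_moment_density: "integrable bp (\<lambda>x. x\<^sup>2) \<and> integrable bm (\<lambda>x. x\<^sup>2) \<longleftrightarrow>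
      integrable lborel (\<lambda>x. x\<^sup>2 * \<bar>b x\<bar>)"
proof -
  have meas [measurable]: "b \<in> borel_measurable borel"
    using b by (auto dest: borel_measurable_integrable)
  have bp: "bp = density lborel (\<lambda>x. ennreal (max 0 (b x)))"
    unfolding bp_def by (intro density_cong) (auto simp: max_def ennreal_neg)
  have bm: "bm = density lborel (\<lambda>x. ennreal (max 0 (- b x)))"
    unfolding bm_def by (intro density_cong) (auto simp: max_def ennreal_neg)
  have ip: "integrable lborel (\<lambda>x. max 0 (b x))" and im: "integrable lborel (\<lambda>x. max 0 (- b x))"
    using b by auto
  have fin: "emeasure (density lborel (\<lambda>x. ennreal (max 0 (c x)))) UNIV \<noteq> \<infinity>"
    if "integrable lborel (\<lambda>x. max 0 (c x))" "c \<in> borel_measurable borel" for c :: "real \<Rightarrow> real"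
    using that by (subst emeasure_density) (auto simp: nn_integral_eq_integral dest: borel_measurable_integrable)
  define A where "A = {x. b x > 0}"
  have A [measurable]: "A \<in> sets borel"
    unfolding A_def by measurable
  have "emeasure bp (- A) = 0" "emeasure bm A = 0"
    unfolding bp_def bm_def
    by (subst emeasure_density; force simp: A_def nn_integral_0_iff_AE ennreal_neg indicator_def)+
  then have "measure bp (- A) = 0 \<and> measure bm A = 0"
    by (simp add: measure_def)
  moreover have "finite_borel_measure bp" "finite_borel_measure bm"
    using fin[OF ip] fin[OF im] meas unfolding bp bm
    by (auto intro!: finite_borel_measure.intro finite_measureI simp: finite_borel_measure_axioms_def)
  ultimately show "finite_signed_measure bp bm"
    using A unfolding finite_signed_measure_def by blast
  let ?e = "\<lambda>x. exp (- (\<i> * complex_of_real (\<xi> * x)))"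
  have e: "cmod (?e x) = 1" for x
    by simp
  have int: "integrable lborel (\<lambda>x. c x *\<^sub>R ?e x)" if "integrable lborel c" for c :: "real \<Rightarrow> real"
    using that by (rule Bochner_Integration.integrable_bound[where f = c]) (use that in \<open>auto simp: e dest: borel_measurable_integrable\<close>)
  have "char bp (- \<xi>) - char bm (- \<xi>) = (CLINT x|lborel. max 0 (b x) *\<^sub>R ?e x) - (CLINT x|lborel. max 0 (- b x) *\<^sub>R ?e x)"
    unfolding char_def bp bm by (subst (1 2) integral_density) auto
  also have "\<dots> = (CLINT x|lborel. max 0 (b x) *\<^sub>R ?e x - max 0 (- b x) *\<^sub>R ?e x)"
    by (rule Bochner_Integration.integral_diff[symmetric]) (rule int ip im)+
  also have "\<dots> = (CLINT x|lborel. complex_of_real (b x) * ?e x)"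
    by (intro Bochner_Integration.integral_cong) (auto simp: max_def scaleR_conv_of_real)
  finally show "kernel_hat bp bm \<xi> = Re (CLINT x|lborel. complex_of_real (b x) * ?e x)"
    unfolding kernel_hat_def by simp
  have "integrable bp (\<lambda>x. x\<^sup>2) \<longleftrightarrow> integrable lborel (\<lambda>x. max 0 (b x) * x\<^sup>2)"
    unfolding bp by (subst integrable_density) auto
  moreover have "integrable bm (\<lambda>x. x\<^sup>2) \<longleftrightarrow> integrable lborel (\<lambda>x. max 0 (- b x) * x\<^sup>2)"
    unfolding bm by (subst integrable_density) auto
  moreover have "integrable lborel (\<lambda>x. x\<^sup>2 * \<bar>b x\<bar>)"
    if "integrable lborel (\<lambda>x. max 0 (b x) * x\<^sup>2)" "integrable lborel (\<lambda>x. max 0 (- b x) * x\<^sup>2)"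
    using Bochner_Integration.integrable_add[OF that]
    by (rule Bochner_Integration.integrable_cong[THEN iffD1, rotated -1]) (auto simp: max_def)
  moreover have "integrable lborel (\<lambda>x. max 0 (b x) * x\<^sup>2)" "integrable lborel (\<lambda>x. max 0 (- b x) * x\<^sup>2)"
    if "integrable lborel (\<lambda>x. x\<^sup>2 * \<bar>b x\<bar>)"
    by (rule Bochner_Integration.integrable_bound[OF that];
        auto simp: max_def abs_mult mult_nonneg_nonpos)+
  ultimately show "integrable bp (\<lambda>x. x\<^sup>2) \<and> integrable bm (\<lambda>x. x\<^sup>2) \<longleftrightarrow>
      integrable lborel (\<lambda>x. x\<^sup>2 * \<bar>b x\<bar>)"
    by blast
qed

subsection \<open>The two systems\<close>

definition nonlocal_solution ::
    "real measure \<Rightarrow> real measure \<Rightarrow> nat \<Rightarrow> real \<Rightarrow> real \<Rightarrow> real set \<Rightarrow> real \<Rightarrow>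
     (real \<Rightarrow> real) \<Rightarrow> (real \<Rightarrow> real) \<Rightarrow> (real \<Rightarrow> real \<Rightarrow> real) \<Rightarrow> (real \<Rightarrow> real \<Rightarrow> real) \<Rightarrow> bool" where
  "nonlocal_solution bp bm n \<delta> \<epsilon> I \<sigma> u0 v0 u v \<longleftrightarrow>
     C_path I \<sigma> u \<and> C_path I \<sigma> v \<and>
     (\<exists>ut vt. C1_path I (\<sigma> - 1) u ut \<and> C1_path I (\<sigma> - 1) v vt \<and>
       (\<forall>t\<in>I. \<exists>vx wx.
          weak_deriv (v t) vx \<and> is_K bp bm \<delta> vx (ut t) \<and>
          weak_deriv (\<lambda>x. u t x + \<epsilon> ^ n * u t x ^ (n + 1)) wx \<and> is_K bp bm \<delta> wx (vt t))) \<and>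
     (AE x in lborel. u 0 x = u0 x) \<and> (AE x in lborel. v 0 x = v0 x)"

definition local_solution ::
    "nat \<Rightarrow> real \<Rightarrow> real set \<Rightarrow> real \<Rightarrow>
     (real \<Rightarrow> real) \<Rightarrow> (real \<Rightarrow> real) \<Rightarrow> (real \<Rightarrow> real \<Rightarrow> real) \<Rightarrow> (real \<Rightarrow> real \<Rightarrow> real) \<Rightarrow> bool" where
  "local_solution n \<epsilon> I \<sigma> u0 v0 u v \<longleftrightarrow>
     C_path I \<sigma> u \<and> C_path I \<sigma> v \<and>
     (\<exists>ut vt. C1_path I (\<sigma> - 1) u ut \<and> C1_path I (\<sigma> - 1) v vt \<and>
       (\<forall>t\<in>I. \<exists>vx ux.
          weak_deriv (v t) vx \<and> (AE x in lborel. ut t x = vx x) \<and>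
          weak_deriv (u t) ux \<and>
          (AE x in lborel. vt t x = (1 + real (n + 1) * \<epsilon> ^ n * u t x ^ n) * ux x))) \<and>
     (AE x in lborel. u 0 x = u0 x) \<and> (AE x in lborel. v 0 x = v0 x)"

text \<open>
  A constant independent of \<open>\<delta>\<close> and \<open>\<epsilon>\<close> can only depend on the solutions, which vary with \<open>\<delta>\<close> and \<open>\<epsilon>\<close>,
  through a bound \<open>M\<close> for their norms.  A single solution is always bounded on a compact \<open>I\<close>.
\<close>

definition Hs_bounded :: "real set \<Rightarrow> real \<Rightarrow> real \<Rightarrow> (real \<Rightarrow> real \<Rightarrow> real) \<Rightarrow> bool" where
  "Hs_bounded I \<sigma> M u \<longleftrightarrow> (\<forall>t\<in>I. Hs_norm \<sigma> (u t) \<le> M)"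

end

theory Submission
  imports Defs
begin

text \<open>
  All estimates take place on the Fourier side.  Let \<open>U\<close>, \<open>V\<close> be the differences of the two solutions,
  \<open>r = s - 1\<close>, and \<open>u\<delta>\<^sup>n\<^sup>+\<^sup>1 - u\<^sup>n\<^sup>+\<^sup>1 = w U\<close>.  With \<open>A = \<langle>D\<rangle>\<^sup>r U\<close> and \<open>B = \<langle>D\<rangle>\<^sup>r V\<close>, the energy
  \<open>E = \<parallel>A\<parallel>\<^sup>2 + \<parallel>B\<parallel>\<^sup>2 + \<epsilon>\<^sup>n \<langle>A, w A\<rangle>\<close> is equivalent to \<open>\<parallel>A\<parallel>\<^sup>2 + \<parallel>B\<parallel>\<^sup>2\<close> for small \<open>\<epsilon>\<close>.
  In its derivative the terms of highest order cancel because the symbol \<open>i \<xi> k(\<delta> \<xi>)\<close> is imaginary,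
  up to a commutator of \<open>w\<close> and \<open>\<langle>D\<rangle>\<^sup>r\<close>, which gains one derivative.  The consistency error is
  \<open>O(\<delta>\<^sup>\<theta>)\<close> in \<open>H\<^sup>r\<close> because \<open>\<bar>k(\<zeta>) - 1\<bar> \<le> C \<bar>\<zeta>\<bar>\<^sup>\<theta>\<close>.  Hence \<open>E' \<le> C \<delta>\<^sup>\<theta> \<surd>E + C \<epsilon>\<^sup>n E\<close>,
  and a Gronwall argument for \<open>\<surd>E\<close> concludes.
  The weak derivative \<open>u\<^sub>x\<close> of the local system, a priori only locally integrable, is square integrable because
  the factor \<open>1 + (n + 1) \<epsilon>\<^sup>n u\<^sup>n\<close> is bounded away from zero for small \<open>\<epsilon>\<close>.
\<close>

subsection \<open>The Hilbert space of square integrable functions\<close>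

text \<open>The comparison takes place in H^(s-1) because the consistency error, with symbol
  \<open>(k (\<delta> \<xi>) - 1) i \<xi>\<close>, costs one derivative for the factor \<xi> and
  \<theta> further ones for the rate; this uses up the regularity s + \<theta>. The linear part is
  skew, so every term of E' that is quadratic in (A, B) carries \<epsilon>^n, which is how
  \<epsilon>^n enters the exponent. The obstacle is the pairing of U_t with the commutator: up to
  the consistency error, the energy controls U_t only in H^(r-1) uniformly in \<delta>, and the
  gained derivative compensates exactly this loss. The time derivative of w is bounded without any
  assumed bound on time derivatives: it is read off from the equations, whose symbols are at most a
  constant times |\<xi>|, uniformly in \<delta>. The two smallness conditions on \<epsilon>, for the
  coercivity of E and for the coefficient of u_x, depend only on M, n and s. L^2 is made a type of
  class \<open>real_inner\<close> and \<open>banach\<close>; products and commutators become bounded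
  bilinear maps on it, so that E can be differentiated by the product rule.\<close>

lemma sqi_measurable_borel [measurable_dest]: "square_integrable f \<Longrightarrow> f \<in> borel_measurable borel"
  by (simp add: square_integrable_def)

lemma sqi_integrable: "square_integrable f \<Longrightarrow> integrable lborel (\<lambda>x. (norm (f x))\<^sup>2)"
  by (simp add: square_integrable_def)

lemma sqi_bound:
  fixes f :: "real \<Rightarrow> 'a::{banach, second_countable_topology}"
    and g :: "real \<Rightarrow> 'b::{banach, second_countable_topology}"
  assumes f: "square_integrable f" and g: "g \<in> borel_measurable borel"
    and le: "AE x in lborel. norm (g x) \<le> c * norm (f x)"
  shows "square_integrable g"
  unfolding square_integrable_def
proof
  show "integrable lborel (\<lambda>x. (norm (g x))\<^sup>2)"
  proof (rule Bochner_Integration.integrable_bound)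
    show "integrable lborel (\<lambda>x. c\<^sup>2 * (norm (f x))\<^sup>2)"
      using sqi_integrable[OF f] by simp
    show "AE x in lborel. norm ((norm (g x))\<^sup>2) \<le> norm (c\<^sup>2 * (norm (f x))\<^sup>2)"
      using le
    proof eventually_elim
      case (elim x)
      have "(norm (g x))\<^sup>2 \<le> (c * norm (f x))\<^sup>2"
        using elim by (intro power_mono) auto
      then show ?case by (simp add: power_mult_distrib)
    qed
  qed (use g in measurable)
qed (use g in simp)

lemma sqi_cong_AE:
  fixes f g :: "real \<Rightarrow> 'a::{banach, second_countable_topology}"
  assumes "square_integrable f" "g \<in> borel_measurable borel" "AE x in lborel. f x = g x"
  shows "square_integrable g"
  by (rule sqi_bound[OF assms(1,2), where c = 1]) (use assms(3) in auto)

lemma sqi_norm: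
  fixes f :: "real \<Rightarrow> 'a::{banach, second_countable_topology}"
  assumes "square_integrable f"
  shows "square_integrable (\<lambda>x. norm (f x))"
  by (rule sqi_bound[OF assms, where c = 1]) (use assms in auto)

lemma sqi_zero [simp]: "square_integrable (\<lambda>x. 0)"
  by (simp add: square_integrable_def)

lemma sqi_scaleR:
  fixes f :: "real \<Rightarrow> 'a::{banach, second_countable_topology}"
  assumes "square_integrable f"
  shows "square_integrable (\<lambda>x. a *\<^sub>R f x)"
  by (rule sqi_bound[OF assms, where c = "\<bar>a\<bar>"]) (use assms in auto)

lemma sqi_mult_const:
  fixes f :: "real \<Rightarrow> 'a::{banach, second_countable_topology, real_normed_div_algebra}"
  assumes "square_integrable f"
  shows "square_integrable (\<lambda>x. a * f x)"
  by (rule sqi_bound[OF assms, where c = "norm a"]) (use assms in \<open>auto simp: norm_mult\<close>)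

lemma sqi_uminus:
  fixes f :: "real \<Rightarrow> 'a::{banach, second_countable_topology}"
  assumes "square_integrable f"
  shows "square_integrable (\<lambda>x. - f x)"
  using sqi_scaleR[OF assms, of "-1"] by simp

lemma sqi_add:
  fixes f g :: "real \<Rightarrow> 'a::{banach, second_countable_topology}"
  assumes f: "square_integrable f" and g: "square_integrable g"
  shows "square_integrable (\<lambda>x. f x + g x)"
  unfolding square_integrable_def
proof
  have [measurable]: "f \<in> borel_measurable borel" "g \<in> borel_measurable borel"
    using f g by auto
  show "(\<lambda>x. f x + g x) \<in> borel_measurable lborel" by measurable
  show "integrable lborel (\<lambda>x. (norm (f x + g x))\<^sup>2)"
  proof (rule Bochner_Integration.integrable_bound)
    show "integrable lborel (\<lambda>x. 2 * (norm (f x))\<^sup>2 + 2 * (norm (g x))\<^sup>2)"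
      using sqi_integrable[OF f] sqi_integrable[OF g] by simp
    have "(norm (f x + g x))\<^sup>2 \<le> 2 * (norm (f x))\<^sup>2 + 2 * (norm (g x))\<^sup>2" for x
    proof -
      have "(norm (f x + g x))\<^sup>2 \<le> (norm (f x) + norm (g x))\<^sup>2"
        by (intro power_mono norm_triangle_ineq) auto
      moreover have "0 \<le> (norm (f x) - norm (g x))\<^sup>2" by simp
      ultimately show ?thesis
        by (simp add: power2_sum power2_diff)
    qed
    then show "AE x in lborel. norm ((norm (f x + g x))\<^sup>2) \<le> norm (2 * (norm (f x))\<^sup>2 + 2 * (norm (g x))\<^sup>2)"
      by auto
  qed measurable
qed

lemma sqi_diff:
  fixes f g :: "real \<Rightarrow> 'a::{banach, second_countable_topology}"
  assumes f: "square_integrable f" and g: "square_integrable g"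
  shows "square_integrable (\<lambda>x. f x - g x)"
  using sqi_add[OF f sqi_uminus[OF g]] by simp

lemma sqi_norm_mult_integrable:
  fixes f :: "real \<Rightarrow> 'a::{banach, second_countable_topology}"
    and g :: "real \<Rightarrow> 'b::{banach, second_countable_topology}"
  assumes f: "square_integrable f" and g: "square_integrable g"
  shows "integrable lborel (\<lambda>x. norm (f x) * norm (g x))"
proof (rule Bochner_Integration.integrable_bound)
  have [measurable]: "f \<in> borel_measurable borel" "g \<in> borel_measurable borel"
    using f g by auto
  show "integrable lborel (\<lambda>x. (norm (f x))\<^sup>2 + (norm (g x))\<^sup>2)"
    using sqi_integrable[OF f] sqi_integrable[OF g] by simp
  have "norm (f x) * norm (g x) \<le> (norm (f x))\<^sup>2 + (norm (g x))\<^sup>2" for x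
  proof -
    have "0 \<le> (norm (f x) - norm (g x))\<^sup>2 + (norm (f x))\<^sup>2 + (norm (g x))\<^sup>2" by simp
    then show ?thesis by (simp add: power2_diff)
  qed
  then show "AE x in lborel. norm (norm (f x) * norm (g x)) \<le> norm ((norm (f x))\<^sup>2 + (norm (g x))\<^sup>2)"
    by auto
  show "(\<lambda>x. norm (f x) * norm (g x)) \<in> borel_measurable lborel" by measurable
qed

lemma sqi_mult_integrable:
  fixes f g :: "real \<Rightarrow> 'a::{banach, second_countable_topology, real_normed_div_algebra}"
  assumes f: "square_integrable f" and g: "square_integrable g"
  shows "integrable lborel (\<lambda>x. f x * g x)"
proof -
  have [measurable]: "f \<in> borel_measurable borel" "g \<in> borel_measurable borel"
    using f g by auto
  show ?thesis
    by (rule Bochner_Integration.integrable_bound[OF sqi_norm_mult_integrable[OF f g]])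
      (auto simp: norm_mult)
qed

lemma sqi_inner_integrable:
  fixes f g :: "real \<Rightarrow> 'a::{banach, second_countable_topology, real_inner}"
  assumes f: "square_integrable f" and g: "square_integrable g"
  shows "integrable lborel (\<lambda>x. f x \<bullet> g x)"
proof -
  have [measurable]: "f \<in> borel_measurable borel" "g \<in> borel_measurable borel"
    using f g by auto
  show ?thesis
    by (rule Bochner_Integration.integrable_bound[OF sqi_norm_mult_integrable[OF f g]])
      (auto simp: Cauchy_Schwarz_ineq2)
qed

\<comment> \<open>The relation is partial: exactly the square integrable functions are related to
  themselves, so the type consists of their classes modulo null sets. The values are complex because
  transforms live here, but the space is real: \<open>inner\<close> on complex numbers is the real
  part of the Hermitian product, and multiplication by an imaginary symbol is skew for it.\<close>
quotient_type l2 = "real \<Rightarrow> complex" / partial: "\<lambda>f g. square_integrable f \<and> square_integrable g \<and> (AE x in lborel. f x = g x)"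
proof (rule part_equivpI)
  show "\<exists>x. square_integrable x \<and> square_integrable x \<and> (AE xa in lborel. x xa = (x xa :: complex))"
    by (rule exI[of _ "\<lambda>x. 0"]) auto
  show "symp (\<lambda>f g. square_integrable f \<and> square_integrable g \<and> (AE x in lborel. f x = (g x :: complex)))"
    by (auto simp: symp_def)
  show "transp (\<lambda>f g. square_integrable f \<and> square_integrable g \<and> (AE x in lborel. f x = (g x :: complex)))"
    by (auto simp: transp_def elim!: eventually_rev_mp)
qed

instantiation l2 :: real_inner
begin

lift_definition zero_l2 :: l2 is "\<lambda>x. 0" by simp

lift_definition plus_l2 :: "l2 \<Rightarrow> l2 \<Rightarrow> l2" is "\<lambda>f g x. f x + g x"
  by (auto intro: sqi_add elim!: eventually_rev_mp)

lift_definition uminus_l2 :: "l2 \<Rightarrow> l2" is "\<lambda>f x. - f x"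
  by (auto intro: sqi_uminus)

lift_definition minus_l2 :: "l2 \<Rightarrow> l2 \<Rightarrow> l2" is "\<lambda>f g x. f x - g x"
  by (auto intro: sqi_diff elim!: eventually_rev_mp)

lift_definition scaleR_l2 :: "real \<Rightarrow> l2 \<Rightarrow> l2" is "\<lambda>a f x. a *\<^sub>R f x"
  by (metis (mono_tags, lifting) sqi_scaleR eventually_mono)

lift_definition inner_l2 :: "l2 \<Rightarrow> l2 \<Rightarrow> real" is "\<lambda>f g. LINT x|lborel. f x \<bullet> g x"
  by (intro integral_cong_AE) (auto elim!: eventually_rev_mp)

definition norm_l2 :: "l2 \<Rightarrow> real" where "norm_l2 f = sqrt (f \<bullet> f)"
definition dist_l2 :: "l2 \<Rightarrow> l2 \<Rightarrow> real" where "dist_l2 f g = norm (f - g)"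
definition sgn_l2 :: "l2 \<Rightarrow> l2" where "sgn_l2 f = inverse (norm f) *\<^sub>R f"
definition uniformity_l2 :: "(l2 \<times> l2) filter"
  where "uniformity_l2 = (INF e\<in>{0 <..}. principal {(x, y). dist x y < e})"
definition open_l2 :: "l2 set \<Rightarrow> bool"
  where "open_l2 U = (\<forall>x\<in>U. eventually (\<lambda>(x', y). x' = x \<longrightarrow> y \<in> U) uniformity)"

instance
proof
  fix a b c :: l2 and r s :: real
  show "a + b + c = a + (b + c)"
    by transfer (auto intro!: sqi_add simp: add.assoc)
  show "a + b = b + a"
    by transfer (auto intro!: sqi_add simp: add.commute)
  show "0 + a = a"
    by transfer (auto intro!: sqi_add)
  show "- a + a = 0"
    by transfer (auto intro!: sqi_add)
  show "a - b = a + - b"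
    by transfer (auto intro!: sqi_add sqi_diff sqi_uminus)
  show "r *\<^sub>R (a + b) = r *\<^sub>R a + r *\<^sub>R b"
    by transfer (auto intro!: sqi_add sqi_scaleR simp: algebra_simps)
  show "(r + s) *\<^sub>R a = r *\<^sub>R a + s *\<^sub>R a"
    by transfer (auto intro!: sqi_add sqi_scaleR simp: algebra_simps)
  show "r *\<^sub>R s *\<^sub>R a = (r * s) *\<^sub>R a"
    by transfer (auto intro!: sqi_add sqi_scaleR simp: algebra_simps)
  show "1 *\<^sub>R a = a"
    by transfer (auto intro!: sqi_add sqi_scaleR simp: algebra_simps)
  show "dist a b = norm (a - b)" by (rule dist_l2_def)
  show "sgn a = inverse (norm a) *\<^sub>R a" by (rule sgn_l2_def)
  show "uniformity = (INF e\<in>{0 <..}. principal {(x, y::l2). dist x y < e})"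
    by (rule uniformity_l2_def)
  show "open U \<longleftrightarrow> (\<forall>x\<in>U. eventually (\<lambda>(x', y). x' = x \<longrightarrow> y \<in> U) uniformity)" for U :: "l2 set"
    by (rule open_l2_def)
  show "a \<bullet> b = b \<bullet> a"
    by transfer (simp add: inner_commute)
  show "(a + b) \<bullet> c = a \<bullet> c + b \<bullet> c"
    by transfer (simp add: inner_add_left sqi_inner_integrable)
  show "(r *\<^sub>R a) \<bullet> b = r * (a \<bullet> b)"
    by transfer simp
  show "0 \<le> a \<bullet> a"
    by transfer (auto intro!: integral_nonneg_AE)
  show "a \<bullet> a = 0 \<longleftrightarrow> a = 0"
  proof transfer
    fix f g :: "real \<Rightarrow> complex"
    assume "square_integrable f \<and> square_integrable g \<and> (AE x in lborel. f x = g x)"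
    then have f: "square_integrable f" by simp
    have "(LINT x|lborel. f x \<bullet> f x) = 0 \<longleftrightarrow> (AE x in lborel. f x \<bullet> f x = 0)"
      using f by (intro integral_nonneg_eq_0_iff_AE) (auto intro: sqi_inner_integrable)
    then show "((LINT x|lborel. f x \<bullet> f x) = 0) =
      (square_integrable f \<and> square_integrable (\<lambda>x. 0 :: complex) \<and> (AE x in lborel. f x = 0))"
      using f by simp
  qed
  show "norm a = sqrt (a \<bullet> a)" by (rule norm_l2_def)
qed

end

lemma rep_l2_sqi [simp]: "square_integrable (rep_l2 f)"
  using Quotient_rep_reflp[OF Quotient_l2] by blast

lemma abs_rep_l2 [simp]: "abs_l2 (rep_l2 f) = f"
  using Quotient_abs_rep[OF Quotient_l2] by blast

lemma abs_l2_eq_iff: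
  "square_integrable f \<Longrightarrow> square_integrable g \<Longrightarrow> abs_l2 f = abs_l2 g \<longleftrightarrow> (AE x in lborel. f x = g x)"
  using Quotient_rel[OF Quotient_l2, of f g] by auto

lemma abs_l2_eqI:
  "square_integrable f \<Longrightarrow> square_integrable g \<Longrightarrow> AE x in lborel. f x = g x \<Longrightarrow> abs_l2 f = abs_l2 g"
  by (simp add: abs_l2_eq_iff)

lemma rep_abs_l2: "square_integrable f \<Longrightarrow> AE x in lborel. rep_l2 (abs_l2 f) x = f x"
  using abs_l2_eq_iff[of "rep_l2 (abs_l2 f)" f] by simp

lemma abs_l2_add: "square_integrable f \<Longrightarrow> square_integrable g \<Longrightarrow>
    abs_l2 f + abs_l2 g = abs_l2 (\<lambda>x. f x + g x)"
  by (rule plus_l2.abs_eq) auto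

lemma abs_l2_diff: "square_integrable f \<Longrightarrow> square_integrable g \<Longrightarrow>
    abs_l2 f - abs_l2 g = abs_l2 (\<lambda>x. f x - g x)"
  by (rule minus_l2.abs_eq) auto

lemma abs_l2_scaleR: "square_integrable f \<Longrightarrow> a *\<^sub>R abs_l2 f = abs_l2 (\<lambda>x. a *\<^sub>R f x)"
  by (rule scaleR_l2.abs_eq) auto

lemma abs_l2_inner: "square_integrable f \<Longrightarrow> square_integrable g \<Longrightarrow>
    abs_l2 f \<bullet> abs_l2 g = (LINT x|lborel. f x \<bullet> g x)"
  by (rule inner_l2.abs_eq) auto

lemma abs_l2_norm: "square_integrable f \<Longrightarrow> norm (abs_l2 f) = sqrt (LINT x|lborel. (norm (f x))\<^sup>2)"
  by (simp add: norm_eq_sqrt_inner abs_l2_inner power2_norm_eq_inner)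

lemma abs_l2_norm_le:
  assumes f: "square_integrable f" and g: "g \<in> borel_measurable borel"
    and le: "AE x in lborel. norm (g x) \<le> c * norm (f x)" and c: "0 \<le> c"
  shows "norm (abs_l2 g) \<le> c * norm (abs_l2 f)"
proof -
  have sg: "square_integrable g" by (rule sqi_bound[OF f g le])
  have "(LINT x|lborel. (norm (g x))\<^sup>2) \<le> (LINT x|lborel. c\<^sup>2 * (norm (f x))\<^sup>2)"
  proof (rule integral_mono_AE)
    show "AE x in lborel. (norm (g x))\<^sup>2 \<le> c\<^sup>2 * (norm (f x))\<^sup>2"
      using le
    proof eventually_elim
      case (elim x)
      have "(norm (g x))\<^sup>2 \<le> (c * norm (f x))\<^sup>2"
        using elim by (intro power_mono) auto
      then show ?case by (simp add: power_mult_distrib)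
    qed
  qed (use sqi_integrable[OF f] sqi_integrable[OF sg] in auto)
  then have "sqrt (LINT x|lborel. (norm (g x))\<^sup>2) \<le> sqrt (c\<^sup>2 * (LINT x|lborel. (norm (f x))\<^sup>2))"
    by simp
  then show ?thesis
    using c by (simp add: abs_l2_norm f sg real_sqrt_mult)
qed

lemma abs_l2_norm_mono:
  "square_integrable f \<Longrightarrow> g \<in> borel_measurable borel \<Longrightarrow> AE x in lborel. norm (g x) \<le> norm (f x) \<Longrightarrow>
   norm (abs_l2 g) \<le> norm (abs_l2 f)"
  using abs_l2_norm_le[of f g 1] by simp

subsection \<open>Convolution and weights\<close>

lemma measurable_cnj [measurable (raw)]:
  "f \<in> borel_measurable M \<Longrightarrow> (\<lambda>x. cnj (f x)) \<in> borel_measurable M"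
  by (rule borel_measurable_continuous_on[where f = cnj]) (intro continuous_intros)

lemma sqi_of_real:
  fixes f :: "real \<Rightarrow> real"
  assumes "square_integrable f"
  shows "square_integrable (\<lambda>x. complex_of_real (f x))"
  by (rule sqi_bound[OF assms, where c = 1]) (use assms in auto)

definition conv :: "(real \<Rightarrow> 'a) \<Rightarrow> (real \<Rightarrow> 'a) \<Rightarrow> real \<Rightarrow> 'a::{banach, second_countable_topology, real_normed_field}"
  where "conv f g \<xi> = (LINT \<eta>|lborel. f (\<xi> - \<eta>) * g \<eta>)"

lemma sqi_reflect:
  fixes f :: "real \<Rightarrow> 'a::{banach, second_countable_topology}"
  assumes "square_integrable f"
  shows "square_integrable (\<lambda>\<eta>. f (\<xi> - \<eta>))"
proof -
  have [measurable]: "f \<in> borel_measurable borel" using assms by simp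
  show ?thesis
    using lborel_integrable_real_affine[OF sqi_integrable[OF assms], of "-1" \<xi>]
    by (simp add: square_integrable_def)
qed

lemma AE_reflect:
  assumes "AE x in lborel. f x = g x" and [measurable]: "f \<in> borel_measurable borel" "g \<in> borel_measurable borel"
  shows "AE x in lborel. f (\<xi> - x :: real) = (g (\<xi> - x) :: 'a::{second_countable_topology, t2_space})"
  using AE_borel_affine[of "-1" "\<lambda>x. f x = g x" \<xi>] assms by simp

lemma conv_integrable:
  fixes f g :: "real \<Rightarrow> 'a::{banach, second_countable_topology, real_normed_field}"
  shows "square_integrable f \<Longrightarrow> square_integrable g \<Longrightarrow> integrable lborel (\<lambda>\<eta>. f (\<xi> - \<eta>) * g \<eta>)"
  by (intro sqi_mult_integrable sqi_reflect)

lemma conv_measurable [measurable]: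
  fixes f g :: "real \<Rightarrow> 'a::{banach, second_countable_topology, real_normed_field}"
  assumes [measurable]: "f \<in> borel_measurable borel" "g \<in> borel_measurable borel"
  shows "conv f g \<in> borel_measurable borel"
proof -
  have "(\<lambda>\<xi>. LINT \<eta>|lborel. f (\<xi> - \<eta>) * g \<eta>) \<in> borel_measurable borel"
    by (rule lborel.borel_measurable_lebesgue_integral) measurable
  then show ?thesis
    unfolding conv_def[abs_def] .
qed

lemma conv_diff_right:
  fixes f g h :: "real \<Rightarrow> 'a::{banach, second_countable_topology, real_normed_field}"
  assumes "square_integrable f" "square_integrable g" "square_integrable h"
  shows "conv f (\<lambda>x. g x - h x) \<xi> = conv f g \<xi> - conv f h \<xi>"
  unfolding conv_def by (simp add: right_diff_distrib conv_integrable assms)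

lemma conv_norm_le_nn:
  fixes f g :: "real \<Rightarrow> 'a::{banach, second_countable_topology, real_normed_field}"
  shows "ennreal (norm (conv f g \<xi>)) \<le> (\<integral>\<^sup>+\<eta>. ennreal (norm (f (\<xi> - \<eta>))) * ennreal (norm (g \<eta>)) \<partial>lborel)"
proof (cases "integrable lborel (\<lambda>\<eta>. f (\<xi> - \<eta>) * g \<eta>)")
  case True
  from integral_norm_bound_ennreal[OF this] show ?thesis
    by (simp add: conv_def norm_mult ennreal_mult)
next
  \<comment> \<open>A Bochner integral that does not exist has the value 0, so the bound holds at
    every \<open>\<xi>\<close>.\<close>
  case False
  then show ?thesis by (simp add: conv_def not_integrable_integral_eq)
qed

text \<open>Cauchy-Schwarz with \<open>F = sqrt F * sqrt F\<close> bounds the squared inner integral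
  by the mass of \<open>F\<close> times the integral of \<open>F * G\<^sup>2\<close>; Tonelli then
  produces the second mass of \<open>F\<close>. With extended integrals, integrability of the
  convolution comes out as a conclusion.\<close>

lemma young_nn:
  fixes F G :: "real \<Rightarrow> real"
  assumes [measurable]: "F \<in> borel_measurable borel" "G \<in> borel_measurable borel"
    and nonneg: "\<And>x. 0 \<le> F x" "\<And>x. 0 \<le> G x"
  shows "(\<integral>\<^sup>+\<xi>. (\<integral>\<^sup>+\<eta>. ennreal (F (\<xi> - \<eta>)) * ennreal (G \<eta>) \<partial>lborel)\<^sup>2 \<partial>lborel)
    \<le> (\<integral>\<^sup>+x. ennreal (F x) \<partial>lborel)\<^sup>2 * (\<integral>\<^sup>+x. (ennreal (G x))\<^sup>2 \<partial>lborel)"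
proof -
  let ?A = "\<integral>\<^sup>+x. ennreal (F x) \<partial>lborel"
  have A: "(\<integral>\<^sup>+\<eta>. ennreal (F (\<xi> - \<eta>)) \<partial>lborel) = ?A" for \<xi>
    using nn_integral_real_affine[of "\<lambda>x. ennreal (F x)" "-1" \<xi>] by simp
  have A': "(\<integral>\<^sup>+\<xi>. ennreal (F (\<xi> - \<eta>)) \<partial>lborel) = ?A" for \<eta>
    using nn_integral_real_affine[of "\<lambda>x. ennreal (F x)" "1" "-\<eta>"] by simp
  have sq: "ennreal (sqrt (F x)) * ennreal (sqrt (F x)) = ennreal (F x)" for x
    using nonneg by (simp flip: ennreal_mult)
  have "(\<integral>\<^sup>+\<eta>. ennreal (F (\<xi> - \<eta>)) * ennreal (G \<eta>) \<partial>lborel)\<^sup>2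
      \<le> ?A * (\<integral>\<^sup>+\<eta>. ennreal (F (\<xi> - \<eta>)) * (ennreal (G \<eta>))\<^sup>2 \<partial>lborel)" for \<xi>
  proof -
    have "(\<integral>\<^sup>+\<eta>. ennreal (F (\<xi> - \<eta>)) * ennreal (G \<eta>) \<partial>lborel)\<^sup>2
        = (\<integral>\<^sup>+\<eta>. ennreal (sqrt (F (\<xi> - \<eta>))) * (ennreal (sqrt (F (\<xi> - \<eta>))) * ennreal (G \<eta>)) \<partial>lborel)\<^sup>2"
      by (simp add: sq flip: mult.assoc)
    also have "\<dots> \<le> (\<integral>\<^sup>+\<eta>. (ennreal (sqrt (F (\<xi> - \<eta>))))\<^sup>2 \<partial>lborel)
        * (\<integral>\<^sup>+\<eta>. (ennreal (sqrt (F (\<xi> - \<eta>))) * ennreal (G \<eta>))\<^sup>2 \<partial>lborel)"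
      by (rule Cauchy_Schwarz_nn_integral) measurable
    also have "\<dots> = ?A * (\<integral>\<^sup>+\<eta>. ennreal (F (\<xi> - \<eta>)) * (ennreal (G \<eta>))\<^sup>2 \<partial>lborel)"
      by (simp add: power_mult_distrib power2_eq_square[of "ennreal (sqrt _)"] sq A)
    finally show ?thesis .
  qed
  then have "(\<integral>\<^sup>+\<xi>. (\<integral>\<^sup>+\<eta>. ennreal (F (\<xi> - \<eta>)) * ennreal (G \<eta>) \<partial>lborel)\<^sup>2 \<partial>lborel)
      \<le> (\<integral>\<^sup>+\<xi>. ?A * (\<integral>\<^sup>+\<eta>. ennreal (F (\<xi> - \<eta>)) * (ennreal (G \<eta>))\<^sup>2 \<partial>lborel) \<partial>lborel)"
    by (intro nn_integral_mono)
  also have "\<dots> = ?A * (\<integral>\<^sup>+\<xi>. (\<integral>\<^sup>+\<eta>. ennreal (F (\<xi> - \<eta>)) * (ennreal (G \<eta>))\<^sup>2 \<partial>lborel) \<partial>lborel)"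
    by (rule nn_integral_cmult) measurable
  also have "(\<integral>\<^sup>+\<xi>. (\<integral>\<^sup>+\<eta>. ennreal (F (\<xi> - \<eta>)) * (ennreal (G \<eta>))\<^sup>2 \<partial>lborel) \<partial>lborel)
      = (\<integral>\<^sup>+\<eta>. (\<integral>\<^sup>+\<xi>. ennreal (F (\<xi> - \<eta>)) * (ennreal (G \<eta>))\<^sup>2 \<partial>lborel) \<partial>lborel)"
    by (rule lborel_pair.Fubini') measurable
  also have "\<dots> = ?A * (\<integral>\<^sup>+\<eta>. (ennreal (G \<eta>))\<^sup>2 \<partial>lborel)"
    by (simp add: nn_integral_multc A' nn_integral_cmult)
  finally show ?thesis
    by (simp add: power2_eq_square mult.assoc)
qed

lemma young_sqi:
  fixes f g :: "real \<Rightarrow> 'a::{banach, second_countable_topology, real_normed_field}"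
  assumes f: "integrable lborel f" and g: "square_integrable g"
  shows "square_integrable (conv f g)"
    and "(LINT \<xi>|lborel. (norm (conv f g \<xi>))\<^sup>2) \<le> (LINT x|lborel. norm (f x))\<^sup>2 * (LINT x|lborel. (norm (g x))\<^sup>2)"
proof -
  have [measurable]: "f \<in> borel_measurable borel" "g \<in> borel_measurable borel"
    using f g by auto
  have nf: "(\<integral>\<^sup>+x. ennreal (norm (f x)) \<partial>lborel) = ennreal (LINT x|lborel. norm (f x))"
    using f by (intro nn_integral_eq_integral) auto
  have ng: "(\<integral>\<^sup>+x. (ennreal (norm (g x)))\<^sup>2 \<partial>lborel) = ennreal (LINT x|lborel. (norm (g x))\<^sup>2)"
    using sqi_integrable[OF g] by (simp add: ennreal_power nn_integral_eq_integral)
  have le: "(\<integral>\<^sup>+\<xi>. ennreal ((norm (conv f g \<xi>))\<^sup>2) \<partial>lborel)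
      \<le> ennreal ((LINT x|lborel. norm (f x))\<^sup>2 * (LINT x|lborel. (norm (g x))\<^sup>2))"
  proof -
    have "(\<integral>\<^sup>+\<xi>. ennreal ((norm (conv f g \<xi>))\<^sup>2) \<partial>lborel)
        \<le> (\<integral>\<^sup>+\<xi>. (\<integral>\<^sup>+\<eta>. ennreal (norm (f (\<xi> - \<eta>))) * ennreal (norm (g \<eta>)) \<partial>lborel)\<^sup>2 \<partial>lborel)"
    proof (rule nn_integral_mono)
      fix \<xi>
      have "ennreal ((norm (conv f g \<xi>))\<^sup>2) = (ennreal (norm (conv f g \<xi>)))\<^sup>2"
        by (simp add: ennreal_power)
      also have "\<dots> \<le> (\<integral>\<^sup>+\<eta>. ennreal (norm (f (\<xi> - \<eta>))) * ennreal (norm (g \<eta>)) \<partial>lborel)\<^sup>2"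
        by (intro power_mono conv_norm_le_nn) auto
      finally show "ennreal ((norm (conv f g \<xi>))\<^sup>2) \<le> \<dots>" .
    qed
    also have "\<dots> \<le> (\<integral>\<^sup>+x. ennreal (norm (f x)) \<partial>lborel)\<^sup>2 * (\<integral>\<^sup>+x. (ennreal (norm (g x)))\<^sup>2 \<partial>lborel)"
      by (rule young_nn) auto
    also have "\<dots> = ennreal ((LINT x|lborel. norm (f x))\<^sup>2 * (LINT x|lborel. (norm (g x))\<^sup>2))"
      unfolding nf ng by (simp add: ennreal_power ennreal_mult)
    finally show ?thesis .
  qed
  show sq: "square_integrable (conv f g)"
    unfolding square_integrable_def
  proof
    show "integrable lborel (\<lambda>x. (norm (conv f g x))\<^sup>2)"
      unfolding integrable_iff_bounded
      using le_less_trans[OF le ennreal_less_top] by simp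
  qed simp
  show "(LINT \<xi>|lborel. (norm (conv f g \<xi>))\<^sup>2) \<le> (LINT x|lborel. norm (f x))\<^sup>2 * (LINT x|lborel. (norm (g x))\<^sup>2)"
    using le by (subst (asm) nn_integral_eq_integral) (auto simp: sqi_integrable[OF sq] ennreal_le_iff)
qed

lemma young:
  fixes f g :: "real \<Rightarrow> complex"
  assumes f: "integrable lborel f" and g: "square_integrable g"
  shows "norm (abs_l2 (conv f g)) \<le> (LINT x|lborel. norm (f x)) * norm (abs_l2 g)"
proof -
  have "sqrt (LINT \<xi>|lborel. (norm (conv f g \<xi>))\<^sup>2)
      \<le> sqrt ((LINT x|lborel. norm (f x))\<^sup>2 * (LINT x|lborel. (norm (g x))\<^sup>2))"
    by (intro real_sqrt_le_mono young_sqi f g)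
  then show ?thesis
    by (simp add: abs_l2_norm young_sqi f g real_sqrt_mult)
qed

lemma conv_commute:
  fixes f g :: "real \<Rightarrow> 'a::{banach, second_countable_topology, real_normed_field}"
  shows "conv f g \<xi> = conv g f \<xi>"
  unfolding conv_def
  using lborel_integral_real_affine[of "-1" "\<lambda>\<eta>. f (\<xi> - \<eta>) * g \<eta>" \<xi>]
  by (simp add: mult.commute)

text \<open>On the Fourier side multiplication by a real function is convolution with a function
  satisfying \<open>f (- x) = cnj (f x)\<close>. This symmetry makes the convolution self-adjoint:
  after Fubini the kernel \<open>f (\<xi> - \<eta>)\<close> turns into the conjugate of
  \<open>f (\<eta> - \<xi>)\<close>. Young's inequality for the absolute values justifies
  Fubini.\<close>

lemma conv_adjoint:
  fixes f g h :: "real \<Rightarrow> complex"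
  assumes f: "square_integrable f" "integrable lborel f" and g: "square_integrable g" and h: "square_integrable h"
    and herm: "AE x in lborel. f (- x) = cnj (f x)"
  shows "(LINT \<xi>|lborel. conv f g \<xi> \<bullet> h \<xi>) = (LINT \<xi>|lborel. g \<xi> \<bullet> conv f h \<xi>)"
proof -
  have [measurable]: "f \<in> borel_measurable borel" "g \<in> borel_measurable borel" "h \<in> borel_measurable borel"
    using f g h by auto
  let ?k = "\<lambda>\<xi> \<eta>. (f (\<xi> - \<eta>) * g \<eta>) \<bullet> h \<xi>"
  have int: "integrable (lborel \<Otimes>\<^sub>M lborel) (\<lambda>(\<xi>, \<eta>). ?k \<xi> \<eta>)"
  proof (rule lborel_pair.Fubini_integrable)
    show "(\<lambda>(\<xi>, \<eta>). ?k \<xi> \<eta>) \<in> borel_measurable (lborel \<Otimes>\<^sub>M lborel)" by measurable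
    show "AE \<xi> in lborel. integrable lborel (\<lambda>\<eta>. case (\<xi>, \<eta>) of (\<xi>, \<eta>) \<Rightarrow> ?k \<xi> \<eta>)"
      by (auto intro!: integrable_inner_left conv_integrable f g)
    show "integrable lborel (\<lambda>\<xi>. LINT \<eta>|lborel. norm (case (\<xi>, \<eta>) of (\<xi>, \<eta>) \<Rightarrow> ?k \<xi> \<eta>))"
    proof (rule Bochner_Integration.integrable_bound)
      show "integrable lborel (\<lambda>\<xi>. conv (\<lambda>x. norm (f x)) (\<lambda>x. norm (g x)) \<xi> * norm (h \<xi>))"
        by (intro sqi_mult_integrable young_sqi sqi_norm g h integrable_norm f)
      have "(LINT \<eta>|lborel. norm (?k \<xi> \<eta>)) \<le> conv (\<lambda>x. norm (f x)) (\<lambda>x. norm (g x)) \<xi> * norm (h \<xi>)" for \<xi>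
      proof -
        have i: "integrable lborel (\<lambda>\<eta>. norm (f (\<xi> - \<eta>)) * norm (g \<eta>))"
          using conv_integrable[OF f(1) g, of \<xi>] by (simp flip: norm_mult)
        have "(LINT \<eta>|lborel. norm (?k \<xi> \<eta>)) \<le> (LINT \<eta>|lborel. (norm (f (\<xi> - \<eta>)) * norm (g \<eta>)) * norm (h \<xi>))"
        proof (rule integral_mono)
          show "integrable lborel (\<lambda>\<eta>. norm (?k \<xi> \<eta>))"
            by (auto intro!: integrable_inner_left conv_integrable f g)
          show "integrable lborel (\<lambda>\<eta>. (norm (f (\<xi> - \<eta>)) * norm (g \<eta>)) * norm (h \<xi>))"
            using i by simp
          show "norm (?k \<xi> \<eta>) \<le> (norm (f (\<xi> - \<eta>)) * norm (g \<eta>)) * norm (h \<xi>)" for \<eta>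
            using Cauchy_Schwarz_ineq2[of "f (\<xi> - \<eta>) * g \<eta>" "h \<xi>"] by (simp add: norm_mult)
        qed
        then show ?thesis by (simp add: conv_def)
      qed
      then show "AE \<xi> in lborel. norm (LINT \<eta>|lborel. norm (case (\<xi>, \<eta>) of (\<xi>, \<eta>) \<Rightarrow> ?k \<xi> \<eta>))
          \<le> norm (conv (\<lambda>x. norm (f x)) (\<lambda>x. norm (g x)) \<xi> * norm (h \<xi>))"
        by (auto intro!: AE_I2 order_trans[OF _ abs_ge_self])
    qed measurable
  qed
  have "(LINT \<xi>|lborel. conv f g \<xi> \<bullet> h \<xi>) = (LINT \<xi>|lborel. LINT \<eta>|lborel. ?k \<xi> \<eta>)"
    unfolding conv_def by (simp add: conv_integrable f g)
  also have "\<dots> = (LINT \<eta>|lborel. LINT \<xi>|lborel. ?k \<xi> \<eta>)"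
    using lborel_pair.Fubini_integral[OF int] by simp
  also have "\<dots> = (LINT \<eta>|lborel. g \<eta> \<bullet> conv f h \<eta>)"
  proof (rule Bochner_Integration.integral_cong[OF refl])
    fix \<eta>
    have ae: "AE \<xi> in lborel. f (\<xi> - \<eta>) = cnj (f (\<eta> - \<xi>))"
    proof -
      have "AE \<xi> in lborel. f (- (\<eta> - \<xi>)) = cnj (f (\<eta> - \<xi>))"
        by (rule AE_reflect[OF herm]) measurable
      then show ?thesis by simp
    qed
    have "(LINT \<xi>|lborel. ?k \<xi> \<eta>) = (LINT \<xi>|lborel. g \<eta> \<bullet> (f (\<eta> - \<xi>) * h \<xi>))"
    proof (rule integral_cong_AE)
      show "AE \<xi> in lborel. ?k \<xi> \<eta> = g \<eta> \<bullet> (f (\<eta> - \<xi>) * h \<xi>)"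
        using ae by eventually_elim (simp add: inner_complex_def algebra_simps)
    qed measurable
    also have "\<dots> = g \<eta> \<bullet> conv f h \<eta>"
      unfolding conv_def by (simp add: conv_integrable f h)
    finally show "(LINT \<xi>|lborel. ?k \<xi> \<eta>) = g \<eta> \<bullet> conv f h \<eta>" .
  qed
  finally show ?thesis .
qed

text \<open>\<open>jweight p\<close> is the weight \<open>\<langle>\<xi>\<rangle>\<^sup>p\<close>.\<close>

definition jweight :: "real \<Rightarrow> real \<Rightarrow> real"
  where "jweight p \<xi> = (1 + \<xi>\<^sup>2) powr (p / 2)"

lemma one_plus_square_pos [simp]: "0 < 1 + (\<xi>::real)\<^sup>2"
  using zero_le_power2[of \<xi>] by linarith

lemma one_plus_square_nz [simp]: "1 + (\<xi>::real)\<^sup>2 \<noteq> 0"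
  using less_imp_neq[OF one_plus_square_pos[of \<xi>]] by (rule not_sym)

lemma jweight_pos [simp]: "0 < jweight p \<xi>"
  by (simp add: jweight_def)

lemma jweight_nonneg [simp]: "0 \<le> jweight p \<xi>"
  by (simp add: less_imp_le)

lemma jweight_0 [simp]: "jweight 0 \<xi> = 1"
  by (simp add: jweight_def)

lemma jweight_add: "jweight (p + q) \<xi> = jweight p \<xi> * jweight q \<xi>"
  by (simp add: jweight_def add_divide_distrib powr_add)

lemma jweight_power2: "(jweight p \<xi>)\<^sup>2 = (1 + \<xi>\<^sup>2) powr p"
  by (simp add: jweight_def power2_eq_square flip: powr_add)

lemma jweight_mono: "p \<le> q \<Longrightarrow> jweight p \<xi> \<le> jweight q \<xi>"
  by (simp add: jweight_def powr_mono)

lemma jweight_1: "jweight 1 \<xi> = sqrt (1 + \<xi>\<^sup>2)"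
  by (simp add: jweight_def powr_half_sqrt)

lemma jweight_powr: "jweight p \<xi> = jweight 1 \<xi> powr p"
  by (simp add: jweight_def powr_powr)

lemma abs_le_jweight: "\<bar>\<xi>\<bar> \<le> jweight 1 \<xi>"
  unfolding jweight_1 by (rule real_le_rsqrt) simp

text \<open>Squaring reduces the claim to
  \<open>\<eta> * \<xi> \<le> \<bar>\<xi>\<bar> * jweight 1 \<eta>\<close>. With the absolute value
  on the right it says that the weight is 1-Lipschitz, which is what the commutator estimate uses;
  subadditivity of the weight follows as well.\<close>

lemma jweight_triangle: "jweight 1 (\<xi> + \<eta>) \<le> \<bar>\<xi>\<bar> + jweight 1 \<eta>"
  unfolding jweight_1
proof (rule real_le_lsqrt)
  have "\<eta> * \<xi> \<le> \<bar>\<xi>\<bar> * sqrt (1 + \<eta>\<^sup>2)"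
    using abs_le_jweight[of \<eta>] unfolding jweight_1
    by (metis abs_ge_self abs_mult mult.commute mult_left_mono abs_ge_zero order_trans)
  then show "1 + (\<xi> + \<eta>)\<^sup>2 \<le> (\<bar>\<xi>\<bar> + sqrt (1 + \<eta>\<^sup>2))\<^sup>2"
    by (simp add: power2_sum algebra_simps)
qed simp_all

lemma jweight_measurable [measurable]: "jweight p \<in> borel_measurable borel"
  unfolding jweight_def[abs_def] by measurable

lemma sqi_jweight: "square_integrable (jweight (-1))"
proof -
  have e: "(norm (jweight (-1) x))\<^sup>2 = inverse (1 + x\<^sup>2)" for x
    by (simp add: jweight_power2 powr_minus)
  have "integrable lborel (\<lambda>x::real. inverse (1 + x\<^sup>2))"
    using integrable_inverse_1_plus_square by (simp add: set_integrable_def)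
  then show ?thesis
    unfolding square_integrable_def e by simp
qed

text \<open>Cauchy-Schwarz applied to the product of \<open>jweight (-1)\<close>, which is square
  integrable in one dimension, and the weighted function. This is the embedding of H^1 into the
  functions with integrable transform.\<close>

lemma l1_of_weighted:
  fixes f :: "real \<Rightarrow> complex"
  assumes f: "square_integrable (\<lambda>\<xi>. complex_of_real (jweight 1 \<xi>) * f \<xi>)"
  shows "integrable lborel f"
    and "(LINT x|lborel. norm (f x)) \<le> sqrt (LINT x|lborel. (jweight (-1) x)\<^sup>2) * norm (abs_l2 (\<lambda>\<xi>. complex_of_real (jweight 1 \<xi>) * f \<xi>))"
proof -
  let ?g = "\<lambda>\<xi>. complex_of_real (jweight 1 \<xi>) * f \<xi>" and ?h = "\<lambda>\<xi>. complex_of_real (jweight (-1) \<xi>)"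
  have one: "jweight (-1) x * jweight 1 x = 1" for x
    using jweight_add[of "-1" 1 x] by simp
  have h: "square_integrable ?h"
    by (rule sqi_bound[OF sqi_jweight, where c = 1]) auto
  have eq: "f = (\<lambda>x. ?h x * ?g x)"
    by (simp add: one flip: mult.assoc of_real_mult)
  show "integrable lborel f"
    by (subst eq) (intro sqi_mult_integrable h f)
  have one': "jweight (-1) x * (jweight 1 x * y) = y" for x y
    by (simp add: one flip: mult.assoc)
  have nf: "norm (f x) = norm (?h x) * norm (?g x)" for x
    by (simp add: norm_mult one')
  have n: "square_integrable (\<lambda>x. complex_of_real (norm (?h x)))" "square_integrable (\<lambda>x. complex_of_real (norm (?g x)))"
    using sqi_of_real[OF sqi_norm[OF h]] sqi_of_real[OF sqi_norm[OF f]] by blast+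
  have "(LINT x|lborel. norm (f x)) = abs_l2 (\<lambda>x. complex_of_real (norm (?h x))) \<bullet> abs_l2 (\<lambda>x. complex_of_real (norm (?g x)))"
    unfolding abs_l2_inner[OF n] by (simp only: nf inner_complex_def) simp
  also have "\<dots> \<le> norm (abs_l2 (\<lambda>x. complex_of_real (norm (?h x)))) * norm (abs_l2 (\<lambda>x. complex_of_real (norm (?g x))))"
    by (rule norm_cauchy_schwarz)
  also have "\<dots> = sqrt (LINT x|lborel. (jweight (-1) x)\<^sup>2) * norm (abs_l2 ?g)"
    unfolding abs_l2_norm[OF n(1)] abs_l2_norm[OF n(2)] abs_l2_norm[OF f] by simp
  finally show "(LINT x|lborel. norm (f x)) \<le> \<dots>" .
qed

subsection \<open>Bessel inequality for the Fourier transform\<close>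

lemma sqi_cauchy_schwarz:
  fixes f g :: "real \<Rightarrow> real"
  assumes f: "square_integrable f" and g: "square_integrable g"
  shows "(LINT x|lborel. f x * g x) \<le> sqrt (LINT x|lborel. (f x)\<^sup>2) * sqrt (LINT x|lborel. (g x)\<^sup>2)"
proof -
  note f' = sqi_of_real[OF f] and g' = sqi_of_real[OF g]
  show ?thesis
    using norm_cauchy_schwarz[of "abs_l2 (\<lambda>x. complex_of_real (f x))" "abs_l2 (\<lambda>x. complex_of_real (g x))"]
    unfolding abs_l2_inner[OF f' g'] abs_l2_norm[OF f'] abs_l2_norm[OF g']
    by (simp add: inner_complex_def)
qed

lemma nn_integral_fatou_le:
  fixes u :: "nat \<Rightarrow> 'a \<Rightarrow> ennreal"
  assumes [measurable]: "\<And>i. u i \<in> borel_measurable M"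
    and lim: "AE x in M. (\<lambda>i. u i x) \<longlonglongrightarrow> f x"
    and le: "\<And>i. (\<integral>\<^sup>+x. u i x \<partial>M) \<le> c i" and c: "c \<longlonglongrightarrow> l"
  shows "(\<integral>\<^sup>+x. f x \<partial>M) \<le> l"
proof -
  have "(\<integral>\<^sup>+x. f x \<partial>M) = (\<integral>\<^sup>+x. liminf (\<lambda>i. u i x) \<partial>M)"
    using lim by (intro nn_integral_cong_AE) (auto elim!: eventually_mono simp: lim_imp_Liminf)
  also have "\<dots> \<le> liminf (\<lambda>i. \<integral>\<^sup>+x. u i x \<partial>M)"
    by (rule nn_integral_liminf) simp
  also have "\<dots> \<le> liminf c"
    by (rule Liminf_mono) (simp add: le)
  also have "\<dots> = l" using c by (simp add: lim_imp_Liminf)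
  finally show ?thesis .
qed

text \<open>Integrability of \<open>f\<close> and the bound \<open>C\<close> dominate the integrand
  on the product with a finite measure. The finite measure will be the standard normal distribution,
  whose characteristic function is explicit.\<close>

lemma fubini_bounded_kernel:
  fixes f :: "real \<Rightarrow> complex" and B :: "real \<Rightarrow> real \<Rightarrow> complex"
  assumes M: "finite_borel_measure M" and f: "integrable lborel f"
    and [measurable]: "case_prod B \<in> borel_measurable (borel \<Otimes>\<^sub>M borel)"
    and bound: "\<And>x \<zeta>. norm (B x \<zeta>) \<le> C"
  shows "(LINT \<zeta>|M. LINT x|lborel. f x * B x \<zeta>) = (LINT x|lborel. f x * (LINT \<zeta>|M. B x \<zeta>))"
proof -
  interpret M: finite_borel_measure M by fact
  interpret pair_sigma_finite lborel M ..
  have sM [measurable_cong]: "sets M = sets borel" by (rule M.M_is_borel)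
  have [measurable]: "f \<in> borel_measurable borel" using f by auto
  have B: "integrable M (B x)" for x
    by (rule M.integrable_const_bound[where B = C]) (auto simp: bound)
  have "integrable (lborel \<Otimes>\<^sub>M M) (\<lambda>(x, \<zeta>). f x * B x \<zeta>)"
  proof (rule Fubini_integrable)
    show "(\<lambda>(x, \<zeta>). f x * B x \<zeta>) \<in> borel_measurable (lborel \<Otimes>\<^sub>M M)" by measurable
    show "AE x in lborel. integrable M (\<lambda>\<zeta>. case (x, \<zeta>) of (x, \<zeta>) \<Rightarrow> f x * B x \<zeta>)"
      using B by simp
    show "integrable lborel (\<lambda>x. LINT \<zeta>|M. norm (case (x, \<zeta>) of (x, \<zeta>) \<Rightarrow> f x * B x \<zeta>))"
    proof (rule Bochner_Integration.integrable_bound)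
      show "integrable lborel (\<lambda>x. norm (f x) * (C * measure M (space M)))"
        using f by simp
      have "(LINT \<zeta>|M. norm (f x * B x \<zeta>)) \<le> norm (f x) * (C * measure M (space M))" for x
      proof -
        have "(LINT \<zeta>|M. norm (f x * B x \<zeta>)) \<le> (LINT \<zeta>|M. norm (f x) * C)"
          by (rule integral_mono) (auto simp: norm_mult bound intro!: mult_left_mono integrable_norm B)
        then show ?thesis by (simp add: mult_ac)
      qed
      then show "AE x in lborel. norm (LINT \<zeta>|M. norm (case (x, \<zeta>) of (x, \<zeta>) \<Rightarrow> f x * B x \<zeta>))
          \<le> norm (norm (f x) * (C * measure M (space M)))"
        by (auto intro!: AE_I2 order_trans[OF _ abs_ge_self])
    qed measurable
  qed
  from Fubini_integral[OF this] show ?thesis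
    using B by simp
qed

text \<open>The transform as an actual integral, of complex functions. It serves the truncations of
  square integrable functions and, up to sign and the factor \<open>2 * pi\<close>, also the inverse
  transform.\<close>

definition ft :: "(real \<Rightarrow> complex) \<Rightarrow> real \<Rightarrow> complex"
  where "ft h \<xi> = (CLINT x|lborel. h x * iexp (- (\<xi> * x)))"

lemma norm_iexp [simp]: "norm (iexp x) = 1"
  by simp

lemma ft_integrable: "integrable lborel h \<Longrightarrow> integrable lborel (\<lambda>x. h x * iexp (- (\<xi> * x)))"
  by (rule Bochner_Integration.integrable_bound[of _ h]) (auto simp: norm_mult simp del: of_real_minus of_real_mult)

lemma ft_measurable [measurable]:
  assumes [measurable]: "h \<in> borel_measurable borel"
  shows "ft h \<in> borel_measurable borel"
proof -
  have "(\<lambda>\<xi>. CLINT x|lborel. h x * iexp (- (\<xi> * x))) \<in> borel_measurable borel"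
    by (rule lborel.borel_measurable_lebesgue_integral) measurable
  then show ?thesis unfolding ft_def[abs_def] .
qed

lemma ft_norm_le: "integrable lborel h \<Longrightarrow> norm (ft h \<xi>) \<le> (LINT x|lborel. norm (h x))"
  unfolding ft_def using integral_norm_bound[of lborel "\<lambda>x. h x * iexp (- (\<xi> * x))"]
  by (simp add: norm_mult)

lemma ft_cnj: "cnj (ft h \<xi>) = (CLINT x|lborel. cnj (h x) * iexp (\<xi> * x))"
  unfolding ft_def by (subst Bochner_Integration.integral_cnj[symmetric]) (simp add: exp_cnj)

lemma gaussian_integral:
  fixes k :: real
  assumes k: "k > 0"
  shows "integrable lborel (\<lambda>z. exp (- (k * z)\<^sup>2 / 2))"
    and "(LINT z|lborel. exp (- (k * z)\<^sup>2 / 2)) = sqrt (2 * pi) / k"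
proof -
  have e: "exp (- (k * z)\<^sup>2 / 2) = (sqrt (2 * pi) / k) * normal_density 0 (1 / k) z" for z
    using k by (simp add: normal_density_def power_mult_distrib real_sqrt_divide field_simps)
  show "integrable lborel (\<lambda>z. exp (- (k * z)\<^sup>2 / 2))" "(LINT z|lborel. exp (- (k * z)\<^sup>2 / 2)) = sqrt (2 * pi) / k"
    unfolding e using k by simp_all
qed

lemma finite_borel_std_normal: "finite_borel_measure std_normal_distribution"
proof -
  interpret real_distribution std_normal_distribution by (rule real_dist_normal_dist)
  show ?thesis by unfold_locales auto
qed

text \<open>Expanding the square and exchanging integrals replaces the average by a double integral
  of \<open>h x * cnj (h y)\<close> against the characteristic function of the normal distribution
  at \<open>k * (y - x)\<close>, again a Gaussian. Its mass is \<open>sqrt (2 * pi) / k\<close>, so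
  Cauchy-Schwarz and Young's inequality give the bound.\<close>

lemma ft_gaussian_average:
  fixes h :: "real \<Rightarrow> complex"
  assumes h: "integrable lborel h" "square_integrable h" and k: "k > 0"
  shows "(LINT \<zeta>|std_normal_distribution. (norm (ft h (k * \<zeta>)))\<^sup>2) \<le> sqrt (2 * pi) / k * (LINT x|lborel. (norm (h x))\<^sup>2)"
proof -
  let ?N = "std_normal_distribution" and ?I = "LINT x|lborel. norm (h x)"
  interpret N: real_distribution ?N by (rule real_dist_normal_dist)
  note [measurable_cong] = N.events_eq_borel
  have [measurable]: "h \<in> borel_measurable borel" using h by auto
  let ?G = "\<lambda>z. exp (- (k * z)\<^sup>2 / 2)"
  have inner: "(LINT \<zeta>|?N. iexp (- (k * \<zeta> * x)) * cnj (ft h (k * \<zeta>))) = (LINT y|lborel. cnj (h y) * complex_of_real (?G (x - y)))" for x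
  proof -
    have "(LINT \<zeta>|?N. iexp (- (k * \<zeta> * x)) * cnj (ft h (k * \<zeta>)))
      = (LINT \<zeta>|?N. LINT y|lborel. cnj (h y) * iexp (\<zeta> * (k * (y - x))))"
    proof (rule Bochner_Integration.integral_cong[OF refl])
      fix \<zeta>
      have "iexp (- (k * \<zeta> * x)) * cnj (ft h (k * \<zeta>)) = (LINT y|lborel. iexp (- (k * \<zeta> * x)) * (cnj (h y) * iexp (k * \<zeta> * y)))"
        unfolding ft_cnj by (rule integral_mult_right_zero[symmetric])
      also have "\<dots> = (LINT y|lborel. cnj (h y) * iexp (\<zeta> * (k * (y - x))))"
      proof (rule Bochner_Integration.integral_cong[OF refl])
        fix y
        have "iexp (- (k * \<zeta> * x)) * iexp (k * \<zeta> * y) = iexp (\<zeta> * (k * (y - x)))"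
          by (simp add: algebra_simps flip: exp_add)
        then show "iexp (- (k * \<zeta> * x)) * (cnj (h y) * iexp (k * \<zeta> * y)) = cnj (h y) * iexp (\<zeta> * (k * (y - x)))"
          by (metis mult.left_commute)
      qed
      finally show "iexp (- (k * \<zeta> * x)) * cnj (ft h (k * \<zeta>)) = (LINT y|lborel. cnj (h y) * iexp (\<zeta> * (k * (y - x))))" .
    qed
    also have "\<dots> = (LINT y|lborel. cnj (h y) * (LINT \<zeta>|?N. iexp (\<zeta> * (k * (y - x)))))"
    proof (rule fubini_bounded_kernel[OF finite_borel_std_normal])
      show "integrable lborel (\<lambda>y. cnj (h y))" using h by simp
      show "norm (iexp (\<zeta> * (k * (y - x)))) \<le> 1" for y \<zeta> by (simp only: norm_iexp)
    qed measurable
    also have "\<dots> = (LINT y|lborel. cnj (h y) * complex_of_real (?G (x - y)))"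
    proof (rule Bochner_Integration.integral_cong[OF refl])
      fix y
      have "(LINT \<zeta>|?N. iexp (\<zeta> * (k * (y - x)))) = char ?N (k * (y - x))"
        by (simp add: char_def mult.commute)
      also have "\<dots> = complex_of_real (?G (y - x))"
        by (simp add: char_std_normal_distribution)
      also have "?G (y - x) = ?G (x - y)"
        by (simp add: power_mult_distrib power2_commute)
      finally show "cnj (h y) * (LINT \<zeta>|?N. iexp (\<zeta> * (k * (y - x)))) = cnj (h y) * complex_of_real (?G (x - y))"
        by simp
    qed
    finally show ?thesis .
  qed
  have "complex_of_real (LINT \<zeta>|?N. (norm (ft h (k * \<zeta>)))\<^sup>2) = (LINT \<zeta>|?N. ft h (k * \<zeta>) * cnj (ft h (k * \<zeta>)))"
    by (simp only: complex_norm_square flip: integral_complex_of_real)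
  also have "\<dots> = (LINT \<zeta>|?N. LINT x|lborel. h x * (iexp (- (k * \<zeta> * x)) * cnj (ft h (k * \<zeta>))))"
    unfolding ft_def[of h "k * _"] mult.assoc[symmetric] by simp
  also have "\<dots> = (LINT x|lborel. h x * (LINT \<zeta>|?N. iexp (- (k * \<zeta> * x)) * cnj (ft h (k * \<zeta>))))"
  proof (rule fubini_bounded_kernel[OF finite_borel_std_normal h(1)])
    show "norm (iexp (- (k * \<zeta> * x)) * cnj (ft h (k * \<zeta>))) \<le> ?I" for x \<zeta>
      unfolding norm_mult norm_iexp using ft_norm_le[OF h(1)] by simp
  qed measurable
  also have "\<dots> = (LINT x|lborel. h x * (LINT y|lborel. cnj (h y) * complex_of_real (?G (x - y))))"
    unfolding inner ..
  finally have eq: "complex_of_real (LINT \<zeta>|?N. (norm (ft h (k * \<zeta>)))\<^sup>2)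
      = (LINT x|lborel. h x * (LINT y|lborel. cnj (h y) * complex_of_real (?G (x - y))))" .
  note Gi = gaussian_integral[OF k]
  have n: "square_integrable (\<lambda>x. norm (h x))" by (rule sqi_norm[OF h(2)])
  have y: "square_integrable (conv ?G (\<lambda>x. norm (h x)))"
    by (rule young_sqi[OF Gi(1) n])
  have "(LINT \<zeta>|?N. (norm (ft h (k * \<zeta>)))\<^sup>2) = norm (complex_of_real (LINT \<zeta>|?N. (norm (ft h (k * \<zeta>)))\<^sup>2))"
    by simp
  also have "\<dots> = norm (LINT x|lborel. h x * (LINT y|lborel. cnj (h y) * complex_of_real (?G (x - y))))"
    unfolding eq ..
  also have "\<dots> \<le> (LINT x|lborel. norm (h x) * conv ?G (\<lambda>x. norm (h x)) x)"
  proof (rule order_trans[OF integral_norm_bound integral_mono'])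
    show "integrable lborel (\<lambda>x. norm (h x) * conv ?G (\<lambda>x. norm (h x)) x)"
      by (intro sqi_mult_integrable n y)
    show "norm (h x * (LINT y|lborel. cnj (h y) * complex_of_real (?G (x - y)))) \<le> norm (h x) * conv ?G (\<lambda>x. norm (h x)) x" for x
    proof -
      have "norm (LINT y|lborel. cnj (h y) * complex_of_real (?G (x - y))) \<le> conv ?G (\<lambda>x. norm (h x)) x"
        unfolding conv_def using integral_norm_bound[of lborel "\<lambda>y. cnj (h y) * complex_of_real (?G (x - y))"]
        by (simp add: norm_mult mult.commute)
      then show "norm (h x * (LINT y|lborel. cnj (h y) * complex_of_real (?G (x - y)))) \<le> norm (h x) * conv ?G (\<lambda>x. norm (h x)) x"
        by (simp add: norm_mult mult_left_mono)
    qed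
    show "0 \<le> norm (h x) * conv ?G (\<lambda>x. norm (h x)) x" for x
      by (auto simp: conv_def intro!: mult_nonneg_nonneg integral_nonneg_AE)
  qed
  also have "\<dots> \<le> sqrt (LINT x|lborel. (norm (h x))\<^sup>2) * sqrt (LINT x|lborel. (conv ?G (\<lambda>x. norm (h x)) x)\<^sup>2)"
    by (rule sqi_cauchy_schwarz[OF n y])
  also have "\<dots> \<le> sqrt (LINT x|lborel. (norm (h x))\<^sup>2) * sqrt ((sqrt (2 * pi) / k)\<^sup>2 * (LINT x|lborel. (norm (h x))\<^sup>2))"
  proof (intro mult_left_mono real_sqrt_le_mono)
    show "(LINT x|lborel. (conv ?G (\<lambda>x. norm (h x)) x)\<^sup>2) \<le> (sqrt (2 * pi) / k)\<^sup>2 * (LINT x|lborel. (norm (h x))\<^sup>2)"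
      using young_sqi(2)[OF Gi(1) n] Gi(2) by simp
  qed simp
  also have "\<dots> = sqrt (2 * pi) / k * (LINT x|lborel. (norm (h x))\<^sup>2)"
    using k by (simp add: real_sqrt_mult)
  finally show ?thesis .
qed

text \<open>The Gaussian factors in \<open>?u\<close> tend to 1. For a fixed one, the substitution
  \<open>\<xi> = K * \<zeta>\<close> turns the integral into the Gaussian average; the Jacobian
  \<open>K\<close> cancels the \<open>1 / K\<close> of its bound, and the two factors
  \<open>sqrt (2 * pi)\<close> make up the constant, independent of \<open>K\<close>. Fatou's lemma
  removes the Gaussian.\<close>

lemma ft_bessel:
  fixes h :: "real \<Rightarrow> complex"
  assumes h: "integrable lborel h" "square_integrable h"
  shows "square_integrable (ft h)"
    and "(LINT \<xi>|lborel. (norm (ft h \<xi>))\<^sup>2) \<le> 2 * pi * (LINT x|lborel. (norm (h x))\<^sup>2)"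
proof -
  let ?N = "std_normal_distribution"
  interpret N: real_distribution ?N by (rule real_dist_normal_dist)
  note [measurable_cong] = N.events_eq_borel
  have [measurable]: "h \<in> borel_measurable borel" using h by auto
  let ?c = "2 * pi * (LINT x|lborel. (norm (h x))\<^sup>2)"
  let ?u = "\<lambda>k \<xi>. ennreal ((norm (ft h \<xi>))\<^sup>2 * exp (- (\<xi> / real (Suc k))\<^sup>2 / 2))"
  have le: "(\<integral>\<^sup>+\<xi>. ennreal ((norm (ft h \<xi>))\<^sup>2) \<partial>lborel) \<le> ennreal ?c"
  proof (rule nn_integral_fatou_le[where u = ?u])
    show "?u i \<in> borel_measurable lborel" for i by measurable
    show "AE \<xi> in lborel. (\<lambda>k. ?u k \<xi>) \<longlonglongrightarrow> ennreal ((norm (ft h \<xi>))\<^sup>2)"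
    proof (rule AE_I2, rule tendsto_ennrealI)
      fix \<xi>
      have "(\<lambda>k. \<xi> / real (Suc k)) \<longlonglongrightarrow> 0"
        using tendsto_mult[OF tendsto_const[of \<xi>] LIMSEQ_Suc[OF lim_inverse_n]] by (simp add: divide_inverse)
      then have "(\<lambda>k. (norm (ft h \<xi>))\<^sup>2 * exp (- (\<xi> / real (Suc k))\<^sup>2 / 2)) \<longlonglongrightarrow> (norm (ft h \<xi>))\<^sup>2 * exp (- 0\<^sup>2 / 2)"
        by (intro tendsto_intros) simp_all
      then show "(\<lambda>k. (norm (ft h \<xi>))\<^sup>2 * exp (- (\<xi> / real (Suc k))\<^sup>2 / 2)) \<longlonglongrightarrow> (norm (ft h \<xi>))\<^sup>2"
        by simp
    qed
    show "(\<integral>\<^sup>+\<xi>. ?u k \<xi> \<partial>lborel) \<le> ennreal ?c" for k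
    proof -
      define K where "K = real (Suc k)"
      have K: "K > 0" by (simp add: K_def)
      have i: "integrable ?N (\<lambda>\<zeta>. (norm (ft h (K * \<zeta>)))\<^sup>2)"
      proof (rule N.integrable_const_bound[where B = "(LINT x|lborel. norm (h x))\<^sup>2"])
        show "AE x in ?N. norm ((norm (ft h (K * x)))\<^sup>2) \<le> (LINT x|lborel. norm (h x))\<^sup>2"
          using ft_norm_le[OF h(1)] by (auto intro!: AE_I2 power_mono)
      qed measurable
      have "(\<integral>\<^sup>+\<xi>. ?u k \<xi> \<partial>lborel) = ennreal K * (\<integral>\<^sup>+\<zeta>. ennreal ((norm (ft h (K * \<zeta>)))\<^sup>2 * exp (- \<zeta>\<^sup>2 / 2)) \<partial>lborel)"
        using K by (subst nn_integral_real_affine[where c = K and t = 0]) (simp_all add: K_def)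
      also have "(\<integral>\<^sup>+\<zeta>. ennreal ((norm (ft h (K * \<zeta>)))\<^sup>2 * exp (- \<zeta>\<^sup>2 / 2)) \<partial>lborel)
          = (\<integral>\<^sup>+\<zeta>. ennreal (sqrt (2 * pi)) * (ennreal (std_normal_density \<zeta>) * ennreal ((norm (ft h (K * \<zeta>)))\<^sup>2)) \<partial>lborel)"
        by (intro nn_integral_cong) (simp add: std_normal_density_def mult.commute flip: ennreal_mult)
      also have "\<dots> = ennreal (sqrt (2 * pi)) * (\<integral>\<^sup>+\<zeta>. ennreal ((norm (ft h (K * \<zeta>)))\<^sup>2) \<partial>?N)"
        by (simp add: nn_integral_cmult nn_integral_density)
      also have "(\<integral>\<^sup>+\<zeta>. ennreal ((norm (ft h (K * \<zeta>)))\<^sup>2) \<partial>?N) = ennreal (LINT \<zeta>|?N. (norm (ft h (K * \<zeta>)))\<^sup>2)"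
        by (rule nn_integral_eq_integral[OF i]) simp
      also have "ennreal K * (ennreal (sqrt (2 * pi)) * \<dots>) = ennreal (K * (sqrt (2 * pi) * (LINT \<zeta>|?N. (norm (ft h (K * \<zeta>)))\<^sup>2)))"
        using K by (simp add: ennreal_mult)
      also have "\<dots> \<le> ennreal (K * (sqrt (2 * pi) * (sqrt (2 * pi) / K * (LINT x|lborel. (norm (h x))\<^sup>2))))"
        using K by (intro ennreal_leI mult_left_mono ft_gaussian_average h) auto
      also have "K * (sqrt (2 * pi) * (sqrt (2 * pi) / K * (LINT x|lborel. (norm (h x))\<^sup>2))) = ?c"
        using K by simp
      finally show ?thesis .
    qed
  qed (rule tendsto_const)
  show sq: "square_integrable (ft h)"
    unfolding square_integrable_def
  proof
    show "integrable lborel (\<lambda>x. (norm (ft h x))\<^sup>2)"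
      unfolding integrable_iff_bounded
      using le_less_trans[OF le ennreal_less_top] by simp
  qed simp
  show "(LINT \<xi>|lborel. (norm (ft h \<xi>))\<^sup>2) \<le> ?c"
    using le by (subst (asm) nn_integral_eq_integral) (auto simp: sqi_integrable[OF sq] ennreal_le_iff)
qed

subsection \<open>The Fourier transform of square integrable functions\<close>

lemma l2_norm_sq_nn: "square_integrable f \<Longrightarrow>
   (\<integral>\<^sup>+x. ennreal ((norm (f x))\<^sup>2) \<partial>lborel) = ennreal ((norm (abs_l2 f))\<^sup>2)"
  by (simp add: abs_l2_norm nn_integral_eq_integral sqi_integrable)

lemma sqi_of_nn:
  fixes f :: "real \<Rightarrow> 'a::{banach, second_countable_topology}"
  assumes [measurable]: "f \<in> borel_measurable borel"
    and le: "(\<integral>\<^sup>+x. ennreal ((norm (f x))\<^sup>2) \<partial>lborel) \<le> ennreal c"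
  shows "square_integrable f"
  unfolding square_integrable_def
proof
  show "integrable lborel (\<lambda>x. (norm (f x))\<^sup>2)"
    unfolding integrable_iff_bounded
    using le_less_trans[OF le ennreal_less_top] by simp
qed simp

lemma l2_norm_le_of_nn:
  assumes f: "f \<in> borel_measurable borel"
    and le: "(\<integral>\<^sup>+x. ennreal ((norm (f x))\<^sup>2) \<partial>lborel) \<le> ennreal (c\<^sup>2)" and c: "0 \<le> c"
  shows "norm (abs_l2 f) \<le> c"
proof -
  have "ennreal ((norm (abs_l2 f))\<^sup>2) \<le> ennreal (c\<^sup>2)"
    using le l2_norm_sq_nn[OF sqi_of_nn[OF f le]] by simp
  then have "(norm (abs_l2 f))\<^sup>2 \<le> c\<^sup>2" by (simp add: ennreal_le_iff)
  then show ?thesis using c by (rule power2_le_imp_le)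
qed

text \<open>The increments have squared norm at most \<open>(1/4) ^ j\<close>, so even after
  multiplication by \<open>2 ^ j\<close> their squares have a finite total integral. Almost
  everywhere the increments are then at most a constant times \<open>sqrt (1/2) ^ j\<close>, so the
  sequence converges pointwise; Fatou's lemma shows that the pointwise limit is also the limit in
  norm.\<close>

lemma l2_fast_Cauchy_converges:
  fixes X :: "nat \<Rightarrow> l2"
  assumes fast: "\<And>j m n. j \<le> m \<Longrightarrow> j \<le> n \<Longrightarrow> norm (X m - X n) \<le> (1/2) ^ j"
  shows "\<exists>l. X \<longlonglongrightarrow> l"
proof -
  define f where "f j = rep_l2 (X j)" for j
  have sf: "square_integrable (f j)" for j by (simp add: f_def)
  have X: "X j = abs_l2 (f j)" for j by (simp add: f_def)
  have [measurable]: "f j \<in> borel_measurable borel" for j using sf by auto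
  have nn: "(\<integral>\<^sup>+x. ennreal ((norm (f m x - f n x))\<^sup>2) \<partial>lborel) \<le> ennreal (((1/2) ^ j)\<^sup>2)" if "j \<le> m" "j \<le> n" for j m n
  proof -
    have "(norm (X m - X n))\<^sup>2 \<le> ((1/2) ^ j)\<^sup>2"
      using fast[OF that] by (intro power_mono) auto
    then show ?thesis
      using l2_norm_sq_nn[OF sqi_diff[OF sf sf]] by (simp add: X abs_l2_diff sf ennreal_leI)
  qed
  have "AE x in lborel. convergent (\<lambda>j. f j x)"
  proof -
    let ?d = "\<lambda>j x. ennreal (2 ^ j * (norm (f (Suc j) x - f j x))\<^sup>2)"
    have "(\<integral>\<^sup>+x. (\<Sum>j. ?d j x) \<partial>lborel) = (\<Sum>j. \<integral>\<^sup>+x. ?d j x \<partial>lborel)"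
      by (rule nn_integral_suminf) measurable
    also have "\<dots> \<le> (\<Sum>j. ennreal ((1/2) ^ j))"
    proof (rule suminf_le)
      show "(\<integral>\<^sup>+x. ?d j x \<partial>lborel) \<le> ennreal ((1/2) ^ j)" for j
      proof -
        have "(\<integral>\<^sup>+x. ?d j x \<partial>lborel) = ennreal (2 ^ j) * (\<integral>\<^sup>+x. ennreal ((norm (f (Suc j) x - f j x))\<^sup>2) \<partial>lborel)"
          by (simp add: ennreal_mult nn_integral_cmult)
        also have "\<dots> \<le> ennreal (2 ^ j) * ennreal (((1/2) ^ j)\<^sup>2)"
          by (intro mult_left_mono nn) auto
        also have "\<dots> = ennreal (2 ^ j * ((1/2) ^ j)\<^sup>2)"
          by (rule ennreal_mult[symmetric]) auto
        also have "2 ^ j * ((1/2) ^ j)\<^sup>2 = ((1/2::real) ^ j)"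
          by (simp add: power_divide power2_eq_square)
        finally show ?thesis .
      qed
    qed auto
    also have "\<dots> = ennreal (\<Sum>j. (1/2) ^ j)"
      by (intro suminf_ennreal2 summable_geometric) auto
    also have "\<dots> < \<infinity>" by simp
    finally have "AE x in lborel. (\<Sum>j. ?d j x) \<noteq> \<infinity>"
      by (intro nn_integral_PInf_AE) auto
    then show ?thesis
    proof eventually_elim
      case (elim x)
      define S where "S = enn2real (\<Sum>j. ?d j x)"
      have S: "(\<Sum>j. ?d j x) = ennreal S" "S \<ge> 0"
        using elim by (simp_all add: S_def less_top del: not_gr_zero)
      have d: "?d j x < ennreal (S + 1)" for j
        by (rule ennreal_suminf_lessD[of "\<lambda>j. ?d j x"]) (use S in \<open>simp add: ennreal_less_iff\<close>)
      then have b: "2 ^ j * (norm (f (Suc j) x - f j x))\<^sup>2 \<le> S + 1" for j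
        using ennreal_less_iff[of "2 ^ j * (norm (f (Suc j) x - f j x))\<^sup>2" "S + 1"] d[of j] by (simp add: less_imp_le)
      have b': "norm (f (Suc j) x - f j x) \<le> sqrt (S + 1) * (sqrt (1/2)) ^ j" for j
      proof -
        have "(norm (f (Suc j) x - f j x))\<^sup>2 \<le> (S + 1) * (1/2) ^ j"
          using b[of j] by (simp add: power_divide field_simps)
        then have "sqrt ((norm (f (Suc j) x - f j x))\<^sup>2) \<le> sqrt ((S + 1) * (1/2) ^ j)"
          by (rule real_sqrt_le_mono)
        then show ?thesis by (simp add: real_sqrt_mult real_sqrt_power)
      qed
      have "summable (\<lambda>j. sqrt (S + 1) * (sqrt (1/2)) ^ j)"
        by (intro summable_mult summable_geometric) (simp add: real_sqrt_lt_1_iff)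
      then have "summable (\<lambda>j. f (Suc j) x - f j x)"
        by (rule summable_comparison_test[rotated]) (use b' in auto)
      then have "convergent (\<lambda>n. \<Sum>j<n. f (Suc j) x - f j x)"
        by (simp add: summable_iff_convergent)
      then have "convergent (\<lambda>n. f n x - f 0 x)"
        by (simp add: sum_lessThan_telescope[of "\<lambda>j. f j x"])
      then show "convergent (\<lambda>j. f j x)"
        by (simp add: convergent_diff_const_right_iff)
    qed
  qed
  then have g: "AE x in lborel. (\<lambda>j. f j x) \<longlonglongrightarrow> lim (\<lambda>j. f j x)"
    by (simp add: convergent_LIMSEQ_iff)
  define g where "g x = lim (\<lambda>j. f j x)" for x
  have [measurable]: "g \<in> borel_measurable borel"
    unfolding g_def[abs_def] by measurable
  have fat: "(\<integral>\<^sup>+x. ennreal ((norm (f j x - g x))\<^sup>2) \<partial>lborel) \<le> ennreal (((1/2) ^ j)\<^sup>2)" for j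
  proof (rule nn_integral_fatou_le[where u = "\<lambda>i x. ennreal ((norm (f j x - f (i + j) x))\<^sup>2)"])
    show "AE x in lborel. (\<lambda>i. ennreal ((norm (f j x - f (i + j) x))\<^sup>2)) \<longlonglongrightarrow> ennreal ((norm (f j x - g x))\<^sup>2)"
      using g
    proof eventually_elim
      case (elim x)
      then have "(\<lambda>i. f (i + j) x) \<longlonglongrightarrow> g x"
        unfolding g_def by (rule LIMSEQ_ignore_initial_segment)
      then show ?case by (intro tendsto_intros)
    qed
    show "(\<integral>\<^sup>+x. ennreal ((norm (f j x - f (i + j) x))\<^sup>2) \<partial>lborel) \<le> ennreal (((1/2) ^ j)\<^sup>2)" for i
      by (rule nn) auto
  qed (auto intro: tendsto_const)
  have sg: "square_integrable g"
  proof -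
    have "square_integrable (\<lambda>x. f 0 x - g x)"
      using fat[of 0] by (rule sqi_of_nn[rotated]) measurable
    from sqi_diff[OF sf[of 0] this] show ?thesis by simp
  qed
  have "norm (X j - abs_l2 g) \<le> (1/2) ^ j" for j
    unfolding X by (simp add: abs_l2_diff sf sg) (rule l2_norm_le_of_nn[OF _ fat], simp_all)
  moreover have "(\<lambda>j. (1/2) ^ j :: real) \<longlonglongrightarrow> 0" by (rule LIMSEQ_power_zero) simp
  ultimately have "(\<lambda>j. X j - abs_l2 g) \<longlonglongrightarrow> 0"
    by (intro Lim_null_comparison[of "\<lambda>j. X j - abs_l2 g" "\<lambda>j. (1/2) ^ j"]) auto
  then have "X \<longlonglongrightarrow> abs_l2 g"
    by (rule LIM_zero_cancel)
  then show ?thesis ..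
qed

instance l2 :: banach
proof
  fix X :: "nat \<Rightarrow> l2"
  assume X: "Cauchy X"
  have "\<forall>j::nat. \<exists>N. \<forall>m\<ge>N. \<forall>n\<ge>N. norm (X m - X n) < (1/2) ^ j"
    using X by (simp add: Cauchy_iff)
  then obtain N where N: "\<And>j m n. m \<ge> N j \<Longrightarrow> n \<ge> N j \<Longrightarrow> norm (X m - X n) < (1/2) ^ j"
    by metis
  \<comment> \<open>The sum dominates every \<open>N i\<close> with \<open>i \<le> j\<close>; the
    added \<open>j\<close> makes the sequence strictly increasing.\<close>
  define r where "r j = (\<Sum>i\<le>j. N i) + j" for j
  have r: "strict_mono r"
    unfolding strict_mono_Suc_iff r_def by simp
  have rN: "N j \<le> r m" if "j \<le> m" for j m
  proof -
    have "N j \<le> (\<Sum>i\<le>m. N i)"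
      using that by (intro member_le_sum) auto
    then show ?thesis by (simp add: r_def)
  qed
  have "\<exists>l. (X \<circ> r) \<longlonglongrightarrow> l"
    by (rule l2_fast_Cauchy_converges) (auto intro!: less_imp_le N rN)
  then obtain l where "(X \<circ> r) \<longlonglongrightarrow> l" ..
  from Cauchy_converges_subseq[OF X r this] show "convergent X"
    by (auto simp: convergent_def)
qed

section \<open>The transform on L^2 as a limit over truncations\<close>

definition truncate :: "real \<Rightarrow> (real \<Rightarrow> real) \<Rightarrow> real \<Rightarrow> complex"
  where "truncate R f x = indicator {-R..R} x * complex_of_real (f x)"

abbreviation emb :: "(real \<Rightarrow> real) \<Rightarrow> real \<Rightarrow> complex"
  where "emb f \<equiv> (\<lambda>x. complex_of_real (f x))"

lemma fourier_cutoff_eq: "fourier_cutoff R f = ft (truncate R f)"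
  by (rule ext) (simp add: fourier_cutoff_def ft_def truncate_def)

lemma truncate_measurable [measurable]: "f \<in> borel_measurable borel \<Longrightarrow> truncate R f \<in> borel_measurable borel"
  unfolding truncate_def[abs_def] by measurable

lemma truncate_sqi: "square_integrable f \<Longrightarrow> square_integrable (truncate R f)"
  by (rule sqi_bound[where c = 1]) (auto simp: truncate_def norm_mult indicator_def)

lemma indicator_sqi: "square_integrable (indicator {a..b} :: real \<Rightarrow> complex)"
proof (rule sqi_of_nn)
  have "(\<integral>\<^sup>+x. ennreal ((norm (indicator {a..b} x :: complex))\<^sup>2) \<partial>lborel) = (\<integral>\<^sup>+x. indicator {a..b} x \<partial>lborel)"
    by (intro nn_integral_cong) (simp add: indicator_def)
  then show "(\<integral>\<^sup>+x. ennreal ((norm (indicator {a..b} x :: complex))\<^sup>2) \<partial>lborel) \<le> ennreal (max 0 (b - a))"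
    by (cases "a \<le> b") (auto simp: max_def)
qed simp

lemma truncate_integrable: "square_integrable f \<Longrightarrow> integrable lborel (truncate R f)"
  unfolding truncate_def[abs_def] by (intro sqi_mult_integrable indicator_sqi sqi_of_real)

lemma truncate_tendsto:
  assumes f: "square_integrable f"
  shows "((\<lambda>R. abs_l2 (truncate R f)) \<longlongrightarrow> abs_l2 (emb f)) at_top"
proof -
  note ef = sqi_of_real[OF f]
  have "((\<lambda>R. LINT x|lborel. (norm (truncate R f x - emb f x))\<^sup>2) \<longlongrightarrow> (LINT x|(lborel::real measure). (0::real))) at_top"
  proof (rule integral_dominated_convergence_at_top[where w = "\<lambda>x. (norm (f x))\<^sup>2"])
    show "AE x in lborel. ((\<lambda>R. (cmod (truncate R f x - emb f x))\<^sup>2) \<longlongrightarrow> 0) at_top"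
    proof (rule AE_I2)
      fix x
      have "eventually (\<lambda>R. (cmod (truncate R f x - emb f x))\<^sup>2 = 0) at_top"
        using eventually_ge_at_top[of "\<bar>x\<bar>"] by eventually_elim (auto simp: truncate_def indicator_def)
      then show "((\<lambda>R. (cmod (truncate R f x - emb f x))\<^sup>2) \<longlongrightarrow> 0) at_top"
        by (rule tendsto_eventually)
    qed
    show "\<forall>\<^sub>F R in at_top. AE x in lborel. norm ((cmod (truncate R f x - emb f x))\<^sup>2) \<le> (norm (f x))\<^sup>2"
      by (intro always_eventually allI AE_I2) (auto simp: truncate_def indicator_def)
    show "(\<lambda>x. (cmod (truncate t f x - emb f x))\<^sup>2) \<in> borel_measurable lborel" for t
      using f by measurable
  qed (use sqi_integrable[OF f] in auto)
  then have "((\<lambda>R. sqrt (LINT x|lborel. (norm (truncate R f x - emb f x))\<^sup>2)) \<longlongrightarrow> sqrt 0) at_top"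
    by (intro tendsto_real_sqrt) simp
  then have "((\<lambda>R. norm (abs_l2 (truncate R f) - abs_l2 (emb f))) \<longlongrightarrow> 0) at_top"
    by (simp add: abs_l2_diff truncate_sqi f ef abs_l2_norm sqi_diff)
  then show ?thesis
    by (simp add: tendsto_norm_zero_iff LIM_zero_iff)
qed

lemma ft_diff:
  "integrable lborel f \<Longrightarrow> integrable lborel g \<Longrightarrow> ft (\<lambda>x. f x - g x) = (\<lambda>\<xi>. ft f \<xi> - ft g \<xi>)"
  unfolding ft_def[abs_def] left_diff_distrib by (intro ext Bochner_Integration.integral_diff ft_integrable)

lemma ft_bessel_l2:
  assumes "integrable lborel h" "square_integrable h"
  shows "norm (abs_l2 (ft h)) \<le> sqrt (2 * pi) * norm (abs_l2 h)"
  using real_sqrt_le_mono[OF ft_bessel(2)[OF assms]]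
  by (simp add: abs_l2_norm ft_bessel assms real_sqrt_mult)

lemma ft_bessel_diff:
  assumes f: "integrable lborel f" "square_integrable f" and g: "integrable lborel g" "square_integrable g"
  shows "norm (abs_l2 (ft f) - abs_l2 (ft g)) \<le> sqrt (2 * pi) * norm (abs_l2 f - abs_l2 g)"
  using ft_bessel_l2[of "\<lambda>x. f x - g x"] f g
  by (simp add: abs_l2_diff sqi_diff ft_bessel ft_diff)

text \<open>Truncations of a square integrable function are integrable, so by the Bessel inequality
  their transforms are elements of \<open>l2\<close>. The limit of extended integrals in the
  definition thereby becomes convergence in a normed space.\<close>

lemma has_fourier_iff:
  assumes f: "square_integrable f"
  shows "has_fourier f g \<longleftrightarrow> square_integrable g \<and> ((\<lambda>R. abs_l2 (ft (truncate R f))) \<longlongrightarrow> abs_l2 g) at_top"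
proof (cases "square_integrable g")
  case True
  have s: "square_integrable (ft (truncate R f))" for R
    by (intro ft_bessel truncate_integrable truncate_sqi f)
  have "(\<integral>\<^sup>+\<xi>. ennreal ((cmod (fourier_cutoff R f \<xi> - g \<xi>))\<^sup>2) \<partial>lborel)
      = ennreal ((norm (abs_l2 (ft (truncate R f)) - abs_l2 g))\<^sup>2)" for R
    unfolding fourier_cutoff_eq by (simp add: l2_norm_sq_nn sqi_diff s True abs_l2_diff)
  then have "has_fourier f g \<longleftrightarrow> ((\<lambda>R. ennreal ((norm (abs_l2 (ft (truncate R f)) - abs_l2 g))\<^sup>2)) \<longlongrightarrow> ennreal 0) at_top"
    using True by (simp add: has_fourier_def)
  also have "\<dots> \<longleftrightarrow> ((\<lambda>R. (norm (abs_l2 (ft (truncate R f)) - abs_l2 g))\<^sup>2) \<longlongrightarrow> 0) at_top"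
    by (intro tendsto_ennreal_iff) auto
  also have "\<dots> \<longleftrightarrow> ((\<lambda>R. norm (abs_l2 (ft (truncate R f)) - abs_l2 g)) \<longlongrightarrow> 0) at_top"
  proof
    assume "((\<lambda>R. (norm (abs_l2 (ft (truncate R f)) - abs_l2 g))\<^sup>2) \<longlongrightarrow> 0) at_top"
    from tendsto_real_sqrt[OF this] show "((\<lambda>R. norm (abs_l2 (ft (truncate R f)) - abs_l2 g)) \<longlongrightarrow> 0) at_top"
      by simp
  next
    assume "((\<lambda>R. norm (abs_l2 (ft (truncate R f)) - abs_l2 g)) \<longlongrightarrow> 0) at_top"
    from tendsto_power[OF this, of 2] show "((\<lambda>R. (norm (abs_l2 (ft (truncate R f)) - abs_l2 g))\<^sup>2) \<longlongrightarrow> 0) at_top"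
      by simp
  qed
  also have "\<dots> \<longleftrightarrow> ((\<lambda>R. abs_l2 (ft (truncate R f))) \<longlongrightarrow> abs_l2 g) at_top"
    by (simp add: tendsto_norm_zero_iff LIM_zero_iff)
  finally show ?thesis using True by simp
qed (simp add: has_fourier_def)

text \<open>By the Bessel inequality the transforms of the truncations at integers form a Cauchy
  sequence, and completeness gives a limit \<open>G\<close>. The estimate \<open>bd\<close> extends
  the convergence from integers to all real \<open>R\<close>. This is the existence statement that
  gives the choice in \<open>fourier\<close> its meaning.\<close>

lemma has_fourier_fourier:
  assumes f: "square_integrable f"
  shows "has_fourier f (fourier f)"
proof -
  let ?F = "\<lambda>R. abs_l2 (ft (truncate R f))" and ?c = "\<lambda>R. abs_l2 (truncate R f)"
  have le: "norm (?F R - ?F R') \<le> sqrt (2 * pi) * norm (?c R - ?c R')" for R R'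
    by (intro ft_bessel_diff truncate_integrable truncate_sqi f)
  have "convergent (\<lambda>n. ?c (real n))"
    using filterlim_compose[OF truncate_tendsto[OF f] filterlim_real_sequentially] by (auto simp: convergent_def)
  then have "Cauchy (\<lambda>n. ?c (real n))" by (rule convergent_Cauchy)
  have "Cauchy (\<lambda>n. ?F (real n))"
    unfolding Cauchy_iff
  proof (intro allI impI)
    fix e :: real assume "e > 0"
    then have "e / sqrt (2 * pi) > 0" by simp
    then obtain M where "\<And>m n. m \<ge> M \<Longrightarrow> n \<ge> M \<Longrightarrow> norm (?c (real m) - ?c (real n)) < e / sqrt (2 * pi)"
      using \<open>Cauchy (\<lambda>n. ?c (real n))\<close> unfolding Cauchy_iff by blast
    then have "norm (?F (real m) - ?F (real n)) < e" if "m \<ge> M" "n \<ge> M" for m n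
      using le[of "real m" "real n"] that by (force simp: field_simps)
    then show "\<exists>M. \<forall>m\<ge>M. \<forall>n\<ge>M. norm (?F (real m) - ?F (real n)) < e" by blast
  qed
  then obtain G where G: "(\<lambda>n. ?F (real n)) \<longlonglongrightarrow> G"
    by (auto simp: Cauchy_convergent_iff convergent_def)
  have cG: "(\<lambda>n. ?c (real n)) \<longlonglongrightarrow> abs_l2 (emb f)"
    by (rule filterlim_compose[OF truncate_tendsto[OF f] filterlim_real_sequentially])
  have bd: "norm (?F R - G) \<le> sqrt (2 * pi) * norm (?c R - abs_l2 (emb f))" for R
  proof (rule tendsto_le[OF sequentially_bot])
    show "(\<lambda>n. norm (?F R - ?F (real n))) \<longlonglongrightarrow> norm (?F R - G)"
      by (intro tendsto_intros G)
    show "(\<lambda>n. sqrt (2 * pi) * norm (?c R - ?c (real n))) \<longlonglongrightarrow> sqrt (2 * pi) * norm (?c R - abs_l2 (emb f))"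
      by (intro tendsto_intros cG)
  qed (simp add: le)
  have "((\<lambda>R. ?F R - G) \<longlongrightarrow> 0) at_top"
  proof (rule Lim_null_comparison)
    show "\<forall>\<^sub>F R in at_top. norm (?F R - G) \<le> sqrt (2 * pi) * norm (?c R - abs_l2 (emb f))"
      using bd by simp
    have "((\<lambda>R. sqrt (2 * pi) * norm (?c R - abs_l2 (emb f))) \<longlongrightarrow> sqrt (2 * pi) * norm (abs_l2 (emb f) - abs_l2 (emb f))) at_top"
      by (intro tendsto_intros truncate_tendsto f)
    then show "((\<lambda>R. sqrt (2 * pi) * norm (?c R - abs_l2 (emb f))) \<longlongrightarrow> 0) at_top" by simp
  qed
  then have "(?F \<longlongrightarrow> abs_l2 (rep_l2 G)) at_top"
    by (simp add: LIM_zero_iff)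
  then have "has_fourier f (rep_l2 G)"
    by (simp add: has_fourier_iff[OF f])
  then show ?thesis unfolding fourier_def by (rule someI[of "has_fourier f"])
qed

lemma fourier_sqi: "square_integrable f \<Longrightarrow> square_integrable (fourier f)"
  using has_fourier_fourier by (simp add: has_fourier_def)

lemma fourier_measurable [measurable]: "square_integrable f \<Longrightarrow> fourier f \<in> borel_measurable borel"
  using fourier_sqi by auto

lemma fourier_tendsto: "square_integrable f \<Longrightarrow> ((\<lambda>R. abs_l2 (ft (truncate R f))) \<longlongrightarrow> abs_l2 (fourier f)) at_top"
  using has_fourier_fourier has_fourier_iff by blast

lemma fourier_bessel:
  assumes f: "square_integrable f"
  shows "norm (abs_l2 (fourier f)) \<le> sqrt (2 * pi) * norm (abs_l2 (emb f))"
proof (rule tendsto_le[OF trivial_limit_at_top_linorder])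
  show "((\<lambda>R. norm (abs_l2 (ft (truncate R f)))) \<longlongrightarrow> norm (abs_l2 (fourier f))) at_top"
    by (intro tendsto_intros fourier_tendsto f)
  show "((\<lambda>R. sqrt (2 * pi) * norm (abs_l2 (truncate R f))) \<longlongrightarrow> sqrt (2 * pi) * norm (abs_l2 (emb f))) at_top"
    by (intro tendsto_intros truncate_tendsto f)
qed (simp add: ft_bessel_l2 truncate_integrable truncate_sqi f)

lemma fourier_unique:
  assumes f: "square_integrable f" and g: "square_integrable g"
    and lim: "((\<lambda>R. abs_l2 (ft (truncate R f))) \<longlongrightarrow> abs_l2 g) at_top"
  shows "AE \<xi> in lborel. fourier f \<xi> = g \<xi>"
  using tendsto_unique[OF trivial_limit_at_top_linorder fourier_tendsto[OF f] lim]
  by (simp add: abs_l2_eq_iff fourier_sqi f g)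

lemma ft_truncate_add:
  assumes "square_integrable f" "square_integrable g"
  shows "ft (truncate R (\<lambda>x. f x + g x)) = (\<lambda>\<xi>. ft (truncate R f) \<xi> + ft (truncate R g) \<xi>)"
proof
  fix \<xi>
  have "ft (truncate R (\<lambda>x. f x + g x)) \<xi> = (LINT x|lborel. truncate R f x * iexp (- (\<xi> * x)) + truncate R g x * iexp (- (\<xi> * x)))"
    unfolding ft_def by (intro Bochner_Integration.integral_cong) (auto simp: truncate_def algebra_simps)
  then show "ft (truncate R (\<lambda>x. f x + g x)) \<xi> = ft (truncate R f) \<xi> + ft (truncate R g) \<xi>"
    unfolding ft_def by (simp only: Bochner_Integration.integral_add[OF ft_integrable ft_integrable] truncate_integrable assms)
qed

lemma ft_truncate_scale: "ft (truncate R (\<lambda>x. a * f x)) = (\<lambda>\<xi>. a * ft (truncate R f) \<xi>)"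
proof
  fix \<xi>
  have "ft (truncate R (\<lambda>x. a * f x)) \<xi> = (LINT x|lborel. complex_of_real a * (truncate R f x * iexp (- (\<xi> * x))))"
    unfolding ft_def by (intro Bochner_Integration.integral_cong) (auto simp: truncate_def algebra_simps)
  also have "\<dots> = complex_of_real a * ft (truncate R f) \<xi>"
    unfolding ft_def by (rule integral_mult_right_zero)
  finally show "ft (truncate R (\<lambda>x. a * f x)) \<xi> = a * ft (truncate R f) \<xi>" .
qed

lemma fourier_add:
  assumes f: "square_integrable f" and g: "square_integrable g"
  shows "AE \<xi> in lborel. fourier (\<lambda>x. f x + g x) \<xi> = fourier f \<xi> + fourier g \<xi>"
proof (rule fourier_unique)
  have "((\<lambda>R. abs_l2 (ft (truncate R f)) + abs_l2 (ft (truncate R g))) \<longlongrightarrow> abs_l2 (fourier f) + abs_l2 (fourier g)) at_top"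
    by (intro tendsto_intros fourier_tendsto f g)
  then show "((\<lambda>R. abs_l2 (ft (truncate R (\<lambda>x. f x + g x)))) \<longlongrightarrow> abs_l2 (\<lambda>\<xi>. fourier f \<xi> + fourier g \<xi>)) at_top"
    by (simp add: abs_l2_add ft_bessel truncate_integrable truncate_sqi fourier_sqi f g ft_truncate_add)
qed (intro sqi_add fourier_sqi f g)+

lemma fourier_scale:
  assumes f: "square_integrable f"
  shows "AE \<xi> in lborel. fourier (\<lambda>x. a * f x) \<xi> = a * fourier f \<xi>"
proof (rule fourier_unique)
  have "((\<lambda>R. a *\<^sub>R abs_l2 (ft (truncate R f))) \<longlongrightarrow> a *\<^sub>R abs_l2 (fourier f)) at_top"
    by (intro tendsto_intros fourier_tendsto f)
  then show "((\<lambda>R. abs_l2 (ft (truncate R (\<lambda>x. a * f x)))) \<longlongrightarrow> abs_l2 (\<lambda>\<xi>. a * fourier f \<xi>)) at_top"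
    by (simp add: abs_l2_scaleR ft_bessel truncate_integrable truncate_sqi fourier_sqi f ft_truncate_scale scaleR_conv_of_real)
qed (intro sqi_mult_const fourier_sqi f)+

lemma fourier_diff:
  assumes f: "square_integrable f" and g: "square_integrable g"
  shows "AE \<xi> in lborel. fourier (\<lambda>x. f x - g x) \<xi> = fourier f \<xi> - fourier g \<xi>"
  using fourier_add[OF f sqi_mult_const[OF g, of "-1"]] fourier_scale[OF g, of "-1"]
  by (auto elim!: eventually_rev_mp)

lemma truncate_cong_AE:
  assumes [measurable]: "f \<in> borel_measurable borel" "g \<in> borel_measurable borel"
    and "AE x in lborel. f x = g x"
  shows "ft (truncate R f) = ft (truncate R g)"
proof
  show "ft (truncate R f) \<xi> = ft (truncate R g) \<xi>" for \<xi>
    unfolding ft_def by (rule integral_cong_AE) (use assms(3) in \<open>auto simp: truncate_def elim!: eventually_mono\<close>)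
qed

text \<open>The conclusion is equality at every point: the two functions satisfy
  \<open>has_fourier\<close> for the same right-hand sides, so the choice operator is applied to the
  same predicate.\<close>

lemma fourier_cong_AE:
  assumes "f \<in> borel_measurable borel" "g \<in> borel_measurable borel"
    and "AE x in lborel. f x = g x"
  shows "fourier f = fourier g"
proof -
  have "has_fourier f = has_fourier g"
    unfolding has_fourier_def[abs_def] fourier_cutoff_eq truncate_cong_AE[OF assms] ..
  then show ?thesis by (simp add: fourier_def)
qed

lemma fourier_eq_ft:
  assumes f: "square_integrable f" and i: "integrable lborel (emb f)"
  shows "AE \<xi> in lborel. fourier f \<xi> = ft (emb f) \<xi>"
proof (rule fourier_unique[OF f])
  note ef = sqi_of_real[OF f]
  show "square_integrable (ft (emb f))" by (intro ft_bessel i ef)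
  have "((\<lambda>R. abs_l2 (ft (truncate R f)) - abs_l2 (ft (emb f))) \<longlongrightarrow> 0) at_top"
  proof (rule Lim_null_comparison)
    show "\<forall>\<^sub>F R in at_top. norm (abs_l2 (ft (truncate R f)) - abs_l2 (ft (emb f))) \<le> sqrt (2 * pi) * norm (abs_l2 (truncate R f) - abs_l2 (emb f))"
      by (intro always_eventually allI ft_bessel_diff truncate_integrable truncate_sqi f i ef)
    have "((\<lambda>R. sqrt (2 * pi) * norm (abs_l2 (truncate R f) - abs_l2 (emb f))) \<longlongrightarrow> sqrt (2 * pi) * norm (abs_l2 (emb f) - abs_l2 (emb f))) at_top"
      by (intro tendsto_intros truncate_tendsto f)
    then show "((\<lambda>R. sqrt (2 * pi) * norm (abs_l2 (truncate R f) - abs_l2 (emb f))) \<longlongrightarrow> 0) at_top" by simp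
  qed
  then show "((\<lambda>R. abs_l2 (ft (truncate R f))) \<longlongrightarrow> abs_l2 (ft (emb f))) at_top"
    by (simp add: LIM_zero_iff)
qed

text \<open>For the truncations, which are real valued, the symmetry holds at every point.
  Reflection combined with conjugation is an isometry of L^2, so it passes to the limit.\<close>

lemma fourier_hermitian:
  assumes f: "square_integrable f"
  shows "AE \<xi> in lborel. fourier f (- \<xi>) = cnj (fourier f \<xi>)"
proof -
  let ?g = "\<lambda>\<xi>. cnj (fourier f (- \<xi>))"
  have rf: "square_integrable (\<lambda>\<xi>. fourier f (- \<xi>))"
    using sqi_reflect[OF fourier_sqi[OF f], of 0] by simp
  have g: "square_integrable ?g"
    by (rule sqi_bound[OF rf, where c = 1]) (use rf in auto)
  have c: "ft (truncate R f) \<xi> = cnj (ft (truncate R f) (- \<xi>))" for R \<xi>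
  proof -
    have "cnj (truncate R f x) = truncate R f x" for x by (simp add: truncate_def indicator_def)
    then show ?thesis unfolding ft_cnj by (simp add: ft_def)
  qed
  have s: "square_integrable (ft (truncate R f))" for R
    by (intro ft_bessel truncate_integrable truncate_sqi f)
  have "norm (abs_l2 (ft (truncate R f)) - abs_l2 ?g) = norm (abs_l2 (ft (truncate R f)) - abs_l2 (fourier f))" for R
  proof -
    have "(LINT \<xi>|lborel. (norm (ft (truncate R f) \<xi> - ?g \<xi>))\<^sup>2) = (LINT \<xi>|lborel. (norm (ft (truncate R f) (- \<xi>) - fourier f (- \<xi>)))\<^sup>2)"
    proof (rule Bochner_Integration.integral_cong[OF refl])
      fix \<xi>
      have "ft (truncate R f) \<xi> - ?g \<xi> = cnj (ft (truncate R f) (- \<xi>) - fourier f (- \<xi>))"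
        unfolding c[of R \<xi>] by simp
      then show "(norm (ft (truncate R f) \<xi> - ?g \<xi>))\<^sup>2 = (norm (ft (truncate R f) (- \<xi>) - fourier f (- \<xi>)))\<^sup>2"
        by (metis complex_mod_cnj)
    qed
    also have "\<dots> = (LINT \<xi>|lborel. (norm (ft (truncate R f) \<xi> - fourier f \<xi>))\<^sup>2)"
      using lborel_integral_real_affine[of "-1" "\<lambda>\<xi>. (norm (ft (truncate R f) \<xi> - fourier f \<xi>))\<^sup>2" 0] by simp
    finally show ?thesis
      by (simp add: abs_l2_diff s g fourier_sqi f abs_l2_norm sqi_diff)
  qed
  then have "((\<lambda>R. norm (abs_l2 (ft (truncate R f)) - abs_l2 ?g)) \<longlongrightarrow> 0) at_top"
    using fourier_tendsto[OF f] by (simp add: tendsto_norm_zero_iff LIM_zero_iff)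
  then have "((\<lambda>R. abs_l2 (ft (truncate R f))) \<longlongrightarrow> abs_l2 ?g) at_top"
    by (simp add: tendsto_norm_zero_iff LIM_zero_iff)
  from fourier_unique[OF f g this] show ?thesis
    by eventually_elim (metis complex_cnj_cnj)
qed

subsection \<open>Inversion and products\<close>

text \<open>The positive and the negative part have the same transform, hence, at frequency 0, the
  same mass \<open>c\<close>. If \<open>c\<close> is positive, dividing by it gives two probability
  densities with equal characteristic functions, and Levy's uniqueness theorem identifies
  them.\<close>

lemma l1_ft_unique_real:
  fixes h :: "real \<Rightarrow> real"
  assumes h: "integrable lborel h" and zero: "\<And>\<xi>. ft (emb h) \<xi> = 0"
  shows "AE x in lborel. h x = 0"
proof -
  define p where "p x = max 0 (h x)" for x
  define m where "m x = max 0 (- h x)" for x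
  have p: "integrable lborel p" and m: "integrable lborel m"
    using h unfolding p_def[abs_def] m_def[abs_def] by auto
  have [measurable]: "p \<in> borel_measurable borel" "m \<in> borel_measurable borel"
    using p m by auto
  have h_eq: "h x = p x - m x" and nonneg: "p x \<ge> 0" "m x \<ge> 0" for x
    by (auto simp: p_def m_def)
  have ft_eq: "ft (emb p) \<xi> = ft (emb m) \<xi>" for \<xi>
    using zero[of \<xi>] ft_diff[of "emb p" "emb m"] p m by (simp add: h_eq[abs_def] fun_eq_iff)
  define c where "c = (LINT x|lborel. p x)"
  have c_m: "c = (LINT x|lborel. m x)"
    using ft_eq[of 0] unfolding c_def ft_def by simp
  have c: "c \<ge> 0" unfolding c_def using nonneg by (intro integral_nonneg_AE) auto
  show ?thesis
  proof (cases "c = 0")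
    case True
    then have "AE x in lborel. p x = 0" "AE x in lborel. m x = 0"
      using integral_nonneg_eq_0_iff_AE[OF p] integral_nonneg_eq_0_iff_AE[OF m] nonneg c_def c_m by auto
    then show ?thesis by (auto simp: h_eq elim!: eventually_rev_mp)
  next
    case False
    then have c: "c > 0" using c by simp
    define D where "D q = density lborel (\<lambda>x. ennreal (q x / c))" for q :: "real \<Rightarrow> real"
    have dist: "real_distribution (D q)" and ch: "char (D q) t = ft (emb q) (- t) / c"
      if q: "integrable lborel q" "\<And>x. 0 \<le> q x" "(LINT x|lborel. q x) = c" for q t
    proof -
      have [measurable]: "q \<in> borel_measurable borel" using q by auto
      have "emeasure (D q) UNIV = ennreal (LINT x|lborel. q x / c)"
        using q c by (simp add: D_def emeasure_density nn_integral_eq_integral)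
      also have "\<dots> = 1" using q c by simp
      finally have "prob_space (D q)" by (intro prob_spaceI) (simp add: D_def)
      then show "real_distribution (D q)"
        by (simp add: real_distribution_def real_distribution_axioms_def D_def)
      have "char (D q) t = (CLINT x|lborel. (q x / c) *\<^sub>R iexp (t * x))"
        unfolding char_def D_def using q c by (subst integral_density) auto
      also have "\<dots> = (CLINT x|lborel. (emb q x * iexp (- (- t * x))) / c)"
        by (intro Bochner_Integration.integral_cong) (auto simp: scaleR_conv_of_real)
      also have "\<dots> = ft (emb q) (- t) / c"
        unfolding ft_def by (rule integral_divide_zero)
      finally show "char (D q) t = ft (emb q) (- t) / c" .
    qed
    have "D p = D m"
      by (rule Levy_uniqueness)
        (auto intro!: dist p m nonneg simp: c_def[symmetric] c_m[symmetric] ch p m nonneg ft_eq fun_eq_iff)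
    then have "AE x in lborel. ennreal (p x / c) = ennreal (m x / c)"
      unfolding D_def by (intro sigma_finite_measure.density_unique[OF sigma_finite_lborel]) measurable
    then show ?thesis
      by eventually_elim (use nonneg c in \<open>simp add: h_eq\<close>)
  qed
qed

text \<open>The transforms of the real and the imaginary part are combinations of the transforms of
  \<open>h\<close> and of its conjugate. The latter at \<open>\<xi>\<close> is the conjugate of the
  former at \<open>- \<xi>\<close>, so it vanishes too.\<close>

lemma l1_ft_unique:
  fixes h :: "real \<Rightarrow> complex"
  assumes h: "integrable lborel h" and zero: "\<And>\<xi>. ft h \<xi> = 0"
  shows "AE x in lborel. h x = 0"
proof -
  have i: "integrable lborel (\<lambda>x. Re (h x))" "integrable lborel (\<lambda>x. Im (h x))" using h by auto
  have cn: "(CLINT x|lborel. cnj (h x) * iexp (\<xi> * x)) = 0" for \<xi>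
    using ft_cnj[of h \<xi>] zero by simp
  have ih: "integrable lborel (\<lambda>x. h x * iexp (- (\<xi> * x)))" for \<xi>
    by (rule ft_integrable[OF h])
  have ic: "integrable lborel (\<lambda>x. cnj (h x) * iexp (- (\<xi> * x)))" for \<xi>
    by (rule ft_integrable) (use h in simp)
  have cn': "(CLINT x|lborel. cnj (h x) * iexp (- (\<xi> * x))) = 0" for \<xi>
    using cn[of "-\<xi>"] by simp
  have zero': "(CLINT x|lborel. h x * iexp (- (\<xi> * x))) = 0" for \<xi>
    using zero[of \<xi>] by (simp add: ft_def)
  have re: "ft (emb (\<lambda>x. Re (h x))) \<xi> = 0" for \<xi>
  proof -
    have "ft (emb (\<lambda>x. Re (h x))) \<xi> = (CLINT x|lborel. (h x * iexp (- (\<xi> * x)) + cnj (h x) * iexp (- (\<xi> * x))) / 2)"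
      unfolding ft_def
    proof (rule Bochner_Integration.integral_cong[OF refl])
      fix x
      have "complex_of_real (Re (h x)) = (h x + cnj (h x)) / 2"
        by (simp add: complex_eq_iff)
      then show "complex_of_real (Re (h x)) * iexp (- (\<xi> * x)) = (h x * iexp (- (\<xi> * x)) + cnj (h x) * iexp (- (\<xi> * x))) / 2"
        by (simp only: distrib_right times_divide_eq_left)
    qed
    also have "\<dots> = 0"
      unfolding integral_divide_zero Bochner_Integration.integral_add[OF ih ic] zero' cn' by simp
    finally show ?thesis .
  qed
  have im: "ft (emb (\<lambda>x. Im (h x))) \<xi> = 0" for \<xi>
  proof -
    have "ft (emb (\<lambda>x. Im (h x))) \<xi> = (CLINT x|lborel. (h x * iexp (- (\<xi> * x)) - cnj (h x) * iexp (- (\<xi> * x))) / (2 * \<i>))"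
      unfolding ft_def
    proof (rule Bochner_Integration.integral_cong[OF refl])
      fix x
      have "complex_of_real (Im (h x)) = (h x - cnj (h x)) / (2 * \<i>)"
        by (simp add: complex_eq_iff)
      then show "complex_of_real (Im (h x)) * iexp (- (\<xi> * x)) = (h x * iexp (- (\<xi> * x)) - cnj (h x) * iexp (- (\<xi> * x))) / (2 * \<i>)"
        by (simp only: left_diff_distrib times_divide_eq_left)
    qed
    also have "\<dots> = 0"
      unfolding integral_divide_zero Bochner_Integration.integral_diff[OF ih ic] zero' cn' by simp
    finally show ?thesis .
  qed
  show ?thesis
    using l1_ft_unique_real[OF i(1) re] l1_ft_unique_real[OF i(2) im]
    by eventually_elim (simp add: complex_eq_iff)
qed

lemma l2_pairing_bound:
  assumes f: "square_integrable f" and g: "square_integrable g"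
  shows "norm (LINT x|lborel. f x * g x) \<le> norm (abs_l2 f) * norm (abs_l2 g)"
proof -
  have "norm (LINT x|lborel. f x * g x) \<le> (LINT x|lborel. norm (f x) * norm (g x))"
    using integral_norm_bound[of lborel "\<lambda>x. f x * g x"] by (simp add: norm_mult)
  also have "\<dots> \<le> norm (abs_l2 f) * norm (abs_l2 g)"
    using sqi_cauchy_schwarz[OF sqi_norm[OF f] sqi_norm[OF g]] by (simp add: abs_l2_norm f g)
  finally show ?thesis .
qed

lemma l2_pairing_tendsto:
  assumes F: "\<And>R. square_integrable (F R)" and f: "square_integrable f" and g: "square_integrable g"
    and lim: "((\<lambda>R. abs_l2 (F R)) \<longlongrightarrow> abs_l2 f) \<FF>"
  shows "((\<lambda>R. LINT x|lborel. F R x * g x) \<longlongrightarrow> (LINT x|lborel. f x * g x)) \<FF>"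
proof -
  have "((\<lambda>R. (LINT x|lborel. F R x * g x) - (LINT x|lborel. f x * g x)) \<longlongrightarrow> 0) \<FF>"
  proof (rule Lim_null_comparison)
    show "\<forall>\<^sub>F R in \<FF>. norm ((LINT x|lborel. F R x * g x) - (LINT x|lborel. f x * g x)) \<le> norm (abs_l2 (F R) - abs_l2 f) * norm (abs_l2 g)"
    proof (intro always_eventually allI)
      fix R
      have "(LINT x|lborel. F R x * g x) - (LINT x|lborel. f x * g x) = (LINT x|lborel. (F R x - f x) * g x)"
        unfolding left_diff_distrib by (intro Bochner_Integration.integral_diff[symmetric] sqi_mult_integrable F f g)
      then show "norm ((LINT x|lborel. F R x * g x) - (LINT x|lborel. f x * g x)) \<le> norm (abs_l2 (F R) - abs_l2 f) * norm (abs_l2 g)"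
        using l2_pairing_bound[OF sqi_diff[OF F f] g] by (simp add: abs_l2_diff F f)
    qed
    have "((\<lambda>R. norm (abs_l2 (F R) - abs_l2 f) * norm (abs_l2 g)) \<longlongrightarrow> norm (abs_l2 f - abs_l2 f) * norm (abs_l2 g)) \<FF>"
      by (intro tendsto_intros lim)
    then show "((\<lambda>R. norm (abs_l2 (F R) - abs_l2 f) * norm (abs_l2 g)) \<longlongrightarrow> 0) \<FF>" by simp
  qed
  then show ?thesis by (simp add: LIM_zero_iff)
qed

lemma gaussian_sqi: "square_integrable (\<lambda>x::real. complex_of_real (exp (- x\<^sup>2 / 2)))"
proof -
  have e: "(norm (complex_of_real (exp (- x\<^sup>2 / 2))))\<^sup>2 = exp (- (sqrt 2 * x)\<^sup>2 / 2)" for x :: real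
    by (simp add: power_mult_distrib power2_eq_square flip: exp_add)
  show ?thesis
    using gaussian_integral(1)[of "sqrt 2"] unfolding square_integrable_def e by simp
qed

lemma std_normal_integral:
  fixes f :: "real \<Rightarrow> complex"
  assumes [measurable]: "f \<in> borel_measurable borel"
  shows "(LINT x|lborel. complex_of_real (exp (- x\<^sup>2 / 2)) * f x) = complex_of_real (sqrt (2 * pi)) * (LINT x|std_normal_distribution. f x)"
proof -
  have "(LINT x|std_normal_distribution. f x) = (LINT x|lborel. std_normal_density x *\<^sub>R f x)"
    by (rule integral_density) auto
  also have "\<dots> = (LINT x|lborel. (1 / complex_of_real (sqrt (2 * pi))) * (complex_of_real (exp (- x\<^sup>2 / 2)) * f x))"
    by (intro Bochner_Integration.integral_cong) (auto simp: std_normal_density_def scaleR_conv_of_real)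
  also have "\<dots> = (1 / complex_of_real (sqrt (2 * pi))) * (LINT x|lborel. complex_of_real (exp (- x\<^sup>2 / 2)) * f x)"
    by (rule integral_mult_right_zero)
  finally show ?thesis by simp
qed

lemma char_std_normal: "(LINT \<zeta>|std_normal_distribution. iexp (t * \<zeta>)) = complex_of_real (exp (- t\<^sup>2 / 2))"
  using fun_cong[OF char_std_normal_distribution, of t] unfolding char_def by simp

text \<open>This is the multiplication formula, which moves the transform from one factor of a
  pairing to the other, for a Gaussian centred at \<open>\<xi>\<close>; its transform is a Gaussian
  modulated by \<open>\<xi>\<close>.\<close>

lemma fourier_gaussian_l1:
  fixes h :: "real \<Rightarrow> complex"
  assumes h: "integrable lborel h"
  shows "(LINT \<eta>|lborel. ft h \<eta> * complex_of_real (exp (- (\<eta> - \<xi>)\<^sup>2 / 2)))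
    = complex_of_real (sqrt (2 * pi)) * (LINT x|lborel. h x * (complex_of_real (exp (- x\<^sup>2 / 2)) * iexp (- (\<xi> * x))))"
proof -
  have [measurable]: "h \<in> borel_measurable borel" using h by auto
  have "(LINT \<eta>|lborel. ft h \<eta> * complex_of_real (exp (- (\<eta> - \<xi>)\<^sup>2 / 2)))
      = (LINT \<zeta>|lborel. complex_of_real (exp (- \<zeta>\<^sup>2 / 2)) * ft h (\<xi> + \<zeta>))"
    using lborel_integral_real_affine[of 1 "\<lambda>\<eta>. ft h \<eta> * complex_of_real (exp (- (\<eta> - \<xi>)\<^sup>2 / 2))" \<xi>]
    by (simp add: mult.commute)
  also have "\<dots> = complex_of_real (sqrt (2 * pi)) * (LINT \<zeta>|std_normal_distribution. ft h (\<xi> + \<zeta>))"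
    by (rule std_normal_integral) measurable
  also have "(LINT \<zeta>|std_normal_distribution. ft h (\<xi> + \<zeta>)) = (LINT x|lborel. h x * (LINT \<zeta>|std_normal_distribution. iexp (- ((\<xi> + \<zeta>) * x))))"
    unfolding ft_def
  proof (rule fubini_bounded_kernel[OF finite_borel_std_normal h])
    show "norm (iexp (- ((\<xi> + \<zeta>) * x))) \<le> 1" for x \<zeta> by (simp only: norm_iexp)
  qed measurable
  also have "\<dots> = (LINT x|lborel. h x * (complex_of_real (exp (- x\<^sup>2 / 2)) * iexp (- (\<xi> * x))))"
  proof (rule Bochner_Integration.integral_cong[OF refl])
    fix x
    have "iexp (- ((\<xi> + \<zeta>) * x)) = iexp (- (\<xi> * x)) * iexp ((- x) * \<zeta>)" for \<zeta>
      by (simp add: algebra_simps flip: exp_add)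
    then have "(LINT \<zeta>|std_normal_distribution. iexp (- ((\<xi> + \<zeta>) * x))) = iexp (- (\<xi> * x)) * (LINT \<zeta>|std_normal_distribution. iexp ((- x) * \<zeta>))"
      by (simp only: integral_mult_right_zero)
    also have "\<dots> = complex_of_real (exp (- x\<^sup>2 / 2)) * iexp (- (\<xi> * x))"
      unfolding char_std_normal by simp
    finally show "h x * (LINT \<zeta>|std_normal_distribution. iexp (- ((\<xi> + \<zeta>) * x))) = h x * (complex_of_real (exp (- x\<^sup>2 / 2)) * iexp (- (\<xi> * x)))"
      by (simp only:)
  qed
  finally show ?thesis .
qed

lemma sqi_mult_iexp:
  assumes f: "square_integrable (f :: real \<Rightarrow> complex)"
  shows "square_integrable (\<lambda>x. f x * iexp (a * x))"
proof (rule sqi_bound[OF f, where c = 1])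
  show "(\<lambda>x. f x * iexp (a * x)) \<in> borel_measurable borel" using f by measurable
qed (simp add: norm_mult)

text \<open>Both sides are continuous in \<open>f\<close> for the norm of L^2, since the Gaussian
  and the modulated Gaussian are square integrable. It therefore suffices to have the identity for
  truncations.\<close>

lemma fourier_gaussian:
  assumes f: "square_integrable f"
  shows "(LINT \<eta>|lborel. fourier f \<eta> * complex_of_real (exp (- (\<eta> - \<xi>)\<^sup>2 / 2)))
    = complex_of_real (sqrt (2 * pi)) * (LINT x|lborel. emb f x * (complex_of_real (exp (- x\<^sup>2 / 2)) * iexp (- (\<xi> * x))))"
proof (rule tendsto_unique[OF trivial_limit_at_top_linorder])
  have g1: "square_integrable (\<lambda>\<eta>. complex_of_real (exp (- (\<eta> - \<xi>)\<^sup>2 / 2)))"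
    using sqi_reflect[OF gaussian_sqi, of \<xi>] by (simp add: power2_commute)
  have g2: "square_integrable (\<lambda>x. complex_of_real (exp (- x\<^sup>2 / 2)) * iexp (- (\<xi> * x)))"
    using sqi_mult_iexp[OF gaussian_sqi, of "- \<xi>"] by simp
  show "((\<lambda>R. LINT \<eta>|lborel. ft (truncate R f) \<eta> * complex_of_real (exp (- (\<eta> - \<xi>)\<^sup>2 / 2))) \<longlongrightarrow>
     (LINT \<eta>|lborel. fourier f \<eta> * complex_of_real (exp (- (\<eta> - \<xi>)\<^sup>2 / 2)))) at_top"
    by (intro l2_pairing_tendsto fourier_tendsto fourier_sqi f g1 ft_bessel truncate_integrable truncate_sqi)
  have "((\<lambda>R. complex_of_real (sqrt (2 * pi)) * (LINT x|lborel. truncate R f x * (complex_of_real (exp (- x\<^sup>2 / 2)) * iexp (- (\<xi> * x))))) \<longlongrightarrow>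
     complex_of_real (sqrt (2 * pi)) * (LINT x|lborel. emb f x * (complex_of_real (exp (- x\<^sup>2 / 2)) * iexp (- (\<xi> * x))))) at_top"
    by (intro tendsto_mult_left l2_pairing_tendsto truncate_tendsto sqi_of_real f g2 truncate_sqi)
  then show "((\<lambda>R. LINT \<eta>|lborel. ft (truncate R f) \<eta> * complex_of_real (exp (- (\<eta> - \<xi>)\<^sup>2 / 2))) \<longlongrightarrow>
     complex_of_real (sqrt (2 * pi)) * (LINT x|lborel. emb f x * (complex_of_real (exp (- x\<^sup>2 / 2)) * iexp (- (\<xi> * x))))) at_top"
    by (simp only: fourier_gaussian_l1[OF truncate_integrable[OF f]])
qed

definition ift :: "(real \<Rightarrow> complex) \<Rightarrow> real \<Rightarrow> complex"
  where "ift g x = (CLINT \<eta>|lborel. g \<eta> * iexp (x * \<eta>)) / (2 * pi)"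

lemma ift_eq: "ift g x = ft g (- x) / (2 * pi)"
  by (simp add: ift_def ft_def)

text \<open>Both \<open>f\<close> and the inverse transform of its transform have, after multiplication by a Gaussian
  (which makes them integrable), the same Fourier transform.\<close>

lemma fourier_inversion:
  assumes f: "square_integrable f" and i: "integrable lborel (fourier f)"
  shows "AE x in lborel. emb f x = ift (fourier f) x"
proof -
  let ?G = "\<lambda>x::real. complex_of_real (exp (- x\<^sup>2 / 2))" and ?F = "fourier f"
  have [measurable]: "f \<in> borel_measurable borel" "?F \<in> borel_measurable borel"
    using f by auto
  have ift_m [measurable]: "ift ?F \<in> borel_measurable borel"
    unfolding ift_eq[abs_def] by measurable
  have i1: "integrable lborel (\<lambda>x. emb f x * ?G x)"
    by (intro sqi_mult_integrable sqi_of_real f gaussian_sqi)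
  have Gi: "integrable lborel ?G" using gaussian_integral(1)[of 1] by simp
  have bd: "norm (ift ?F x) \<le> (LINT x|lborel. norm (?F x)) / (2 * pi)" for x
    unfolding ift_eq using ft_norm_le[OF i, of "-x"] by (simp add: norm_divide divide_right_mono)
  have i2: "integrable lborel (\<lambda>x. ift ?F x * ?G x)"
  proof (rule Bochner_Integration.integrable_bound)
    show "integrable lborel (\<lambda>x. (LINT x|lborel. norm (?F x)) / (2 * pi) * exp (- x\<^sup>2 / 2))"
      using gaussian_integral(1)[of 1] by (intro integrable_mult_right) simp
    show "AE x in lborel. norm (ift ?F x * ?G x) \<le> norm ((LINT x|lborel. norm (?F x)) / (2 * pi) * exp (- x\<^sup>2 / 2))"
    proof (rule AE_I2)
      fix x
      have "norm (ift ?F x * ?G x) \<le> (LINT x|lborel. norm (?F x)) / (2 * pi) * exp (- x\<^sup>2 / 2)"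
        using mult_right_mono[OF bd[of x], of "exp (- x\<^sup>2 / 2)"] by (simp add: norm_mult)
      also have "\<dots> \<le> norm \<dots>" by simp
      finally show "norm (ift ?F x * ?G x) \<le> norm ((LINT x|lborel. norm (?F x)) / (2 * pi) * exp (- x\<^sup>2 / 2))" .
    qed
  qed measurable
  have "AE x in lborel. emb f x * ?G x - ift ?F x * ?G x = 0"
  proof (rule l1_ft_unique)
    show "integrable lborel (\<lambda>x. emb f x * ?G x - ift ?F x * ?G x)"
      by (intro Bochner_Integration.integrable_diff i1 i2)
    fix \<xi>
    have "ft (\<lambda>x. ift ?F x * ?G x) \<xi> = (LINT x|lborel. ?G x * (ift ?F x * iexp (- (\<xi> * x))))"
      unfolding ft_def by (intro Bochner_Integration.integral_cong) (auto simp: mult_ac)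
    also have "\<dots> = complex_of_real (sqrt (2 * pi)) * (LINT x|std_normal_distribution. ift ?F x * iexp (- (\<xi> * x)))"
      by (rule std_normal_integral) measurable
    also have "(LINT x|std_normal_distribution. ift ?F x * iexp (- (\<xi> * x)))
        = (LINT x|std_normal_distribution. LINT \<eta>|lborel. (?F \<eta> / (2 * pi)) * iexp ((\<eta> - \<xi>) * x))"
    proof (rule Bochner_Integration.integral_cong[OF refl])
      fix x
      have "ift ?F x * iexp (- (\<xi> * x)) = (LINT \<eta>|lborel. (?F \<eta> * iexp (x * \<eta>)) / (2 * pi) * iexp (- (\<xi> * x)))"
        unfolding ift_def by (simp only: integral_mult_left_zero integral_divide_zero)
      also have "\<dots> = (LINT \<eta>|lborel. (?F \<eta> / (2 * pi)) * iexp ((\<eta> - \<xi>) * x))"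
      proof (rule Bochner_Integration.integral_cong[OF refl])
        fix \<eta>
        have "iexp (x * \<eta>) * iexp (- (\<xi> * x)) = iexp ((\<eta> - \<xi>) * x)"
          by (simp add: algebra_simps flip: exp_add)
        then show "(?F \<eta> * iexp (x * \<eta>)) / (2 * pi) * iexp (- (\<xi> * x)) = (?F \<eta> / (2 * pi)) * iexp ((\<eta> - \<xi>) * x)"
          by (metis (no_types, lifting) mult.assoc times_divide_eq_left)
      qed
      finally show "ift ?F x * iexp (- (\<xi> * x)) = (LINT \<eta>|lborel. (?F \<eta> / (2 * pi)) * iexp ((\<eta> - \<xi>) * x))" .
    qed
    also have "\<dots> = (LINT \<eta>|lborel. (?F \<eta> / (2 * pi)) * (LINT x|std_normal_distribution. iexp ((\<eta> - \<xi>) * x)))"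
    proof (rule fubini_bounded_kernel[OF finite_borel_std_normal])
      show "integrable lborel (\<lambda>\<eta>. ?F \<eta> / (2 * pi))" using i by simp
      show "norm (iexp ((\<eta> - \<xi>) * x)) \<le> 1" for \<eta> x by (simp only: norm_iexp)
    qed measurable
    also have "\<dots> = (LINT \<eta>|lborel. (?F \<eta> * complex_of_real (exp (- (\<eta> - \<xi>)\<^sup>2 / 2))) / (2 * pi))"
      unfolding char_std_normal by simp
    also have "\<dots> = (LINT \<eta>|lborel. ?F \<eta> * complex_of_real (exp (- (\<eta> - \<xi>)\<^sup>2 / 2))) / (2 * pi)"
      by (rule integral_divide_zero)
    also have "complex_of_real (sqrt (2 * pi)) * \<dots> = (LINT x|lborel. emb f x * (?G x * iexp (- (\<xi> * x))))"
    proof -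
      have "complex_of_real (sqrt (2 * pi)) * complex_of_real (sqrt (2 * pi)) = 2 * complex_of_real pi"
        unfolding of_real_mult[symmetric] by simp
      then show ?thesis unfolding fourier_gaussian[OF f]
        by (simp add: mult.assoc[symmetric])
    qed
    also have "\<dots> = ft (\<lambda>x. emb f x * ?G x) \<xi>"
      unfolding ft_def by (simp add: mult.assoc)
    finally show "ft (\<lambda>x. emb f x * ?G x - ift ?F x * ?G x) \<xi> = 0"
      unfolding ft_diff[OF i1 i2] by simp
  qed
  then show ?thesis
  proof eventually_elim
    case (elim x)
    then have "(emb f x - ift ?F x) * ?G x = 0" by (simp only: left_diff_distrib)
    then show ?case by simp
  qed
qed

lemma fourier_sup_bound:
  assumes f: "square_integrable f" and i: "integrable lborel (fourier f)"
  shows "AE x in lborel. \<bar>f x\<bar> \<le> (LINT \<xi>|lborel. norm (fourier f \<xi>)) / (2 * pi)"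
  using fourier_inversion[OF assms]
proof eventually_elim
  case (elim x)
  have "\<bar>f x\<bar> = norm (emb f x)" by simp
  also have "\<dots> \<le> (LINT \<xi>|lborel. norm (fourier f \<xi>)) / (2 * pi)"
    unfolding elim ift_eq using ft_norm_le[OF i, of "-x"] by (simp add: norm_divide divide_right_mono)
  finally show ?case .
qed

section \<open>The transform of a product\<close>

lemma fubini_l1:
  fixes f g :: "real \<Rightarrow> complex" and B :: "real \<Rightarrow> real \<Rightarrow> complex"
  assumes f: "integrable lborel f" and g: "integrable lborel g"
    and [measurable]: "case_prod B \<in> borel_measurable (borel \<Otimes>\<^sub>M borel)"
    and bound: "\<And>x y. norm (B x y) \<le> C"
  shows "(LINT y|lborel. LINT x|lborel. f x * (g y * B x y)) = (LINT x|lborel. LINT y|lborel. f x * (g y * B x y))"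
proof (rule lborel_pair.Fubini_integral)
  have [measurable]: "f \<in> borel_measurable borel" "g \<in> borel_measurable borel" using f g by auto
  have b: "norm (f x * (g y * B x y)) \<le> norm (f x) * (norm (g y) * C)" for x y
    by (simp add: norm_mult bound mult_left_mono)
  show "integrable (lborel \<Otimes>\<^sub>M lborel) (\<lambda>(x, y). f x * (g y * B x y))"
  proof (rule lborel_pair.Fubini_integrable)
    show "(\<lambda>(x, y). f x * (g y * B x y)) \<in> borel_measurable (lborel \<Otimes>\<^sub>M lborel)" by measurable
    have gB: "integrable lborel (\<lambda>y. f x * (g y * B x y))" for x
    proof (rule Bochner_Integration.integrable_bound)
      show "integrable lborel (\<lambda>y. norm (f x) * (norm (g y) * C))" using g by simp
      show "AE y in lborel. norm (f x * (g y * B x y)) \<le> norm (norm (f x) * (norm (g y) * C))"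
        using b by (auto intro!: AE_I2 order_trans[OF _ abs_ge_self])
    qed measurable
    then show "AE x in lborel. integrable lborel (\<lambda>y. case (x, y) of (x, y) \<Rightarrow> f x * (g y * B x y))" by simp
    show "integrable lborel (\<lambda>x. LINT y|lborel. norm (case (x, y) of (x, y) \<Rightarrow> f x * (g y * B x y)))"
    proof (rule Bochner_Integration.integrable_bound)
      show "integrable lborel (\<lambda>x. norm (f x) * ((LINT y|lborel. norm (g y)) * C))" using f by simp
      have "(LINT y|lborel. norm (f x * (g y * B x y))) \<le> norm (f x) * ((LINT y|lborel. norm (g y)) * C)" for x
      proof -
        have "(LINT y|lborel. norm (f x * (g y * B x y))) \<le> (LINT y|lborel. norm (f x) * (norm (g y) * C))"
          by (rule integral_mono) (use gB g b in auto)
        then show ?thesis by simp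
      qed
      then show "AE x in lborel. norm (LINT y|lborel. norm (case (x, y) of (x, y) \<Rightarrow> f x * (g y * B x y)))
          \<le> norm (norm (f x) * ((LINT y|lborel. norm (g y)) * C))"
        by (auto intro!: AE_I2 order_trans[OF _ abs_ge_self])
    qed measurable
  qed
qed

text \<open>With \<open>g\<close> truncated, inserting the inversion formula for \<open>f\<close>
  and exchanging integrals gives the convolution formula at every frequency. Since the transform of
  \<open>f\<close> is integrable, Young's inequality makes the convolution with it continuous on
  L^2, and the truncation can be removed.\<close>

lemma fourier_product:
  assumes f: "square_integrable f" and i: "integrable lborel (fourier f)" and g: "square_integrable g"
  shows "square_integrable (\<lambda>x. f x * g x)"
    and "AE \<xi> in lborel. fourier (\<lambda>x. f x * g x) \<xi> = conv (fourier f) (fourier g) \<xi> / (2 * pi)"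
proof -
  let ?F = "fourier f"
  have [measurable]: "f \<in> borel_measurable borel" "?F \<in> borel_measurable borel" "g \<in> borel_measurable borel"
    using f g by auto
  show fg: "square_integrable (\<lambda>x. f x * g x)"
  proof (rule sqi_bound[OF g])
    show "AE x in lborel. norm (f x * g x) \<le> (LINT \<xi>|lborel. norm (fourier f \<xi>)) / (2 * pi) * norm (g x)"
      using fourier_sup_bound[OF f i] by eventually_elim (simp only: real_norm_def abs_mult mult_right_mono abs_ge_zero)
  qed measurable
  have ift_m [measurable]: "ift ?F \<in> borel_measurable borel"
    unfolding ift_eq[abs_def] by measurable
  have eq: "ft (truncate R (\<lambda>x. f x * g x)) \<xi> = conv ?F (ft (truncate R g)) \<xi> / (2 * pi)" for R \<xi>
  proof -
    let ?g = "truncate R g"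
    have gi: "integrable lborel ?g" by (rule truncate_integrable[OF g])
    have "ft (truncate R (\<lambda>x. f x * g x)) \<xi> = (LINT x|lborel. ?g x * iexp (- (\<xi> * x)) * ift ?F x)"
      unfolding ft_def
    proof (rule integral_cong_AE)
      show "AE x in lborel. truncate R (\<lambda>x. f x * g x) x * iexp (- (\<xi> * x)) = ?g x * iexp (- (\<xi> * x)) * ift ?F x"
        using fourier_inversion[OF f i]
      proof eventually_elim
        case (elim x)
        then show ?case by (simp add: truncate_def mult_ac flip: elim)
      qed
    qed measurable
    also have "\<dots> = (LINT x|lborel. (LINT \<eta>|lborel. ?F \<eta> * (?g x * iexp (- ((\<xi> - \<eta>) * x)))) / (2 * pi))"
    proof (rule Bochner_Integration.integral_cong[OF refl])
      fix x
      have "?g x * iexp (- (\<xi> * x)) * ift ?F x = (LINT \<eta>|lborel. ?g x * iexp (- (\<xi> * x)) * (?F \<eta> * iexp (x * \<eta>))) / (2 * pi)"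
        unfolding ift_def by (simp only: integral_mult_right_zero times_divide_eq_right)
      also have "(LINT \<eta>|lborel. ?g x * iexp (- (\<xi> * x)) * (?F \<eta> * iexp (x * \<eta>))) = (LINT \<eta>|lborel. ?F \<eta> * (?g x * iexp (- ((\<xi> - \<eta>) * x))))"
      proof (rule Bochner_Integration.integral_cong[OF refl])
        fix \<eta>
        have "iexp (- ((\<xi> - \<eta>) * x)) = iexp (- (\<xi> * x)) * iexp (x * \<eta>)"
          by (simp add: algebra_simps flip: exp_add)
        then show "?g x * iexp (- (\<xi> * x)) * (?F \<eta> * iexp (x * \<eta>)) = ?F \<eta> * (?g x * iexp (- ((\<xi> - \<eta>) * x)))"
          by (simp only: mult_ac)
      qed
      finally show "?g x * iexp (- (\<xi> * x)) * ift ?F x = (LINT \<eta>|lborel. ?F \<eta> * (?g x * iexp (- ((\<xi> - \<eta>) * x)))) / (2 * pi)" .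
    qed
    also have "\<dots> = (LINT x|lborel. LINT \<eta>|lborel. ?F \<eta> * (?g x * iexp (- ((\<xi> - \<eta>) * x)))) / (2 * pi)"
      by (rule integral_divide_zero)
    also have "(LINT x|lborel. LINT \<eta>|lborel. ?F \<eta> * (?g x * iexp (- ((\<xi> - \<eta>) * x)))) = (LINT \<eta>|lborel. LINT x|lborel. ?F \<eta> * (?g x * iexp (- ((\<xi> - \<eta>) * x))))"
    proof (rule fubini_l1[OF i gi])
      show "norm (iexp (- ((\<xi> - \<eta>) * x))) \<le> 1" for \<eta> x by (simp only: norm_iexp)
    qed measurable
    also have "\<dots> = conv (ft ?g) ?F \<xi>"
      unfolding conv_def ft_def by (simp only: integral_mult_right_zero mult.commute)
    also have "\<dots> = conv ?F (ft ?g) \<xi>" by (rule conv_commute)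
    finally show ?thesis .
  qed
  have sc: "square_integrable (conv ?F h)" if "square_integrable h" for h
    by (rule young_sqi[OF i that])
  have sf: "square_integrable (\<lambda>\<xi>. conv ?F h \<xi> / (2 * pi))" if "square_integrable h" for h
    using sqi_scaleR[OF sc[OF that], of "1 / (2 * pi)"] by (simp add: scaleR_conv_of_real)
  show "AE \<xi> in lborel. fourier (\<lambda>x. f x * g x) \<xi> = conv ?F (fourier g) \<xi> / (2 * pi)"
  proof (rule fourier_unique[OF fg])
    show "square_integrable (\<lambda>\<xi>. conv ?F (fourier g) \<xi> / (2 * pi))"
      by (rule sf[OF fourier_sqi[OF g]])
    let ?h = "\<lambda>R. ft (truncate R g)"
    have h: "square_integrable (?h R)" for R by (intro ft_bessel truncate_integrable truncate_sqi g)
    have "((\<lambda>R. abs_l2 (conv ?F (?h R)) - abs_l2 (conv ?F (fourier g))) \<longlongrightarrow> 0) at_top"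
    proof (rule Lim_null_comparison)
      show "\<forall>\<^sub>F R in at_top. norm (abs_l2 (conv ?F (?h R)) - abs_l2 (conv ?F (fourier g)))
          \<le> (LINT \<xi>|lborel. norm (?F \<xi>)) * norm (abs_l2 (?h R) - abs_l2 (fourier g))"
      proof (intro always_eventually allI)
        fix R
        have "conv ?F (\<lambda>\<xi>. ?h R \<xi> - fourier g \<xi>) = (\<lambda>\<xi>. conv ?F (?h R) \<xi> - conv ?F (fourier g) \<xi>)"
          by (rule ext) (rule conv_diff_right[OF fourier_sqi[OF f] h fourier_sqi[OF g]])
        then have "abs_l2 (conv ?F (?h R)) - abs_l2 (conv ?F (fourier g)) = abs_l2 (conv ?F (\<lambda>\<xi>. ?h R \<xi> - fourier g \<xi>))"
          by (simp add: abs_l2_diff sc h fourier_sqi g)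
        then show "norm (abs_l2 (conv ?F (?h R)) - abs_l2 (conv ?F (fourier g)))
          \<le> (LINT \<xi>|lborel. norm (?F \<xi>)) * norm (abs_l2 (?h R) - abs_l2 (fourier g))"
          using young[OF i sqi_diff[OF h fourier_sqi[OF g]]] by (simp add: abs_l2_diff h fourier_sqi g)
      qed
      have "((\<lambda>R. (LINT \<xi>|lborel. norm (?F \<xi>)) * norm (abs_l2 (?h R) - abs_l2 (fourier g))) \<longlongrightarrow>
        (LINT \<xi>|lborel. norm (?F \<xi>)) * norm (abs_l2 (fourier g) - abs_l2 (fourier g))) at_top"
        by (intro tendsto_intros fourier_tendsto g)
      then show "((\<lambda>R. (LINT \<xi>|lborel. norm (?F \<xi>)) * norm (abs_l2 (?h R) - abs_l2 (fourier g))) \<longlongrightarrow> 0) at_top" by simp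
    qed
    then have "((\<lambda>R. abs_l2 (conv ?F (?h R))) \<longlongrightarrow> abs_l2 (conv ?F (fourier g))) at_top"
      by (simp add: LIM_zero_iff)
    then have "((\<lambda>R. (1 / (2 * pi)) *\<^sub>R abs_l2 (conv ?F (?h R))) \<longlongrightarrow> (1 / (2 * pi)) *\<^sub>R abs_l2 (conv ?F (fourier g))) at_top"
      by (intro tendsto_intros)
    then show "((\<lambda>R. abs_l2 (ft (truncate R (\<lambda>x. f x * g x)))) \<longlongrightarrow> abs_l2 (\<lambda>\<xi>. conv ?F (fourier g) \<xi> / (2 * pi))) at_top"
      by (simp add: abs_l2_scaleR sc h fourier_sqi g scaleR_conv_of_real eq[abs_def])
  qed
qed

subsection \<open>Weak derivatives\<close>

text \<open>The smooth function exp(-1/y), extended by 0 to the left half line. The prefactor with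
  exponent \<open>k\<close> is there because differentiation produces powers of
  \<open>1 / y\<close>, so the whole family is stable under derivatives.\<close>

definition bump_half :: "nat \<Rightarrow> real \<Rightarrow> real"
  where "bump_half k y = (if 0 < y then (1 / y) ^ k * exp (- (1 / y)) else 0)"

lemma bump_half_tendsto_0: "(bump_half k \<longlongrightarrow> 0) (at_right 0)"
proof -
  have "((\<lambda>z. z ^ k / exp z) \<longlongrightarrow> (0::real)) at_top"
    by (rule tendsto_power_div_exp_0)
  from filterlim_compose[OF this filterlim_inverse_at_top_right]
  have "((\<lambda>y::real. inverse y ^ k / exp (inverse y)) \<longlongrightarrow> 0) (at_right 0)" .
  moreover have "eventually (\<lambda>y. inverse y ^ k / exp (inverse y) = bump_half k y) (at_right 0)"
    using eventually_at_right_less[of 0]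
    by eventually_elim (simp add: bump_half_def exp_minus divide_inverse)
  ultimately show ?thesis
    by (rule Lim_transform_eventually)
qed

lemma bump_half_deriv: "(bump_half k has_real_derivative - real k * bump_half (Suc k) y + bump_half (Suc (Suc k)) y) (at y)"
proof (cases y "0::real" rule: linorder_cases)
  case greater
  have d1: "((\<lambda>y. 1 / y) has_real_derivative - ((1 / y)\<^sup>2)) (at y)"
    using greater by (auto intro!: derivative_eq_intros simp: power2_eq_square)
  have dp: "((\<lambda>y. (1 / y) ^ k) has_real_derivative - real k * (1 / y) ^ Suc k) (at y)"
    using DERIV_power[OF d1, of k] by (cases k) (auto simp: power2_eq_square mult_ac simp del: of_nat_Suc)
  have de: "((\<lambda>y. exp (- (1 / y))) has_real_derivative exp (- (1 / y)) * (1 / y)\<^sup>2) (at y)"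
    using DERIV_chain2[OF DERIV_exp DERIV_minus[OF d1]] by simp
  have "((\<lambda>y. (1 / y) ^ k * exp (- (1 / y))) has_real_derivative - real k * bump_half (Suc k) y + bump_half (Suc (Suc k)) y) (at y)"
    using DERIV_mult[OF dp de] greater by (simp add: bump_half_def algebra_simps power2_eq_square)
  then show ?thesis
    by (rule has_field_derivative_transform_within_open[where S = "{0<..}"]) (use greater in \<open>auto simp: bump_half_def\<close>)
next
  case less
  have "((\<lambda>y. 0) has_real_derivative - real k * bump_half (Suc k) y + bump_half (Suc (Suc k)) y) (at y)"
    using less by (simp add: bump_half_def)
  then show ?thesis
    by (rule has_field_derivative_transform_within_open[where S = "{..<0}"]) (use less in \<open>auto simp: bump_half_def\<close>)
next
  case equal
  \<comment> \<open>To the right of 0 the difference quotient is itself a member of the family, with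
    index \<open>Suc k\<close>, and hence tends to 0; to the left it vanishes.\<close>
  have "((\<lambda>h. (bump_half k h - bump_half k 0) / h) \<longlongrightarrow> 0) (at 0)"
    unfolding filterlim_at_split
  proof
    show "((\<lambda>h. (bump_half k h - bump_half k 0) / h) \<longlongrightarrow> 0) (at_left 0)"
      by (rule tendsto_eventually) (auto simp: bump_half_def eventually_at_filter)
    have "eventually (\<lambda>h. bump_half (Suc k) h = (bump_half k h - bump_half k 0) / h) (at_right 0)"
      using eventually_at_right_less[of 0] by eventually_elim (simp add: bump_half_def)
    then show "((\<lambda>h. (bump_half k h - bump_half k 0) / h) \<longlongrightarrow> 0) (at_right 0)"
      by (rule Lim_transform_eventually[OF bump_half_tendsto_0])
  qed
  then show ?thesis
    using equal by (simp add: has_field_derivative_iff bump_half_def)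
qed

text \<open>A class of functions that is closed under differentiation, hence consists of smooth functions.\<close>

inductive_set smooth_class :: "(real \<Rightarrow> real) set" where
  const: "(\<lambda>x. c) \<in> smooth_class"
| bump_half: "(\<lambda>x. bump_half k (a * x + b)) \<in> smooth_class"
| cos: "(\<lambda>x. cos (w * x)) \<in> smooth_class"
| sin: "(\<lambda>x. sin (w * x)) \<in> smooth_class"
| add: "f \<in> smooth_class \<Longrightarrow> g \<in> smooth_class \<Longrightarrow> (\<lambda>x. f x + g x) \<in> smooth_class"
| mult: "f \<in> smooth_class \<Longrightarrow> g \<in> smooth_class \<Longrightarrow> (\<lambda>x. f x * g x) \<in> smooth_class"

lemma smooth_class_deriv:
  assumes "f \<in> smooth_class"
  shows "\<exists>f'\<in>smooth_class. \<forall>x. (f has_real_derivative f' x) (at x)"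
  using assms
proof induction
  case (const c)
  show ?case by (rule bexI[OF _ smooth_class.const[of 0]]) simp
next
  case (bump_half k a b)
  let ?f' = "\<lambda>x. a * (- real k * bump_half (Suc k) (a * x + b) + bump_half (Suc (Suc k)) (a * x + b))"
  have "?f' \<in> smooth_class" by (intro smooth_class.intros)
  moreover have "((\<lambda>x. bump_half k (a * x + b)) has_real_derivative ?f' x) (at x)" for x
  proof -
    have "((\<lambda>x. a * x + b) has_real_derivative a) (at x)" by (auto intro!: derivative_eq_intros)
    from DERIV_chain2[OF bump_half_deriv this] show ?thesis by (simp only: mult.commute)
  qed
  ultimately show ?case by (intro bexI[of _ ?f'] allI)
next
  case (cos w)
  let ?f' = "\<lambda>x. - w * sin (w * x)"
  have "?f' \<in> smooth_class" by (intro smooth_class.intros)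
  moreover have "((\<lambda>x. cos (w * x)) has_real_derivative ?f' x) (at x)" for x
    by (auto intro!: derivative_eq_intros)
  ultimately show ?case by (intro bexI[of _ ?f'] allI)
next
  case (sin w)
  let ?f' = "\<lambda>x. w * cos (w * x)"
  have "?f' \<in> smooth_class" by (intro smooth_class.intros)
  moreover have "((\<lambda>x. sin (w * x)) has_real_derivative ?f' x) (at x)" for x
    by (auto intro!: derivative_eq_intros)
  ultimately show ?case by (intro bexI[of _ ?f'] allI)
next
  case (add f g)
  then obtain f' g' where "f' \<in> smooth_class" "g' \<in> smooth_class"
    "\<And>x. (f has_real_derivative f' x) (at x)" "\<And>x. (g has_real_derivative g' x) (at x)" by blast
  then show ?case
    by (intro bexI[of _ "\<lambda>x. f' x + g' x"]) (auto intro!: derivative_eq_intros smooth_class.intros)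
next
  case (mult f g)
  then obtain f' g' where "f' \<in> smooth_class" "g' \<in> smooth_class"
    "\<And>x. (f has_real_derivative f' x) (at x)" "\<And>x. (g has_real_derivative g' x) (at x)" by blast
  with mult show ?case
    by (intro bexI[of _ "\<lambda>x. f' x * g x + g' x * f x"]) (auto intro!: derivative_eq_intros smooth_class.intros)
qed

lemma smooth_class_iterated_deriv: "f \<in> smooth_class \<Longrightarrow> (deriv ^^ k) f \<in> smooth_class"
proof (induction k)
  case (Suc k)
  then obtain f' where f': "f' \<in> smooth_class" "\<And>x. ((deriv ^^ k) f has_real_derivative f' x) (at x)"
    using smooth_class_deriv by blast
  then have "deriv ((deriv ^^ k) f) = f'"
    by (intro ext DERIV_imp_deriv)
  with f' show ?case by simp
qed simp

lemma smooth_class_differentiable: "f \<in> smooth_class \<Longrightarrow> (f :: real \<Rightarrow> real) differentiable at x"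
  using smooth_class_deriv real_differentiable_def by blast

lemma smooth_class_test_function:
  "f \<in> smooth_class \<Longrightarrow> (\<And>x. \<bar>x\<bar> > R \<Longrightarrow> f x = 0) \<Longrightarrow> test_function f"
  unfolding test_function_def
  using smooth_class_differentiable[OF smooth_class_iterated_deriv] by blast

text \<open>The factor \<open>exp 2\<close> compensates the two values exp(-1) at the origin, so
  that \<open>bump (x / R)\<close> tends to 1 as \<open>R\<close> grows. The arguments are spelled
  \<open>1 * x + 1\<close> and \<open>(- 1) * x + 1\<close> to match the affine form
  \<open>a * x + b\<close> of the smooth class.\<close>

definition bump :: "real \<Rightarrow> real"
  where "bump x = exp 2 * (bump_half 0 (1 * x + 1) * bump_half 0 ((- 1) * x + 1))"

lemma bump_0: "bump 0 = 1"
  by (simp add: bump_def bump_half_def flip: exp_add)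

lemma bump_eq_0: "\<bar>x\<bar> \<ge> 1 \<Longrightarrow> bump x = 0"
  by (auto simp: bump_def bump_half_def)

lemma bump_scaled_smooth: "(\<lambda>x. bump (x / R)) \<in> smooth_class"
proof -
  have "(\<lambda>x. bump (x / R)) = (\<lambda>x. exp 2 * (bump_half 0 ((1 / R) * x + 1) * bump_half 0 ((- 1 / R) * x + 1)))"
    by (simp add: bump_def)
  also have "\<dots> \<in> smooth_class" by (intro smooth_class.intros)
  finally show ?thesis .
qed

lemma bump_deriv_bounded:
  obtains bump' B where "\<And>x. (bump has_real_derivative bump' x) (at x)" "bump' \<in> borel_measurable borel"
    "\<And>x. \<bar>bump' x\<bar> \<le> B" "\<And>x. \<bar>bump x\<bar> \<le> B" "\<And>x. \<bar>x\<bar> > 1 \<Longrightarrow> bump' x = 0"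
proof -
  have "bump \<in> smooth_class" using bump_scaled_smooth[of 1] by simp
  then obtain bump' where b: "bump' \<in> smooth_class" "\<And>x. (bump has_real_derivative bump' x) (at x)"
    using smooth_class_deriv by blast
  have zero: "bump' x = 0" if "\<bar>x\<bar> > 1" for x
  proof -
    have "(bump has_real_derivative 0) (at x)"
    proof (rule has_field_derivative_transform_within_open[where f = "\<lambda>x. 0" and S = "- {-1..1}"])
      show "open (- {-1..1::real})" by (intro open_Compl closed_atLeastAtMost)
    qed (use that in \<open>auto simp: bump_eq_0\<close>)
    then show ?thesis using b(2) DERIV_unique by blast
  qed
  have c: "continuous_on UNIV bump'"
    using b(1) smooth_class_differentiable differentiable_imp_continuous_within
    by (metis continuous_on_eq_continuous_within)
  have c': "continuous_on UNIV bump"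
    using b(2) DERIV_isCont continuous_at_imp_continuous_on by blast
  have "bounded (bump' ` {-1..1})" "bounded (bump ` {-1..1})"
    using c c' by (auto intro!: compact_imp_bounded compact_continuous_image intro: continuous_on_subset)
  then obtain B1 B2 where B: "\<forall>x\<in>{-1..1}. \<bar>bump' x\<bar> \<le> B1" "\<forall>x\<in>{-1..1}. \<bar>bump x\<bar> \<le> B2"
    by (auto simp: bounded_iff)
  have "\<bar>bump' x\<bar> \<le> max 0 (max B1 B2)" "\<bar>bump x\<bar> \<le> max 0 (max B1 B2)" for x
    using B zero[of x] bump_eq_0[of x] by (cases "x \<in> {-1..1}"; force)+
  moreover have "bump' \<in> borel_measurable borel"
    using c by (rule borel_measurable_continuous_onI)
  ultimately show ?thesis using that b(2) zero by blast
qed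

section \<open>Weak derivatives on the Fourier side\<close>

lemma fourier_tendsto_of_l2:
  assumes F: "\<And>n. square_integrable (F n)" and f: "square_integrable f"
    and lim: "(\<lambda>n. norm (abs_l2 (emb (\<lambda>x. F n x - f x)))) \<longlonglongrightarrow> 0"
  shows "(\<lambda>n. abs_l2 (fourier (F n))) \<longlonglongrightarrow> abs_l2 (fourier f)"
proof -
  have "(\<lambda>n. abs_l2 (fourier (F n)) - abs_l2 (fourier f)) \<longlonglongrightarrow> 0"
  proof (rule Lim_null_comparison)
    show "\<forall>\<^sub>F n in sequentially. norm (abs_l2 (fourier (F n)) - abs_l2 (fourier f)) \<le> sqrt (2 * pi) * norm (abs_l2 (emb (\<lambda>x. F n x - f x)))"
    proof (intro always_eventually allI)
      fix n
      have "abs_l2 (fourier (F n)) - abs_l2 (fourier f) = abs_l2 (fourier (\<lambda>x. F n x - f x))"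
        using fourier_diff[OF F f, of n]
        by (auto simp: abs_l2_diff fourier_sqi F f intro!: abs_l2_eqI sqi_diff fourier_sqi elim!: eventually_mono)
      then show "norm (abs_l2 (fourier (F n)) - abs_l2 (fourier f)) \<le> sqrt (2 * pi) * norm (abs_l2 (emb (\<lambda>x. F n x - f x)))"
        using fourier_bessel[OF sqi_diff[OF F f]] by simp
    qed
    show "(\<lambda>n. sqrt (2 * pi) * norm (abs_l2 (emb (\<lambda>x. F n x - f x)))) \<longlonglongrightarrow> 0"
      using tendsto_mult_left[OF lim] by simp
  qed
  then show ?thesis by (simp add: LIM_zero_iff)
qed

lemma l2_multiplier_tendsto:
  fixes w :: "real \<Rightarrow> complex"
  assumes w [measurable]: "w \<in> borel_measurable borel" and le: "\<And>x. norm (w x) \<le> 1"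
    and F: "\<And>n. square_integrable (F n)" and f: "square_integrable f"
    and lim: "(\<lambda>n. abs_l2 (F n)) \<longlonglongrightarrow> abs_l2 f"
  shows "(\<lambda>n. abs_l2 (\<lambda>x. w x * F n x)) \<longlonglongrightarrow> abs_l2 (\<lambda>x. w x * f x)"
proof -
  have sw: "square_integrable (\<lambda>x. w x * h x)" if h: "square_integrable h" for h
    by (rule sqi_bound[OF h, where c = 1]) (use h in \<open>auto simp: norm_mult le intro!: AE_I2 mult_left_le_one_le\<close>)
  have "(\<lambda>n. abs_l2 (\<lambda>x. w x * F n x) - abs_l2 (\<lambda>x. w x * f x)) \<longlonglongrightarrow> 0"
  proof (rule Lim_null_comparison)
    show "\<forall>\<^sub>F n in sequentially. norm (abs_l2 (\<lambda>x. w x * F n x) - abs_l2 (\<lambda>x. w x * f x)) \<le> norm (abs_l2 (F n) - abs_l2 f)"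
    proof (intro always_eventually allI)
      fix n
      have "norm (abs_l2 (\<lambda>x. w x * (F n x - f x))) \<le> norm (abs_l2 (\<lambda>x. F n x - f x))"
      proof (rule abs_l2_norm_mono[OF sqi_diff[OF F f]])
        show "(\<lambda>x. w x * (F n x - f x)) \<in> borel_measurable borel" using sw[OF sqi_diff[OF F f]] by auto
      qed (auto simp: norm_mult le intro!: AE_I2 mult_left_le_one_le)
      then show "norm (abs_l2 (\<lambda>x. w x * F n x) - abs_l2 (\<lambda>x. w x * f x)) \<le> norm (abs_l2 (F n) - abs_l2 f)"
        by (simp add: abs_l2_diff sw F f right_diff_distrib)
    qed
    have "(\<lambda>n. norm (abs_l2 (F n) - abs_l2 f)) \<longlonglongrightarrow> norm (abs_l2 f - abs_l2 f)"
      by (intro tendsto_intros lim)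
    then show "(\<lambda>n. norm (abs_l2 (F n) - abs_l2 f)) \<longlonglongrightarrow> 0" by simp
  qed
  then show ?thesis by (simp add: LIM_zero_iff)
qed

text \<open>The complex exponential is not an admissible test function, being neither real nor
  compactly supported. Its cosine and sine parts are, once multiplied by the window
  \<open>bump (x / R)\<close>. The product rule yields the expected factor and an error term in
  which the derivative falls on the window.\<close>

lemma weak_deriv_windowed_ft:
  assumes w: "weak_deriv f g" and f: "square_integrable f" and g: "square_integrable g" and R: "R > 0"
    and b: "\<And>x. (bump has_real_derivative bump' x) (at x)" and [measurable]: "bump' \<in> borel_measurable borel"
    and f1: "integrable lborel (emb (\<lambda>x. bump (x / R) * f x))"
    and f2: "integrable lborel (emb (\<lambda>x. bump' (x / R) / R * f x))"
    and g1: "integrable lborel (emb (\<lambda>x. bump (x / R) * g x))"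
  shows "ft (emb (\<lambda>x. bump (x / R) * g x)) \<xi>
    = \<i> * \<xi> * ft (emb (\<lambda>x. bump (x / R) * f x)) \<xi> - ft (emb (\<lambda>x. bump' (x / R) / R * f x)) \<xi>"
proof -
  define \<phi>c where "\<phi>c x = bump (x / R) * cos (\<xi> * x)" for x
  define \<phi>s where "\<phi>s x = bump (x / R) * sin (\<xi> * x)" for x
  have [measurable]: "f \<in> borel_measurable borel" "g \<in> borel_measurable borel" using f g by auto
  have bR: "((\<lambda>x. bump (x / R)) has_real_derivative bump' (x / R) / R) (at x)" for x
  proof -
    have "((\<lambda>x. x / R) has_real_derivative 1 / R) (at x)" by (rule DERIV_cdivide[OF DERIV_ident])
    from DERIV_chain2[OF b this] show ?thesis by simp
  qed
  have supp: "bump (x / R) = 0" if "\<bar>x\<bar> > R" for x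
    using that R by (intro bump_eq_0) (simp add: field_simps)
  have tc: "test_function \<phi>c" and ts: "test_function \<phi>s"
    by (rule smooth_class_test_function[where R = R];
        auto simp: \<phi>c_def[abs_def] \<phi>s_def[abs_def] supp intro!: smooth_class.intros bump_scaled_smooth)+
  have dc: "deriv \<phi>c x = bump' (x / R) / R * cos (\<xi> * x) - \<xi> * (bump (x / R) * sin (\<xi> * x))"
    and ds: "deriv \<phi>s x = bump' (x / R) / R * sin (\<xi> * x) + \<xi> * (bump (x / R) * cos (\<xi> * x))" for x
    unfolding \<phi>c_def[abs_def] \<phi>s_def[abs_def]
    by (rule DERIV_imp_deriv, auto intro!: derivative_eq_intros bR)+
  have wc: "(LINT x|lborel. f x * deriv \<phi>c x) = - (LINT x|lborel. g x * \<phi>c x)"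
    and ws: "(LINT x|lborel. f x * deriv \<phi>s x) = - (LINT x|lborel. g x * \<phi>s x)"
    using w tc ts unfolding weak_deriv_def by blast+
  have e: "iexp (- (\<xi> * x)) = complex_of_real (cos (\<xi> * x)) - \<i> * complex_of_real (sin (\<xi> * x))" for x
    by (subst cis_conv_exp[symmetric]) (simp add: complex_eq_iff)
  have bd: "\<bar>cos t\<bar> \<le> 1" "\<bar>sin t\<bar> \<le> 1" for t :: real by simp_all
  have ci: "integrable lborel (\<lambda>x. h x * cos (\<xi> * x))" "integrable lborel (\<lambda>x. h x * sin (\<xi> * x))"
    if "integrable lborel (emb h)" for h
  proof -
    have h: "integrable lborel h" using that by (simp add: complex_of_real_integrable_eq)
    then have [measurable]: "h \<in> borel_measurable borel" by auto
    show "integrable lborel (\<lambda>x. h x * cos (\<xi> * x))" "integrable lborel (\<lambda>x. h x * sin (\<xi> * x))"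
      by (rule Bochner_Integration.integrable_bound[OF h]; auto simp: abs_mult intro!: AE_I2 mult_right_le_one_le)+
  qed
  have ft_cs: "ft (emb h) \<xi> = complex_of_real (LINT x|lborel. h x * cos (\<xi> * x)) - \<i> * complex_of_real (LINT x|lborel. h x * sin (\<xi> * x))"
    if h: "integrable lborel (emb h)" for h
  proof -
    have "ft (emb h) \<xi> = (CLINT x|lborel. complex_of_real (h x * cos (\<xi> * x)) - \<i> * complex_of_real (h x * sin (\<xi> * x)))"
      unfolding ft_def e by (intro Bochner_Integration.integral_cong) (auto simp: algebra_simps)
    also have "\<dots> = (CLINT x|lborel. complex_of_real (h x * cos (\<xi> * x))) - (CLINT x|lborel. \<i> * complex_of_real (h x * sin (\<xi> * x)))"
      by (intro Bochner_Integration.integral_diff integrable_mult_right) (use ci[OF h] in \<open>simp_all only: complex_of_real_integrable_eq\<close>)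
    finally show ?thesis
      by (simp only: integral_mult_right_zero integral_complex_of_real)
  qed
  have "(LINT x|lborel. f x * deriv \<phi>c x) = (LINT x|lborel. bump' (x / R) / R * f x * cos (\<xi> * x) - \<xi> * (bump (x / R) * f x * sin (\<xi> * x)))"
    by (intro Bochner_Integration.integral_cong) (auto simp: dc algebra_simps)
  also have "\<dots> = (LINT x|lborel. bump' (x / R) / R * f x * cos (\<xi> * x)) - \<xi> * (LINT x|lborel. bump (x / R) * f x * sin (\<xi> * x))"
    using ci[OF f1] ci[OF f2] by (subst Bochner_Integration.integral_diff) auto
  finally have c: "(LINT x|lborel. bump (x / R) * g x * cos (\<xi> * x))
      = \<xi> * (LINT x|lborel. bump (x / R) * f x * sin (\<xi> * x)) - (LINT x|lborel. bump' (x / R) / R * f x * cos (\<xi> * x))"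
    using wc by (simp add: \<phi>c_def mult_ac)
  have "(LINT x|lborel. f x * deriv \<phi>s x) = (LINT x|lborel. bump' (x / R) / R * f x * sin (\<xi> * x) + \<xi> * (bump (x / R) * f x * cos (\<xi> * x)))"
    by (intro Bochner_Integration.integral_cong) (auto simp: ds algebra_simps)
  also have "\<dots> = (LINT x|lborel. bump' (x / R) / R * f x * sin (\<xi> * x)) + \<xi> * (LINT x|lborel. bump (x / R) * f x * cos (\<xi> * x))"
    using ci[OF f1] ci[OF f2] by (subst Bochner_Integration.integral_add) auto
  finally have s: "(LINT x|lborel. bump (x / R) * g x * sin (\<xi> * x))
      = - (LINT x|lborel. bump' (x / R) / R * f x * sin (\<xi> * x)) - \<xi> * (LINT x|lborel. bump (x / R) * f x * cos (\<xi> * x))"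
    using ws by (simp add: \<phi>s_def mult_ac)
  show ?thesis
    unfolding ft_cs[OF f1] ft_cs[OF f2] ft_cs[OF g1] c s
    by (simp add: complex_eq_iff)
qed

text \<open>As the window widens, the error term is \<open>O(1/R)\<close> in L^2, because the
  derivative of the window carries a factor \<open>1 / R\<close>. Multiplication by
  \<open>\<xi>\<close> is not continuous on L^2, so the relation is multiplied by
  \<open>jweight (-1)\<close> before passing to the limit and divided by it afterwards.\<close>

lemma weak_deriv_fourier:
  assumes w: "weak_deriv f g" and f: "square_integrable f" and g: "square_integrable g"
  shows "AE \<xi> in lborel. fourier g \<xi> = \<i> * \<xi> * fourier f \<xi>"
proof -
  obtain bump' B where b: "\<And>x. (bump has_real_derivative bump' x) (at x)" and b'm [measurable]: "bump' \<in> borel_measurable borel"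
    and B: "\<And>x. \<bar>bump' x\<bar> \<le> B" "\<And>x. \<bar>bump x\<bar> \<le> B" and supp': "\<And>x. \<bar>x\<bar> > 1 \<Longrightarrow> bump' x = 0"
    by (rule bump_deriv_bounded) (rule that)
  have cb: "continuous_on UNIV bump"
    using b DERIV_isCont continuous_at_imp_continuous_on by blast
  have bm [measurable]: "bump \<in> borel_measurable borel" using cb by (rule borel_measurable_continuous_onI)
  have [measurable]: "f \<in> borel_measurable borel" "g \<in> borel_measurable borel" using f g by auto
  define R where "R n = real (Suc n)" for n
  have R: "R n > 0" for n by (simp add: R_def)
  have B0: "B \<ge> 0" using B(1)[of 0] by linarith
  have sb: "square_integrable (\<lambda>x. k (x / R n) * h x)" and ib: "integrable lborel (emb (\<lambda>x. k (x / R n) * h x))"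
    if h: "square_integrable h" and k [measurable]: "k \<in> borel_measurable borel" and kB: "\<And>x. \<bar>k x\<bar> \<le> C" and ks: "\<And>x. \<bar>x\<bar> > 1 \<Longrightarrow> k x = 0"
    for h k n C
  proof -
    have [measurable]: "h \<in> borel_measurable borel" using h by auto
    show s: "square_integrable (\<lambda>x. k (x / R n) * h x)"
      by (rule sqi_bound[OF h, where c = C]) (auto simp: abs_mult intro!: mult_right_mono kB)
    \<comment> \<open>The window vanishes outside \<open>{- R n..R n}\<close>, so truncation changes
      nothing, and truncated square integrable functions are integrable.\<close>
    have "emb (\<lambda>x. k (x / R n) * h x) = truncate (R n) (\<lambda>x. k (x / R n) * h x)"
      using R[of n] by (auto simp: truncate_def fun_eq_iff indicator_def field_simps intro!: ks)
    then show "integrable lborel (emb (\<lambda>x. k (x / R n) * h x))"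
      using truncate_integrable[OF s] by simp
  qed
  have bs: "\<bar>x\<bar> > 1 \<Longrightarrow> bump x = 0" for x using bump_eq_0[of x] by simp
  have b2m: "(\<lambda>x. bump' x / R n) \<in> borel_measurable borel" for n by measurable
  have b2B: "\<bar>bump' x / R n\<bar> \<le> B / R n" for x n using B R[of n] by (simp add: abs_divide divide_right_mono)
  have b2s: "\<bar>x\<bar> > 1 \<Longrightarrow> bump' x / R n = 0" for x n using supp' by simp
  note s1 = sb[OF _ bm B(2) bs] and i1 = ib[OF _ bm B(2) bs]
  note s2 = sb[OF _ b2m b2B b2s] and i2 = ib[OF _ b2m b2B b2s]
  define P where "P n x = bump (x / R n) * g x" for n x
  define Q where "Q n x = bump (x / R n) * f x" for n x
  define S where "S n x = bump' (x / R n) / R n * f x" for n x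
  have sP: "square_integrable (P n)" and sQ: "square_integrable (Q n)" and sS: "square_integrable (S n)" for n
    unfolding P_def[abs_def] Q_def[abs_def] S_def[abs_def] using s1[OF f] s1[OF g] s2[OF f] by auto
  have iP: "integrable lborel (emb (P n))" and iQ: "integrable lborel (emb (Q n))" and iS: "integrable lborel (emb (S n))" for n
    unfolding P_def[abs_def] Q_def[abs_def] S_def[abs_def] using i1[OF f] i1[OF g] i2[OF f] by auto
  have rel: "AE \<xi> in lborel. fourier (P n) \<xi> = \<i> * \<xi> * fourier (Q n) \<xi> - fourier (S n) \<xi>" for n
    using fourier_eq_ft[OF sP iP, of n] fourier_eq_ft[OF sQ iQ, of n] fourier_eq_ft[OF sS iS, of n]
  proof eventually_elim
    case (elim \<xi>)
    have "ft (emb (P n)) \<xi> = \<i> * \<xi> * ft (emb (Q n)) \<xi> - ft (emb (S n)) \<xi>"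
      unfolding P_def[abs_def] Q_def[abs_def] S_def[abs_def]
      by (rule weak_deriv_windowed_ft[OF w f g R b b'm]) (use i1[OF f] i1[OF g] i2[OF f] in auto)
    then show ?case using elim by simp
  qed
  have lim1: "(\<lambda>n. abs_l2 (fourier (\<lambda>x. bump (x / R n) * h x))) \<longlonglongrightarrow> abs_l2 (fourier h)" if h: "square_integrable h" for h
  proof (rule fourier_tendsto_of_l2[OF s1[OF h] h])
    have [measurable]: "h \<in> borel_measurable borel" using h by auto
    let ?D = "\<lambda>n x. bump (x / R n) * h x - h x"
    have sD: "square_integrable (emb (?D n))" for n
      by (intro sqi_of_real sqi_diff s1 h)
    have "(\<lambda>n. LINT x|lborel. (norm (emb (?D n) x))\<^sup>2) \<longlonglongrightarrow> (LINT x|(lborel::real measure). (0::real))"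
    proof (rule integral_dominated_convergence[where w = "\<lambda>x. (B + 1)\<^sup>2 * (norm (h x))\<^sup>2"])
      show "AE x in lborel. (\<lambda>n. (norm (emb (?D n) x))\<^sup>2) \<longlonglongrightarrow> 0"
      proof (rule AE_I2)
        fix x
        have "(\<lambda>n. x / R n) \<longlonglongrightarrow> 0"
          unfolding R_def using tendsto_mult[OF tendsto_const[of x] LIMSEQ_Suc[OF lim_inverse_n]] by (simp add: divide_inverse)
        then have "(\<lambda>n. bump (x / R n)) \<longlonglongrightarrow> bump 0"
          using cb continuous_on_tendsto_compose[of UNIV bump "\<lambda>n. x / R n" 0] by simp
        then have "(\<lambda>n. (norm (emb (?D n) x))\<^sup>2) \<longlonglongrightarrow> (norm (complex_of_real (bump 0 * h x - h x)))\<^sup>2"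
          by (intro tendsto_intros)
        then show "(\<lambda>n. (norm (emb (?D n) x))\<^sup>2) \<longlonglongrightarrow> 0" by (simp add: bump_0)
      qed
      show "AE x in lborel. norm ((norm (emb (?D n) x))\<^sup>2) \<le> (B + 1)\<^sup>2 * (norm (h x))\<^sup>2" for n
      proof (rule AE_I2)
        fix x
        have "norm (emb (?D n) x) = \<bar>bump (x / R n) - 1\<bar> * \<bar>h x\<bar>"
          unfolding norm_of_real by (simp add: left_diff_distrib flip: abs_mult)
        also have "\<dots> \<le> (B + 1) * \<bar>h x\<bar>"
          using B(2)[of "x / R n"] by (intro mult_right_mono) auto
        finally have "(norm (emb (?D n) x))\<^sup>2 \<le> ((B + 1) * \<bar>h x\<bar>)\<^sup>2"
          by (intro power_mono) auto
        then show "norm ((norm (emb (?D n) x))\<^sup>2) \<le> (B + 1)\<^sup>2 * (norm (h x))\<^sup>2"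
          by (simp add: power_mult_distrib)
      qed
    qed (use sqi_integrable[OF h] in auto)
    then have "(\<lambda>n. sqrt (LINT x|lborel. (norm (emb (?D n) x))\<^sup>2)) \<longlonglongrightarrow> sqrt 0"
      by (intro tendsto_real_sqrt) simp
    then show "(\<lambda>n. norm (abs_l2 (emb (?D n)))) \<longlonglongrightarrow> 0"
      by (simp only: abs_l2_norm[OF sD] real_sqrt_zero)
  qed
  have limS: "(\<lambda>n. abs_l2 (fourier (S n))) \<longlonglongrightarrow> abs_l2 (fourier (\<lambda>x. 0))"
  proof (rule fourier_tendsto_of_l2[OF sS])
    show "(\<lambda>n. norm (abs_l2 (emb (\<lambda>x. S n x - 0)))) \<longlonglongrightarrow> 0"
    proof (rule Lim_null_comparison)
      show "\<forall>\<^sub>F n in sequentially. norm (norm (abs_l2 (emb (\<lambda>x. S n x - 0)))) \<le> B / R n * norm (abs_l2 (emb f))"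
      proof (intro always_eventually allI)
        fix n
        have "norm (abs_l2 (emb (S n))) \<le> B / R n * norm (abs_l2 (emb f))"
        proof (rule abs_l2_norm_le[OF sqi_of_real[OF f]])
          show "emb (S n) \<in> borel_measurable borel" using sS[of n] by auto
          show "AE x in lborel. norm (emb (S n) x) \<le> B / R n * norm (emb f x)"
            unfolding S_def norm_of_real abs_mult by (intro AE_I2 mult_right_mono b2B abs_ge_zero)
          show "0 \<le> B / R n" using B0 R[of n] by simp
        qed
        then show "norm (norm (abs_l2 (emb (\<lambda>x. S n x - 0)))) \<le> B / R n * norm (abs_l2 (emb f))" by simp
      qed
      have "(\<lambda>n. B * inverse (R n) * norm (abs_l2 (emb f))) \<longlonglongrightarrow> B * 0 * norm (abs_l2 (emb f))"
        unfolding R_def by (intro tendsto_intros LIMSEQ_inverse_real_of_nat)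
      then show "(\<lambda>n. B / R n * norm (abs_l2 (emb f))) \<longlonglongrightarrow> 0" by (simp add: divide_inverse)
    qed
  qed simp
  \<comment> \<open>After this multiplication both multipliers, 1 and \<open>\<i> * \<xi>\<close>,
    become bounded by 1.\<close>
  let ?w = "\<lambda>\<xi>. complex_of_real (jweight (-1) \<xi>)" and ?v = "\<lambda>\<xi>. \<i> * complex_of_real \<xi> * complex_of_real (jweight (-1) \<xi>)"
  have w1: "norm (?w \<xi>) \<le> 1" for \<xi>
    using jweight_mono[of "-1" 0 \<xi>] by simp
  have v1: "norm (?v \<xi>) \<le> 1" for \<xi>
  proof -
    have "\<bar>\<xi>\<bar> * jweight (-1) \<xi> \<le> jweight 1 \<xi> * jweight (-1) \<xi>"
      by (intro mult_right_mono abs_le_jweight) simp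
    also have "\<dots> = 1" using jweight_add[of 1 "-1" \<xi>] by simp
    finally show ?thesis by (simp add: norm_mult)
  qed
  have sw: "square_integrable (\<lambda>x. u x * h x)" if h: "square_integrable h" and [measurable]: "u \<in> borel_measurable borel" and u: "\<And>x. norm (u x) \<le> 1"
    for h u :: "real \<Rightarrow> complex"
    by (rule sqi_bound[OF h, where c = 1]) (use h in \<open>auto simp: norm_mult u intro!: AE_I2 mult_left_le_one_le\<close>)
  have wm: "?w \<in> borel_measurable borel" and vm: "?v \<in> borel_measurable borel" by measurable
  note fs = fourier_sqi
  have "(\<lambda>n. abs_l2 (\<lambda>\<xi>. ?w \<xi> * fourier (P n) \<xi>)) \<longlonglongrightarrow> abs_l2 (\<lambda>\<xi>. ?w \<xi> * fourier g \<xi>)"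
    by (intro l2_multiplier_tendsto wm w1 fs sP g) (use lim1[OF g] in \<open>simp add: P_def[abs_def]\<close>)
  moreover have "abs_l2 (\<lambda>\<xi>. ?w \<xi> * fourier (P n) \<xi>) = abs_l2 (\<lambda>\<xi>. ?v \<xi> * fourier (Q n) \<xi>) - abs_l2 (\<lambda>\<xi>. ?w \<xi> * fourier (S n) \<xi>)" for n
  proof -
    have "abs_l2 (\<lambda>\<xi>. ?w \<xi> * fourier (P n) \<xi>) = abs_l2 (\<lambda>\<xi>. ?v \<xi> * fourier (Q n) \<xi> - ?w \<xi> * fourier (S n) \<xi>)"
    proof (rule abs_l2_eqI)
      show "AE \<xi> in lborel. ?w \<xi> * fourier (P n) \<xi> = ?v \<xi> * fourier (Q n) \<xi> - ?w \<xi> * fourier (S n) \<xi>"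
        using rel[of n] by eventually_elim (simp only: right_diff_distrib mult_ac)
    qed (intro sqi_diff sw fs sP sQ sS wm vm w1 v1)+
    also have "\<dots> = abs_l2 (\<lambda>\<xi>. ?v \<xi> * fourier (Q n) \<xi>) - abs_l2 (\<lambda>\<xi>. ?w \<xi> * fourier (S n) \<xi>)"
      by (intro abs_l2_diff[symmetric] sw fs sQ sS wm vm w1 v1)
    finally show ?thesis .
  qed
  moreover have "(\<lambda>n. abs_l2 (\<lambda>\<xi>. ?v \<xi> * fourier (Q n) \<xi>) - abs_l2 (\<lambda>\<xi>. ?w \<xi> * fourier (S n) \<xi>))
      \<longlonglongrightarrow> abs_l2 (\<lambda>\<xi>. ?v \<xi> * fourier f \<xi>) - abs_l2 (\<lambda>\<xi>. ?w \<xi> * fourier (\<lambda>x. 0) \<xi>)"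
    by (intro tendsto_diff l2_multiplier_tendsto wm vm w1 v1 fs sQ sS f limS sqi_zero) (use lim1[OF f] in \<open>simp add: Q_def[abs_def]\<close>)
  ultimately have "abs_l2 (\<lambda>\<xi>. ?w \<xi> * fourier g \<xi>) = abs_l2 (\<lambda>\<xi>. ?v \<xi> * fourier f \<xi>) - abs_l2 (\<lambda>\<xi>. ?w \<xi> * fourier (\<lambda>x. 0) \<xi>)"
    using LIMSEQ_unique by auto
  also have "\<dots> = abs_l2 (\<lambda>\<xi>. ?v \<xi> * fourier f \<xi> - ?w \<xi> * fourier (\<lambda>x. 0) \<xi>)"
    by (intro abs_l2_diff sw fs f wm vm w1 v1 sqi_zero)
  finally have "AE \<xi> in lborel. ?w \<xi> * fourier g \<xi> = ?v \<xi> * fourier f \<xi> - ?w \<xi> * fourier (\<lambda>x. 0) \<xi>"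
    by (subst (asm) abs_l2_eq_iff) (intro sqi_diff sw fs f g wm vm w1 v1 sqi_zero, assumption?)+
  moreover have "AE \<xi> in lborel. fourier (\<lambda>x. 0) \<xi> = 0"
    using fourier_scale[of "\<lambda>x. 0" 0] by simp
  ultimately show ?thesis
  proof eventually_elim
    case (elim \<xi>)
    then have "?w \<xi> * fourier g \<xi> = ?w \<xi> * (\<i> * \<xi> * fourier f \<xi>)" by (simp add: mult_ac)
    moreover have "?w \<xi> \<noteq> 0" using jweight_pos[of "-1" \<xi>] by (simp add: less_imp_neq[symmetric])
    ultimately show ?case by (metis mult_left_cancel)
  qed
qed

subsection \<open>Bilinear operators given by kernels on the Fourier side\<close>

text \<open>Each summand of the bound lets one of the two factors absorb a weight of order -1, which
  makes that factor integrable. One notion with an explicit constant thus covers products,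
  multiplication operators and the commutator.\<close>

definition admissible :: "real \<Rightarrow> (real \<Rightarrow> real \<Rightarrow> real) \<Rightarrow> bool"
  where "admissible c k \<longleftrightarrow> c \<ge> 0 \<and> case_prod k \<in> borel_measurable (borel \<Otimes>\<^sub>M borel) \<and>
    (\<forall>\<xi> \<eta>. \<bar>k \<xi> \<eta>\<bar> \<le> c * (jweight (-1) (\<xi> - \<eta>) + jweight (-1) \<eta>))"

definition kernel_fun :: "(real \<Rightarrow> real \<Rightarrow> real) \<Rightarrow> (real \<Rightarrow> complex) \<Rightarrow> (real \<Rightarrow> complex) \<Rightarrow> real \<Rightarrow> complex"
  where "kernel_fun k f g \<xi> = (LINT \<eta>|lborel. complex_of_real (k \<xi> \<eta>) * (f (\<xi> - \<eta>) * g \<eta>))"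

definition kernel_op :: "(real \<Rightarrow> real \<Rightarrow> real) \<Rightarrow> l2 \<Rightarrow> l2 \<Rightarrow> l2"
  where "kernel_op k F G = abs_l2 (kernel_fun k (rep_l2 F) (rep_l2 G))"

text \<open>The L^2 norm of the weight of order -1: the constant of the embedding of H^1 into the
  functions with integrable transform.\<close>

definition weight_const :: real
  where "weight_const = sqrt (LINT x|lborel. (jweight (-1) x)\<^sup>2)"

lemma weight_const_nonneg [simp]: "0 \<le> weight_const"
  by (simp add: weight_const_def)

lemma jweight_neg_le_1: "p \<le> 0 \<Longrightarrow> jweight p \<xi> \<le> 1"
  using jweight_mono[of p 0 \<xi>] by simp

lemma admissible_measurable:
  "admissible c k \<Longrightarrow> case_prod k \<in> borel_measurable (borel \<Otimes>\<^sub>M borel)"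
  by (simp add: admissible_def)

lemma kernel_fun_measurable [measurable]:
  assumes k [measurable]: "case_prod k \<in> borel_measurable (borel \<Otimes>\<^sub>M borel)"
    and [measurable]: "f \<in> borel_measurable borel" "g \<in> borel_measurable borel"
  shows "kernel_fun k f g \<in> borel_measurable borel"
proof -
  have "(\<lambda>\<xi>. LINT \<eta>|lborel. complex_of_real (k \<xi> \<eta>) * (f (\<xi> - \<eta>) * g \<eta>)) \<in> borel_measurable borel"
    by (rule lborel.borel_measurable_lebesgue_integral) measurable
  then show ?thesis unfolding kernel_fun_def[abs_def] .
qed

lemma kernel_fun_integrable:
  assumes k: "admissible c k" and f: "square_integrable f" and g: "square_integrable g"
  shows "integrable lborel (\<lambda>\<eta>. complex_of_real (k \<xi> \<eta>) * (f (\<xi> - \<eta>) * g \<eta>))"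
proof (rule Bochner_Integration.integrable_bound)
  note [measurable] = admissible_measurable[OF k]
  have [measurable]: "f \<in> borel_measurable borel" "g \<in> borel_measurable borel" using f g by auto
  show "integrable lborel (\<lambda>\<eta>. 2 * c * norm (f (\<xi> - \<eta>) * g \<eta>))"
    using conv_integrable[OF f g, of \<xi>] by simp
  show "AE \<eta> in lborel. norm (complex_of_real (k \<xi> \<eta>) * (f (\<xi> - \<eta>) * g \<eta>)) \<le> norm (2 * c * norm (f (\<xi> - \<eta>) * g \<eta>))"
  proof (rule AE_I2)
    fix \<eta>
    have "\<bar>k \<xi> \<eta>\<bar> \<le> c * (jweight (-1) (\<xi> - \<eta>) + jweight (-1) \<eta>)" using k by (simp add: admissible_def)
    also have "\<dots> \<le> c * (1 + 1)"
      using k by (intro mult_left_mono add_mono jweight_neg_le_1) (auto simp: admissible_def)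
    finally have "\<bar>k \<xi> \<eta>\<bar> \<le> 2 * c" by simp
    then have "norm (complex_of_real (k \<xi> \<eta>) * (f (\<xi> - \<eta>) * g \<eta>)) \<le> 2 * c * norm (f (\<xi> - \<eta>) * g \<eta>)"
      unfolding norm_mult[of "complex_of_real _"] norm_of_real by (rule mult_right_mono) simp
    then show "norm (complex_of_real (k \<xi> \<eta>) * (f (\<xi> - \<eta>) * g \<eta>)) \<le> norm (2 * c * norm (f (\<xi> - \<eta>) * g \<eta>))"
      by (rule order_trans) simp
  qed
  show "(\<lambda>\<eta>. complex_of_real (k \<xi> \<eta>) * (f (\<xi> - \<eta>) * g \<eta>)) \<in> borel_measurable lborel" by measurable
qed

lemma young_real:
  fixes f g :: "real \<Rightarrow> real"
  assumes f: "integrable lborel f" and g: "square_integrable g"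
  shows "norm (abs_l2 (emb (conv f g))) \<le> (LINT x|lborel. norm (f x)) * norm (abs_l2 (emb g))"
proof -
  have "sqrt (LINT \<xi>|lborel. (norm (conv f g \<xi>))\<^sup>2)
      \<le> sqrt ((LINT x|lborel. norm (f x))\<^sup>2 * (LINT x|lborel. (norm (g x))\<^sup>2))"
    by (intro real_sqrt_le_mono young_sqi f g)
  then show ?thesis
    unfolding abs_l2_norm[OF sqi_of_real[OF g]] abs_l2_norm[OF sqi_of_real[OF young_sqi(1)[OF f g]]]
    by (simp add: real_sqrt_mult)
qed

lemma weighted_l1:
  fixes f :: "real \<Rightarrow> complex"
  assumes f: "square_integrable f"
  shows "integrable lborel (\<lambda>x. jweight (-1) x * norm (f x))"
    and "(LINT x|lborel. norm (jweight (-1) x * norm (f x))) \<le> weight_const * norm (abs_l2 f)"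
proof -
  have n: "square_integrable (\<lambda>x. norm (f x))" by (rule sqi_norm[OF f])
  show "integrable lborel (\<lambda>x. jweight (-1) x * norm (f x))"
    by (rule sqi_mult_integrable[OF sqi_jweight n])
  have "(LINT x|lborel. norm (jweight (-1) x * norm (f x))) = (LINT x|lborel. jweight (-1) x * norm (f x))"
    by simp
  also have "\<dots> \<le> sqrt (LINT x|lborel. (jweight (-1) x)\<^sup>2) * sqrt (LINT x|lborel. (norm (f x))\<^sup>2)"
    by (rule sqi_cauchy_schwarz[OF sqi_jweight n])
  finally show "(LINT x|lborel. norm (jweight (-1) x * norm (f x))) \<le> weight_const * norm (abs_l2 f)"
    by (simp add: weight_const_def abs_l2_norm f)
qed

text \<open>The operator is dominated by two convolutions. In each of them one factor, multiplied by
  \<open>jweight (-1)\<close>, is integrable and the other is square integrable, so Young's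
  inequality applies; the two contributions explain the factor 2.\<close>

lemma kernel_fun_bound:
  assumes k: "admissible c k" and f: "square_integrable f" and g: "square_integrable g"
  shows "square_integrable (kernel_fun k f g)"
    and "norm (abs_l2 (kernel_fun k f g)) \<le> 2 * c * weight_const * norm (abs_l2 f) * norm (abs_l2 g)"
proof -
  note [measurable] = admissible_measurable[OF k]
  have [measurable]: "f \<in> borel_measurable borel" "g \<in> borel_measurable borel" using f g by auto
  have c: "c \<ge> 0" using k by (simp add: admissible_def)
  let ?f = "\<lambda>x. norm (f x)" and ?g = "\<lambda>x. norm (g x)"
  let ?wf = "\<lambda>x. jweight (-1) x * ?f x" and ?wg = "\<lambda>x. jweight (-1) x * ?g x"
  have sf: "square_integrable ?f" and sg: "square_integrable ?g" using f g by (auto intro: sqi_norm)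
  have swf: "square_integrable ?wf"
    by (rule sqi_bound[OF f, where c = 1]) (auto simp: abs_mult intro!: AE_I2 mult_left_le_one_le jweight_neg_le_1)
  have swg: "square_integrable ?wg"
    by (rule sqi_bound[OF g, where c = 1]) (auto simp: abs_mult intro!: AE_I2 mult_left_le_one_le jweight_neg_le_1)
  let ?A = "conv ?wf ?g" and ?B = "conv ?wg ?f"
  have sA: "square_integrable ?A" and sB: "square_integrable ?B"
    using young_sqi(1)[OF weighted_l1(1)[OF f] sg] young_sqi(1)[OF weighted_l1(1)[OF g] sf] by auto
  have pos: "?A \<xi> \<ge> 0" "?B \<xi> \<ge> 0" for \<xi>
    by (auto simp: conv_def intro!: integral_nonneg_AE)
  have pt: "norm (kernel_fun k f g \<xi>) \<le> c * (?A \<xi> + ?B \<xi>)" for \<xi>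
  proof -
    have "norm (kernel_fun k f g \<xi>) \<le> (LINT \<eta>|lborel. norm (complex_of_real (k \<xi> \<eta>) * (f (\<xi> - \<eta>) * g \<eta>)))"
      unfolding kernel_fun_def by (rule integral_norm_bound)
    also have "\<dots> \<le> (LINT \<eta>|lborel. c * (?wf (\<xi> - \<eta>) * ?g \<eta> + ?f (\<xi> - \<eta>) * ?wg \<eta>))"
    proof (rule integral_mono')
      show "integrable lborel (\<lambda>\<eta>. c * (?wf (\<xi> - \<eta>) * ?g \<eta> + ?f (\<xi> - \<eta>) * ?wg \<eta>))"
        using conv_integrable[OF swf sg, of \<xi>] conv_integrable[OF sf swg, of \<xi>] by simp
      fix \<eta>
      have "norm (complex_of_real (k \<xi> \<eta>) * (f (\<xi> - \<eta>) * g \<eta>)) = \<bar>k \<xi> \<eta>\<bar> * (?f (\<xi> - \<eta>) * ?g \<eta>)"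
        by (simp add: norm_mult)
      also have "\<dots> \<le> c * (jweight (-1) (\<xi> - \<eta>) + jweight (-1) \<eta>) * (?f (\<xi> - \<eta>) * ?g \<eta>)"
        using k by (intro mult_right_mono) (auto simp: admissible_def)
      also have "\<dots> = c * (?wf (\<xi> - \<eta>) * ?g \<eta> + ?f (\<xi> - \<eta>) * ?wg \<eta>)"
        by (simp add: algebra_simps)
      finally show "norm (complex_of_real (k \<xi> \<eta>) * (f (\<xi> - \<eta>) * g \<eta>)) \<le> c * (?wf (\<xi> - \<eta>) * ?g \<eta> + ?f (\<xi> - \<eta>) * ?wg \<eta>)" .
      show "0 \<le> c * (?wf (\<xi> - \<eta>) * ?g \<eta> + ?f (\<xi> - \<eta>) * ?wg \<eta>)"
        using c by simp
    qed
    also have "\<dots> = c * (?A \<xi> + conv ?f ?wg \<xi>)"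
      unfolding conv_def using conv_integrable[OF swf sg, of \<xi>] conv_integrable[OF sf swg, of \<xi>] by simp
    finally show ?thesis by (simp add: conv_commute[of ?f])
  qed
  have sAB: "square_integrable (\<lambda>\<xi>. ?A \<xi> + ?B \<xi>)" by (rule sqi_add[OF sA sB])
  show s: "square_integrable (kernel_fun k f g)"
    by (rule sqi_bound[OF sAB, where c = c]) (use pt pos in \<open>auto intro!: AE_I2\<close>)
  have "norm (abs_l2 (kernel_fun k f g)) \<le> c * norm (abs_l2 (emb (\<lambda>\<xi>. ?A \<xi> + ?B \<xi>)))"
  proof (rule abs_l2_norm_le[OF sqi_of_real[OF sAB] _ _ c])
    show "AE x in lborel. norm (kernel_fun k f g x) \<le> c * norm (complex_of_real (?A x + ?B x))"
      unfolding norm_of_real using pt pos by (auto intro!: AE_I2)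
  qed measurable
  also have "abs_l2 (emb (\<lambda>\<xi>. ?A \<xi> + ?B \<xi>)) = abs_l2 (emb ?A) + abs_l2 (emb ?B)"
    by (simp add: abs_l2_add sqi_of_real sA sB)
  also have "c * norm (abs_l2 (emb ?A) + abs_l2 (emb ?B)) \<le> c * (norm (abs_l2 (emb ?A)) + norm (abs_l2 (emb ?B)))"
    by (intro mult_left_mono norm_triangle_ineq c)
  also have "\<dots> \<le> c * (weight_const * norm (abs_l2 f) * norm (abs_l2 g) + weight_const * norm (abs_l2 g) * norm (abs_l2 f))"
  proof (intro mult_left_mono add_mono c)
    have e: "norm (abs_l2 (emb (\<lambda>x. norm (h x)))) = norm (abs_l2 h)" if "square_integrable h" for h :: "real \<Rightarrow> complex"
      unfolding abs_l2_norm[OF sqi_of_real[OF sqi_norm[OF that]]] abs_l2_norm[OF that] by simp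
    show "norm (abs_l2 (emb ?A)) \<le> weight_const * norm (abs_l2 f) * norm (abs_l2 g)"
      using young_real[OF weighted_l1(1)[OF f] sg] mult_right_mono[OF weighted_l1(2)[OF f], of "norm (abs_l2 g)"]
      by (simp add: e g)
    show "norm (abs_l2 (emb ?B)) \<le> weight_const * norm (abs_l2 g) * norm (abs_l2 f)"
      using young_real[OF weighted_l1(1)[OF g] sf] mult_right_mono[OF weighted_l1(2)[OF g], of "norm (abs_l2 f)"]
      by (simp add: e f)
  qed
  finally show "norm (abs_l2 (kernel_fun k f g)) \<le> 2 * c * weight_const * norm (abs_l2 f) * norm (abs_l2 g)"
    by (simp add: algebra_simps)
qed

lemma kernel_fun_cong_AE:
  assumes k: "admissible c k"
    and [measurable]: "f \<in> borel_measurable borel" "g \<in> borel_measurable borel"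
    "f' \<in> borel_measurable borel" "g' \<in> borel_measurable borel"
    and f: "AE x in lborel. f x = f' x" and g: "AE x in lborel. g x = g' x"
  shows "kernel_fun k f g = kernel_fun k f' g'"
proof
  note [measurable] = admissible_measurable[OF k]
  fix \<xi>
  show "kernel_fun k f g \<xi> = kernel_fun k f' g' \<xi>"
    unfolding kernel_fun_def
  proof (rule integral_cong_AE)
    show "AE x in lborel. complex_of_real (k \<xi> x) * (f (\<xi> - x) * g x) = complex_of_real (k \<xi> x) * (f' (\<xi> - x) * g' x)"
      using AE_reflect[OF f, of \<xi>] g by (auto elim!: eventually_rev_mp)
  qed measurable
qed

lemma kernel_op_abs:
  assumes k: "admissible c k" and f: "square_integrable f" and g: "square_integrable g"
  shows "kernel_op k (abs_l2 f) (abs_l2 g) = abs_l2 (kernel_fun k f g)"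
proof -
  have "kernel_fun k (rep_l2 (abs_l2 f)) (rep_l2 (abs_l2 g)) = kernel_fun k f g"
    using sqi_measurable_borel[OF rep_l2_sqi] f g
    by (intro kernel_fun_cong_AE[OF k] rep_abs_l2) auto
  then show ?thesis by (simp add: kernel_op_def)
qed

lemma kernel_op_bound:
  assumes k: "admissible c k"
  shows "norm (kernel_op k F G) \<le> 2 * c * weight_const * norm F * norm G"
  using kernel_fun_bound(2)[OF k rep_l2_sqi rep_l2_sqi, of F G] by (simp add: kernel_op_def)

text \<open>This is what provides the product rule when both arguments depend on time.\<close>

lemma kernel_op_bilinear:
  assumes k: "admissible c k"
  shows "bounded_bilinear (kernel_op k)"
proof
  note s = rep_l2_sqi and ks = kernel_fun_bound(1)[OF k]
  fix F F' G G' :: l2 and r :: real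
  have addF: "kernel_fun k (\<lambda>x. f x + f' x) g = (\<lambda>\<xi>. kernel_fun k f g \<xi> + kernel_fun k f' g \<xi>)"
    if "square_integrable f" "square_integrable f'" "square_integrable g" for f f' g
    unfolding kernel_fun_def distrib_left distrib_right
    by (intro ext Bochner_Integration.integral_add kernel_fun_integrable[OF k] that)
  have addG: "kernel_fun k f (\<lambda>x. g x + g' x) = (\<lambda>\<xi>. kernel_fun k f g \<xi> + kernel_fun k f g' \<xi>)"
    if "square_integrable f" "square_integrable g'" "square_integrable g" for f g g'
    unfolding kernel_fun_def distrib_left distrib_right
    by (intro ext Bochner_Integration.integral_add kernel_fun_integrable[OF k] that)
  have "kernel_op k (abs_l2 f + abs_l2 f') (abs_l2 g) = kernel_op k (abs_l2 f) (abs_l2 g) + kernel_op k (abs_l2 f') (abs_l2 g)"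
    if "square_integrable f" "square_integrable f'" "square_integrable g" for f f' g
    by (simp only: abs_l2_add that sqi_add kernel_op_abs[OF k] ks addF)
  from this[of "rep_l2 F" "rep_l2 F'" "rep_l2 G"]
  show "kernel_op k (F + F') G = kernel_op k F G + kernel_op k F' G" by simp
  have "kernel_op k (abs_l2 f) (abs_l2 g + abs_l2 g') = kernel_op k (abs_l2 f) (abs_l2 g) + kernel_op k (abs_l2 f) (abs_l2 g')"
    if "square_integrable f" "square_integrable g'" "square_integrable g" for f g g'
    by (simp only: abs_l2_add that sqi_add kernel_op_abs[OF k] ks addG)
  from this[of "rep_l2 F" "rep_l2 G'" "rep_l2 G"]
  show "kernel_op k F (G + G') = kernel_op k F G + kernel_op k F G'" by simp
  have sc: "kernel_fun k (\<lambda>x. r *\<^sub>R f x) g = (\<lambda>\<xi>. r *\<^sub>R kernel_fun k f g \<xi>)" "kernel_fun k f (\<lambda>x. r *\<^sub>R g x) = (\<lambda>\<xi>. r *\<^sub>R kernel_fun k f g \<xi>)" for f g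
    unfolding kernel_fun_def by (simp_all add: fun_eq_iff)
  have "kernel_op k (r *\<^sub>R abs_l2 f) (abs_l2 g) = r *\<^sub>R kernel_op k (abs_l2 f) (abs_l2 g)"
    "kernel_op k (abs_l2 f) (r *\<^sub>R abs_l2 g) = r *\<^sub>R kernel_op k (abs_l2 f) (abs_l2 g)"
    if "square_integrable f" "square_integrable g" for f g
    by (simp_all only: abs_l2_scaleR that sqi_scaleR kernel_op_abs[OF k] ks sc)
  from this[of "rep_l2 F" "rep_l2 G"]
  show "kernel_op k (r *\<^sub>R F) G = r *\<^sub>R kernel_op k F G" "kernel_op k F (r *\<^sub>R G) = r *\<^sub>R kernel_op k F G" by simp_all
  show "\<exists>K. \<forall>F G. norm (kernel_op k F G) \<le> norm F * norm G * K"
    using kernel_op_bound[OF k] by (auto simp: mult_ac intro!: exI[of _ "2 * c * weight_const"])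
qed

section \<open>The kernels of products, multiplication operators and the commutator\<close>

lemma jweight_subadd:
  assumes "p \<ge> 0"
  shows "jweight p \<xi> \<le> 2 powr p * (jweight p (\<xi> - \<eta>) + jweight p \<eta>)"
proof -
  have "jweight 1 \<xi> \<le> jweight 1 (\<xi> - \<eta>) + jweight 1 \<eta>"
    using jweight_triangle[of "\<xi> - \<eta>" \<eta>] abs_le_jweight[of "\<xi> - \<eta>"] by simp
  also have "\<dots> \<le> 2 * max (jweight 1 (\<xi> - \<eta>)) (jweight 1 \<eta>)" by simp
  finally have "jweight 1 \<xi> powr p \<le> (2 * max (jweight 1 (\<xi> - \<eta>)) (jweight 1 \<eta>)) powr p"
    using assms by (intro powr_mono2) auto
  also have "\<dots> = 2 powr p * max (jweight 1 (\<xi> - \<eta>)) (jweight 1 \<eta>) powr p"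
    by (intro powr_mult)
  also have "max (jweight 1 (\<xi> - \<eta>)) (jweight 1 \<eta>) powr p \<le> jweight 1 (\<xi> - \<eta>) powr p + jweight 1 \<eta> powr p"
    by (auto simp: max_def)
  finally show ?thesis by (simp flip: jweight_powr)
qed

lemma jweight_cancel [simp]: "jweight p x * jweight (- p) x = 1" "jweight (- p) x * jweight p x = 1"
  using jweight_add[of p "-p" x] jweight_add[of "-p" p x] by simp_all

text \<open>The kernel of the product of \<open>H\<^sup>p\<close> functions in the coordinates \<open>\<langle>\<xi>\<rangle>\<^sup>p\<close> times the transform.\<close>

definition mult_kernel :: "real \<Rightarrow> real \<Rightarrow> real \<Rightarrow> real"
  where "mult_kernel p \<xi> \<eta> = jweight p \<xi> * jweight (- p) (\<xi> - \<eta>) * jweight (- p) \<eta> / (2 * pi)"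

text \<open>By subadditivity the outer weight splits over the two frequencies, and in each part it
  cancels the negative weight of one factor. What remains is a weight of order \<open>- p\<close>,
  which is at most the one of order -1.\<close>

lemma mult_kernel_admissible:
  assumes p: "p \<ge> 1"
  shows "admissible (2 powr p / (2 * pi)) (mult_kernel p)"
  unfolding admissible_def
proof (intro conjI allI)
  show "case_prod (mult_kernel p) \<in> borel_measurable (borel \<Otimes>\<^sub>M borel)"
    unfolding mult_kernel_def[abs_def] by measurable
  fix \<xi> \<eta>
  let ?x = "jweight (- p) (\<xi> - \<eta>)" and ?y = "jweight (- p) \<eta>"
  have "jweight p \<xi> * ?x * ?y \<le> (2 powr p * (jweight p (\<xi> - \<eta>) + jweight p \<eta>)) * ?x * ?y"
    using p by (intro mult_right_mono jweight_subadd) auto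
  also have "\<dots> = 2 powr p * ((jweight p (\<xi> - \<eta>) * ?x) * ?y + ?x * (jweight p \<eta> * ?y))"
    by (simp only: algebra_simps)
  also have "\<dots> = 2 powr p * (?x + ?y)" by simp
  also have "\<dots> \<le> 2 powr p * (jweight (-1) (\<xi> - \<eta>) + jweight (-1) \<eta>)"
    using p by (intro mult_left_mono add_mono jweight_mono) auto
  finally have "jweight p \<xi> * ?x * ?y / (2 * pi) \<le> 2 powr p * (jweight (-1) (\<xi> - \<eta>) + jweight (-1) \<eta>) / (2 * pi)"
    by (rule divide_right_mono) simp
  then show "\<bar>mult_kernel p \<xi> \<eta>\<bar> \<le> 2 powr p / (2 * pi) * (jweight (-1) (\<xi> - \<eta>) + jweight (-1) \<eta>)"
    by (simp add: mult_kernel_def abs_mult)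
qed simp

text \<open>The kernel of multiplication by a function acting on plain L^2. The multiplier is given
  by its H^1 coordinates, whose weight is undone here; the second argument carries no
  weight.\<close>

definition op_kernel :: "real \<Rightarrow> real \<Rightarrow> real"
  where "op_kernel \<xi> \<eta> = jweight (-1) (\<xi> - \<eta>) / (2 * pi)"

lemma op_kernel_admissible: "admissible (1 / (2 * pi)) op_kernel"
  unfolding admissible_def
proof (intro conjI allI)
  show "case_prod op_kernel \<in> borel_measurable (borel \<Otimes>\<^sub>M borel)"
    unfolding op_kernel_def[abs_def] by measurable
  show "\<bar>op_kernel \<xi> \<eta>\<bar> \<le> 1 / (2 * pi) * (jweight (-1) (\<xi> - \<eta>) + jweight (-1) \<eta>)" for \<xi> \<eta>
    by (simp add: op_kernel_def divide_right_mono)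
qed simp

lemma powr_commutator_bound:
  fixes x y z r :: real
  assumes r: "r \<ge> 1" and pos: "x > 0" "y > 0" "z > 0" and tri: "\<bar>x - y\<bar> \<le> z"
  shows "x * \<bar>y powr r - x powr r\<bar> \<le> (2 powr (r + 1) * (r + 1)) * (z powr (r + 1) + z * y powr r)"
proof (cases "y \<le> z")
  case True
  have x: "x \<le> 2 * z" using tri True by linarith
  have xr: "x powr r \<le> (2 * z) powr r" using x pos r by (intro powr_mono2) auto
  have yr: "y powr r \<le> (2 * z) powr r" using True pos r by (intro powr_mono2) auto
  have d: "\<bar>y powr r - x powr r\<bar> \<le> (2 * z) powr r"
    using xr yr powr_ge_zero[of x r] powr_ge_zero[of y r] by linarith
  have "x * \<bar>y powr r - x powr r\<bar> \<le> (2 * z) * (2 * z) powr r"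
    by (intro mult_mono x d) (use pos in auto)
  also have "\<dots> = (2 * z) powr (r + 1)"
    using pos by (simp add: powr_add powr_one)
  also have "\<dots> = 2 powr (r + 1) * z powr (r + 1)"
    by (rule powr_mult)
  also have "\<dots> = 2 powr (r + 1) * 1 * (z powr (r + 1) + 0)" by simp
  also have "\<dots> \<le> 2 powr (r + 1) * (r + 1) * (z powr (r + 1) + z * y powr r)"
    using r pos by (intro mult_mono add_mono) auto
  finally show ?thesis .
next
  case False
  have x: "x \<le> 2 * y" using tri False by linarith
  have bd: "\<bar>y powr r - x powr r\<bar> \<le> r * (2 * y) powr (r - 1) * z"
  proof -
    have deriv: "((\<lambda>t. t powr r) has_real_derivative r * t powr (r - 1)) (at t)" if "t > 0" for t :: real
      using has_real_derivative_powr[OF that, of r] .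
    have main: "\<bar>b powr r - a powr r\<bar> \<le> r * (2 * y) powr (r - 1) * z" if ab: "a < b" "0 < a" "b \<le> 2 * y" "b - a \<le> z" for a b
    proof -
      obtain t where t: "a < t" "t < b" "b powr r - a powr r = (b - a) * (r * t powr (r - 1))"
        using MVT2[of a b "\<lambda>t. t powr r" "\<lambda>t. r * t powr (r - 1)"] ab deriv by auto
      have "(b - a) * (r * t powr (r - 1)) \<le> z * (r * (2 * y) powr (r - 1))"
        using ab t r by (intro mult_mono powr_mono2) auto
      moreover have "0 \<le> (b - a) * (r * t powr (r - 1))" using ab t r by simp
      ultimately show ?thesis unfolding t(3) by (simp add: mult_ac)
    qed
    have rhs: "0 \<le> r * (2 * y) powr (r - 1) * z" using r pos by simp
    show ?thesis
    proof (cases x y rule: linorder_cases)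
      case less
      then show ?thesis using main[of x y] pos tri by simp
    next
      case equal
      then show ?thesis using rhs by simp
    next
      case greater
      then show ?thesis using main[of y x] pos tri x by (simp add: abs_minus_commute)
    qed
  qed
  have "x * \<bar>y powr r - x powr r\<bar> \<le> (2 * y) * (r * (2 * y) powr (r - 1) * z)"
    by (intro mult_mono x bd) (use pos in auto)
  also have "\<dots> = r * z * ((2 * y) powr 1 * (2 * y) powr (r - 1))"
    using pos by (simp add: powr_one)
  also have "\<dots> = r * z * (2 * y) powr r"
    by (subst powr_add[symmetric]) simp
  also have "\<dots> = 2 powr r * r * (z * y powr r)"
    by (simp add: powr_mult)
  also have "\<dots> \<le> 2 powr (r + 1) * (r + 1) * (z powr (r + 1) + z * y powr r)"
    using r pos by (intro mult_mono) (auto intro!: powr_mono)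
  finally show ?thesis .
qed

text \<open>The kernel of \<open>\<langle>D\<rangle> [w, \<langle>D\<rangle>\<^sup>r]\<close>, with \<open>w\<close> measured in \<open>H\<^sup>r\<^sup>+\<^sup>1\<close> and its argument in \<open>H\<^sup>r\<close>.\<close>

definition comm_kernel :: "real \<Rightarrow> real \<Rightarrow> real \<Rightarrow> real"
  where "comm_kernel r \<xi> \<eta> = jweight 1 \<xi> * (jweight r \<eta> - jweight r \<xi>) * jweight (- (r + 1)) (\<xi> - \<eta>) * jweight (- r) \<eta> / (2 * pi)"

text \<open>The first term of \<open>powr_commutator_bound\<close> cancels the weight of
  \<open>w\<close> and leaves order \<open>- r\<close> at \<open>\<eta>\<close>. The second cancels
  the weight at \<open>\<eta>\<close> and leaves order \<open>1 - (r + 1) = - r\<close> at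
  \<open>\<xi> - \<eta>\<close>. Both are at most of order -1 because
  \<open>r \<ge> 1\<close>.\<close>

lemma comm_kernel_admissible:
  assumes r: "r \<ge> 1"
  shows "admissible (2 powr (r + 1) * (r + 1) / (2 * pi)) (comm_kernel r)"
  unfolding admissible_def
proof (intro conjI allI)
  show "case_prod (comm_kernel r) \<in> borel_measurable (borel \<Otimes>\<^sub>M borel)"
    unfolding comm_kernel_def[abs_def] by measurable
  show "0 \<le> 2 powr (r + 1) * (r + 1) / (2 * pi)" using r by simp
  fix \<xi> \<eta> :: real
  let ?c = "2 powr (r + 1) * (r + 1)"
  let ?z = "\<xi> - \<eta>"
  let ?a = "jweight (- (r + 1)) ?z" and ?b = "jweight (- r) \<eta>"
  have tri: "\<bar>jweight 1 \<xi> - jweight 1 \<eta>\<bar> \<le> jweight 1 ?z"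
    using jweight_triangle[of ?z \<eta>] jweight_triangle[of "\<eta> - \<xi>" \<xi>] abs_le_jweight[of ?z] by (simp add: abs_minus_commute)
  have "jweight 1 \<xi> * \<bar>jweight r \<eta> - jweight r \<xi>\<bar> \<le> ?c * (jweight (r + 1) ?z + jweight 1 ?z * jweight r \<eta>)"
    using powr_commutator_bound[OF r jweight_pos jweight_pos jweight_pos tri] by (simp only: jweight_powr[symmetric])
  then have "jweight 1 \<xi> * \<bar>jweight r \<eta> - jweight r \<xi>\<bar> * ?a * ?b \<le> ?c * (jweight (r + 1) ?z + jweight 1 ?z * jweight r \<eta>) * ?a * ?b"
    by (intro mult_right_mono) auto
  also have "\<dots> = ?c * ((jweight (r + 1) ?z * ?a) * ?b + (jweight 1 ?z * ?a) * (jweight r \<eta> * ?b))"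
    by (simp only: algebra_simps)
  also have "\<dots> = ?c * (?b + jweight 1 ?z * ?a)" unfolding jweight_cancel by simp
  also have "jweight 1 ?z * ?a = jweight (- r) ?z" by (simp flip: jweight_add)
  also have "?c * (?b + jweight (- r) ?z) \<le> ?c * (jweight (-1) ?z + jweight (-1) \<eta>)"
    using r jweight_mono[of "-r" "-1" \<eta>] jweight_mono[of "-r" "-1" ?z] by (intro mult_left_mono) auto
  finally have "jweight 1 \<xi> * \<bar>jweight r \<eta> - jweight r \<xi>\<bar> * ?a * ?b / (2 * pi) \<le> ?c * (jweight (-1) ?z + jweight (-1) \<eta>) / (2 * pi)"
    by (rule divide_right_mono) simp
  then show "\<bar>comm_kernel r \<xi> \<eta>\<bar> \<le> ?c / (2 * pi) * (jweight (-1) ?z + jweight (-1) \<eta>)"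
    by (simp add: comm_kernel_def abs_mult)
qed

subsection \<open>Sobolev spaces\<close>

abbreviation weighted :: "real \<Rightarrow> (real \<Rightarrow> real) \<Rightarrow> real \<Rightarrow> complex"
  where "weighted p f \<equiv> (\<lambda>\<xi>. complex_of_real (jweight p \<xi>) * fourier f \<xi>)"

text \<open>Coordinates of H^p in L^2: on \<open>Hs p\<close> this is linear and turns
  \<open>Hs_norm p\<close> into the norm of \<open>l2\<close>, so that paths of functions can be
  differentiated as paths in a Hilbert space.\<close>

definition sob :: "real \<Rightarrow> (real \<Rightarrow> real) \<Rightarrow> l2"
  where "sob p f = abs_l2 (weighted p f)"

lemma Hs_sqi: "f \<in> Hs p \<Longrightarrow> square_integrable f"
  by (simp add: Hs_def)

lemma weighted_norm: "(norm (weighted p f \<xi>))\<^sup>2 = (1 + \<xi>\<^sup>2) powr p * (norm (fourier f \<xi>))\<^sup>2"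
  by (simp add: norm_mult power_mult_distrib jweight_power2)

lemma Hs_iff: "f \<in> Hs p \<longleftrightarrow> square_integrable f \<and> square_integrable (weighted p f)"
proof (cases "square_integrable f")
  case True
  then have [measurable]: "fourier f \<in> borel_measurable borel" by measurable
  have "weighted p f \<in> borel_measurable lborel" by measurable
  then show ?thesis
    using True unfolding Hs_def square_integrable_def[of "weighted p f"] weighted_norm by simp
qed (simp add: Hs_def)

lemma Hs_weighted: "f \<in> Hs p \<Longrightarrow> square_integrable (weighted p f)"
  by (simp add: Hs_iff)

lemma Hs_norm_sob: "f \<in> Hs p \<Longrightarrow> Hs_norm p f = norm (sob p f)"
  by (simp add: sob_def abs_l2_norm Hs_weighted Hs_norm_def flip: weighted_norm)

lemma Hs_mono:
  assumes "f \<in> Hs q" "p \<le> q"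
  shows "f \<in> Hs p" "norm (sob p f) \<le> norm (sob q f)"
proof -
  have s: "square_integrable f" and w: "square_integrable (weighted q f)" using assms by (auto simp: Hs_iff)
  then have [measurable]: "fourier f \<in> borel_measurable borel" by measurable
  have le: "AE x in lborel. norm (weighted p f x) \<le> norm (weighted q f x)"
    using assms(2) by (auto simp: norm_mult intro!: AE_I2 mult_right_mono jweight_mono)
  show "f \<in> Hs p"
    unfolding Hs_iff using s by (auto intro!: sqi_bound[OF w, where c = 1] simp: le)
  show "norm (sob p f) \<le> norm (sob q f)"
    unfolding sob_def by (rule abs_l2_norm_mono[OF w _ le]) measurable
qed

lemma weighted_eq_Hs:
  assumes f: "square_integrable f" and g: "square_integrable g" and eq: "AE \<xi> in lborel. weighted p f \<xi> = g \<xi>"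
  shows "f \<in> Hs p" "sob p f = abs_l2 g"
proof -
  have [measurable]: "fourier f \<in> borel_measurable borel" using f by measurable
  have w: "square_integrable (weighted p f)"
    by (rule sqi_cong_AE[OF g]) (use eq in \<open>auto elim!: eventually_mono\<close>)
  then show "f \<in> Hs p" using f by (simp add: Hs_iff)
  show "sob p f = abs_l2 g"
    unfolding sob_def by (rule abs_l2_eqI[OF w g eq])
qed

lemma Hs_cong_AE:
  assumes f: "f \<in> Hs p" and g: "g \<in> borel_measurable borel" and eq: "AE x in lborel. f x = g x"
  shows "g \<in> Hs p" "sob p g = sob p f"
proof -
  have "fourier f = fourier g"
    using Hs_sqi[OF f] g eq by (intro fourier_cong_AE) auto
  moreover have "square_integrable g" by (rule sqi_cong_AE[OF Hs_sqi[OF f] g eq])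
  ultimately show "g \<in> Hs p" "sob p g = sob p f"
    using f by (auto simp: Hs_iff sob_def)
qed

lemma Hs_add:
  assumes f: "f \<in> Hs p" and g: "g \<in> Hs p"
  shows "(\<lambda>x. f x + g x) \<in> Hs p" "sob p (\<lambda>x. f x + g x) = sob p f + sob p g"
proof -
  have s: "square_integrable (\<lambda>x. f x + g x)" by (intro sqi_add Hs_sqi[OF f] Hs_sqi[OF g])
  have w: "square_integrable (\<lambda>\<xi>. weighted p f \<xi> + weighted p g \<xi>)" by (intro sqi_add Hs_weighted f g)
  have "AE \<xi> in lborel. weighted p (\<lambda>x. f x + g x) \<xi> = weighted p f \<xi> + weighted p g \<xi>"
    using fourier_add[OF Hs_sqi[OF f] Hs_sqi[OF g]] by eventually_elim (simp add: distrib_left)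
  note * = weighted_eq_Hs[OF s w this]
  show "(\<lambda>x. f x + g x) \<in> Hs p" by (rule *)
  show "sob p (\<lambda>x. f x + g x) = sob p f + sob p g"
    unfolding *(2) by (simp add: sob_def abs_l2_add Hs_weighted f g)
qed

lemma Hs_scale:
  assumes f: "f \<in> Hs p"
  shows "(\<lambda>x. a * f x) \<in> Hs p" "sob p (\<lambda>x. a * f x) = a *\<^sub>R sob p f"
proof -
  have s: "square_integrable (\<lambda>x. a * f x)" by (intro sqi_mult_const Hs_sqi[OF f])
  have w: "square_integrable (\<lambda>\<xi>. a *\<^sub>R weighted p f \<xi>)" by (intro sqi_scaleR Hs_weighted f)
  have "AE \<xi> in lborel. weighted p (\<lambda>x. a * f x) \<xi> = a *\<^sub>R weighted p f \<xi>"
    using fourier_scale[OF Hs_sqi[OF f], of a] by eventually_elim (simp add: scaleR_conv_of_real)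
  note * = weighted_eq_Hs[OF s w this]
  show "(\<lambda>x. a * f x) \<in> Hs p" by (rule *)
  show "sob p (\<lambda>x. a * f x) = a *\<^sub>R sob p f"
    unfolding *(2) by (simp only: sob_def abs_l2_scaleR Hs_weighted f)
qed

lemma Hs_diff:
  assumes f: "f \<in> Hs p" and g: "g \<in> Hs p"
  shows "(\<lambda>x. f x - g x) \<in> Hs p" "sob p (\<lambda>x. f x - g x) = sob p f - sob p g"
  using Hs_add[OF f Hs_scale(1)[OF g, of "-1"]] Hs_scale(2)[OF g, of "-1"] by auto

lemma Hs_fourier_l1:
  assumes f: "f \<in> Hs 1"
  shows "integrable lborel (fourier f)" "(LINT x|lborel. norm (fourier f x)) \<le> weight_const * norm (sob 1 f)"
  using l1_of_weighted[OF Hs_weighted[OF f]] by (auto simp: sob_def weight_const_def)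

lemma Hs_sup_bound:
  assumes f: "f \<in> Hs 1"
  shows "AE x in lborel. \<bar>f x\<bar> \<le> weight_const * norm (sob 1 f)"
  using fourier_sup_bound[OF Hs_sqi[OF f] Hs_fourier_l1(1)[OF f]]
proof eventually_elim
  case (elim x)
  have "(LINT x|lborel. norm (fourier f x)) / (2 * pi) \<le> (LINT x|lborel. norm (fourier f x)) / 1"
    using pi_gt3 by (intro divide_left_mono) auto
  then show ?case using elim Hs_fourier_l1(2)[OF f] by simp
qed

lemma Hs_mult_fourier:
  assumes f: "f \<in> Hs 1" and g: "square_integrable g"
  shows "square_integrable (\<lambda>x. f x * g x)"
    and "AE \<xi> in lborel. fourier (\<lambda>x. f x * g x) \<xi> = conv (fourier f) (fourier g) \<xi> / (2 * pi)"
  using fourier_product[OF Hs_sqi[OF f] Hs_fourier_l1(1)[OF f] g] by auto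

text \<open>The weights of the coordinates cancel those inside \<open>mult_kernel p\<close>, leaving
  the convolution formula for the product. Expressing the product through a bounded bilinear map
  yields its norm bound and its time derivative at once.\<close>

lemma Hs_mult:
  assumes p: "p \<ge> 1" and f: "f \<in> Hs p" and g: "g \<in> Hs p"
  shows "(\<lambda>x. f x * g x) \<in> Hs p" "sob p (\<lambda>x. f x * g x) = kernel_op (mult_kernel p) (sob p f) (sob p g)"
proof -
  have f1: "f \<in> Hs 1" by (rule Hs_mono[OF f p])
  note m = Hs_mult_fourier[OF f1 Hs_sqi[OF g]]
  let ?h = "kernel_fun (mult_kernel p) (weighted p f) (weighted p g)"
  note k = mult_kernel_admissible[OF p]
  have "weighted p (\<lambda>x. f x * g x) \<xi> = ?h \<xi>" if "fourier (\<lambda>x. f x * g x) \<xi> = conv (fourier f) (fourier g) \<xi> / (2 * pi)" for \<xi>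
  proof -
    have "?h \<xi> = (LINT \<eta>|lborel. complex_of_real (jweight p \<xi> / (2 * pi)) * (fourier f (\<xi> - \<eta>) * fourier g \<eta>))"
      unfolding kernel_fun_def
    proof (rule Bochner_Integration.integral_cong[OF refl])
      fix \<eta>
      have "mult_kernel p \<xi> \<eta> * (jweight p (\<xi> - \<eta>) * jweight p \<eta>) = jweight p \<xi> / (2 * pi) * (jweight p (\<xi> - \<eta>) * jweight (- p) (\<xi> - \<eta>)) * (jweight p \<eta> * jweight (- p) \<eta>)"
        by (simp only: mult_kernel_def times_divide_eq_left times_divide_eq_right mult_ac)
      also have "\<dots> = jweight p \<xi> / (2 * pi)" by simp
      finally have e: "complex_of_real (mult_kernel p \<xi> \<eta>) * (complex_of_real (jweight p (\<xi> - \<eta>)) * complex_of_real (jweight p \<eta>)) = complex_of_real (jweight p \<xi> / (2 * pi))"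
        by (simp only: of_real_mult[symmetric])
      have "complex_of_real (mult_kernel p \<xi> \<eta>) * (weighted p f (\<xi> - \<eta>) * weighted p g \<eta>)
          = (complex_of_real (mult_kernel p \<xi> \<eta>) * (complex_of_real (jweight p (\<xi> - \<eta>)) * complex_of_real (jweight p \<eta>))) * (fourier f (\<xi> - \<eta>) * fourier g \<eta>)"
        by (simp only: mult_ac)
      then show "complex_of_real (mult_kernel p \<xi> \<eta>) * (weighted p f (\<xi> - \<eta>) * weighted p g \<eta>) = complex_of_real (jweight p \<xi> / (2 * pi)) * (fourier f (\<xi> - \<eta>) * fourier g \<eta>)"
        unfolding e .
    qed
    also have "\<dots> = complex_of_real (jweight p \<xi> / (2 * pi)) * conv (fourier f) (fourier g) \<xi>"
      unfolding conv_def by (rule integral_mult_right_zero)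
    finally show ?thesis using that by simp
  qed
  then have "AE \<xi> in lborel. weighted p (\<lambda>x. f x * g x) \<xi> = ?h \<xi>"
    using m(2) by (auto elim!: eventually_mono)
  note * = weighted_eq_Hs[OF m(1) kernel_fun_bound(1)[OF k Hs_weighted[OF f] Hs_weighted[OF g]] this]
  show "(\<lambda>x. f x * g x) \<in> Hs p" by (rule *)
  show "sob p (\<lambda>x. f x * g x) = kernel_op (mult_kernel p) (sob p f) (sob p g)"
    unfolding *(2) by (simp add: sob_def kernel_op_abs[OF k] Hs_weighted f g)
qed

lemma Hs_power: "p \<ge> 1 \<Longrightarrow> f \<in> Hs p \<Longrightarrow> (\<lambda>x. f x ^ Suc n) \<in> Hs p"
proof (induction n)
  case (Suc n)
  then show ?case using Hs_mult(1)[of p f "\<lambda>x. f x ^ Suc n"] by simp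
qed simp

lemma op_fun:
  assumes w: "w \<in> Hs 1" and a: "square_integrable a"
  shows "square_integrable (\<lambda>\<xi>. conv (fourier w) a \<xi> / (2 * pi))"
    and "kernel_op op_kernel (sob 1 w) (abs_l2 a) = abs_l2 (\<lambda>\<xi>. conv (fourier w) a \<xi> / (2 * pi))"
proof -
  have "kernel_fun op_kernel (weighted 1 w) a \<xi> = conv (fourier w) a \<xi> / (2 * pi)" for \<xi>
  proof -
    have "kernel_fun op_kernel (weighted 1 w) a \<xi> = (LINT \<eta>|lborel. (fourier w (\<xi> - \<eta>) * a \<eta>) / (2 * pi))"
      unfolding kernel_fun_def
    proof (rule Bochner_Integration.integral_cong[OF refl])
      fix \<eta>
      have "complex_of_real (jweight (-1) (\<xi> - \<eta>)) * complex_of_real (jweight 1 (\<xi> - \<eta>)) = 1"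
        by (simp flip: of_real_mult)
      then show "complex_of_real (op_kernel \<xi> \<eta>) * (weighted 1 w (\<xi> - \<eta>) * a \<eta>) = (fourier w (\<xi> - \<eta>) * a \<eta>) / (2 * pi)"
        by (simp add: op_kernel_def mult.assoc[symmetric])
    qed
    then show ?thesis by (simp add: conv_def)
  qed
  then have eq: "kernel_fun op_kernel (weighted 1 w) a = (\<lambda>\<xi>. conv (fourier w) a \<xi> / (2 * pi))" by auto
  show "square_integrable (\<lambda>\<xi>. conv (fourier w) a \<xi> / (2 * pi))"
    using kernel_fun_bound(1)[OF op_kernel_admissible Hs_weighted[OF w] a] unfolding eq .
  show "kernel_op op_kernel (sob 1 w) (abs_l2 a) = abs_l2 (\<lambda>\<xi>. conv (fourier w) a \<xi> / (2 * pi))"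
    unfolding sob_def kernel_op_abs[OF op_kernel_admissible Hs_weighted[OF w] a] eq ..
qed

text \<open>The transform of the real function \<open>w\<close> has the Hermitian symmetry required
  by \<open>conv_adjoint\<close>.\<close>

lemma op_symmetric:
  assumes w: "w \<in> Hs 1"
  shows "kernel_op op_kernel (sob 1 w) A \<bullet> B = A \<bullet> kernel_op op_kernel (sob 1 w) B"
proof -
  let ?a = "rep_l2 A" and ?b = "rep_l2 B"
  have s: "square_integrable ?a" "square_integrable ?b" by simp_all
  have "(LINT \<xi>|lborel. (conv (fourier w) ?a \<xi> / (2 * pi)) \<bullet> ?b \<xi>) = (LINT \<xi>|lborel. conv (fourier w) ?a \<xi> \<bullet> ?b \<xi>) / (2 * pi)"
    by (simp add: inner_complex_def add_divide_distrib[symmetric])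
  also have "(LINT \<xi>|lborel. conv (fourier w) ?a \<xi> \<bullet> ?b \<xi>) = (LINT \<xi>|lborel. ?a \<xi> \<bullet> conv (fourier w) ?b \<xi>)"
    by (intro conv_adjoint fourier_sqi Hs_sqi[OF w] Hs_fourier_l1(1)[OF w] s fourier_hermitian)
  also have "\<dots> / (2 * pi) = (LINT \<xi>|lborel. ?a \<xi> \<bullet> (conv (fourier w) ?b \<xi> / (2 * pi)))"
    by (simp add: inner_complex_def add_divide_distrib[symmetric])
  finally have "kernel_op op_kernel (sob 1 w) (abs_l2 ?a) \<bullet> abs_l2 ?b = abs_l2 ?a \<bullet> kernel_op op_kernel (sob 1 w) (abs_l2 ?b)"
    unfolding op_fun(2)[OF w s(1)] op_fun(2)[OF w s(2)]
      abs_l2_inner[OF op_fun(1)[OF w s(1)] s(2)] abs_l2_inner[OF s(1) op_fun(1)[OF w s(2)]] .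
  then show ?thesis by simp
qed

text \<open>The difference paired with \<open>a\<close> is the commutator of multiplication by
  \<open>w\<close> and the weight of order \<open>r\<close>. Moving one weight of order 1 from
  \<open>a\<close> to the commutator keeps the latter bounded, by
  \<open>comm_kernel_admissible\<close>, so that \<open>a\<close> enters only through its norm in
  H^(-1).\<close>

lemma comm_inner:
  assumes r: "r \<ge> 1" and w: "w \<in> Hs (r + 1)" and U: "U \<in> Hs r" and a: "square_integrable a"
  shows "abs_l2 a \<bullet> (kernel_op op_kernel (sob 1 w) (sob r U) - sob r (\<lambda>x. w x * U x))
    = abs_l2 (\<lambda>\<xi>. complex_of_real (jweight (-1) \<xi>) * a \<xi>) \<bullet> kernel_op (comm_kernel r) (sob (r + 1) w) (sob r U)"
proof -
  have w1: "w \<in> Hs 1" by (rule Hs_mono[OF w]) (use r in simp)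
  have wr: "w \<in> Hs r" by (rule Hs_mono[OF w]) simp
  note k = comm_kernel_admissible[OF r]
  note sU = Hs_weighted[OF U] and sw = Hs_weighted[OF w]
  let ?c = "kernel_fun (comm_kernel r) (weighted (r + 1) w) (weighted r U)"
  let ?d = "\<lambda>\<xi>. conv (fourier w) (weighted r U) \<xi> / (2 * pi) - weighted r (\<lambda>x. w x * U x) \<xi>"
  have wU: "(\<lambda>x. w x * U x) \<in> Hs r" by (rule Hs_mult(1)[OF r wr U])
  have sd: "square_integrable ?d" by (intro sqi_diff op_fun(1)[OF w1 sU] Hs_weighted wU)
  have c: "?c \<xi> = complex_of_real (jweight 1 \<xi>) * (conv (fourier w) (weighted r U) \<xi> / (2 * pi) - complex_of_real (jweight r \<xi>) * conv (fourier w) (fourier U) \<xi> / (2 * pi))" for \<xi>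
  proof -
    have "?c \<xi> = (LINT \<eta>|lborel. complex_of_real (jweight 1 \<xi> / (2 * pi)) * (fourier w (\<xi> - \<eta>) * weighted r U \<eta> - complex_of_real (jweight r \<xi>) * (fourier w (\<xi> - \<eta>) * fourier U \<eta>)))"
      unfolding kernel_fun_def
    proof (rule Bochner_Integration.integral_cong[OF refl])
      fix \<eta>
      have "comm_kernel r \<xi> \<eta> * (jweight (r + 1) (\<xi> - \<eta>) * jweight r \<eta>)
          = jweight 1 \<xi> / (2 * pi) * (jweight r \<eta> - jweight r \<xi>) * (jweight (r + 1) (\<xi> - \<eta>) * jweight (- (r + 1)) (\<xi> - \<eta>)) * (jweight r \<eta> * jweight (- r) \<eta>)"
        by (simp only: comm_kernel_def times_divide_eq_left times_divide_eq_right mult_ac)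
      also have "\<dots> = jweight 1 \<xi> / (2 * pi) * (jweight r \<eta> - jweight r \<xi>)" unfolding jweight_cancel by simp
      finally have e: "complex_of_real (comm_kernel r \<xi> \<eta>) * (complex_of_real (jweight (r + 1) (\<xi> - \<eta>)) * complex_of_real (jweight r \<eta>))
          = complex_of_real (jweight 1 \<xi> / (2 * pi)) * (complex_of_real (jweight r \<eta>) - complex_of_real (jweight r \<xi>))"
        by (simp only: of_real_mult[symmetric] of_real_diff[symmetric])
      have "complex_of_real (comm_kernel r \<xi> \<eta>) * (weighted (r + 1) w (\<xi> - \<eta>) * weighted r U \<eta>)
          = (complex_of_real (comm_kernel r \<xi> \<eta>) * (complex_of_real (jweight (r + 1) (\<xi> - \<eta>)) * complex_of_real (jweight r \<eta>))) * (fourier w (\<xi> - \<eta>) * fourier U \<eta>)"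
        by (simp only: mult_ac)
      also have "\<dots> = complex_of_real (jweight 1 \<xi> / (2 * pi)) * (fourier w (\<xi> - \<eta>) * weighted r U \<eta> - complex_of_real (jweight r \<xi>) * (fourier w (\<xi> - \<eta>) * fourier U \<eta>))"
        unfolding e by (simp only: left_diff_distrib right_diff_distrib mult_ac)
      finally show "complex_of_real (comm_kernel r \<xi> \<eta>) * (weighted (r + 1) w (\<xi> - \<eta>) * weighted r U \<eta>)
          = complex_of_real (jweight 1 \<xi> / (2 * pi)) * (fourier w (\<xi> - \<eta>) * weighted r U \<eta> - complex_of_real (jweight r \<xi>) * (fourier w (\<xi> - \<eta>) * fourier U \<eta>))" .
    qed
    also have "\<dots> = complex_of_real (jweight 1 \<xi> / (2 * pi)) * ((LINT \<eta>|lborel. fourier w (\<xi> - \<eta>) * weighted r U \<eta>) - complex_of_real (jweight r \<xi>) * (LINT \<eta>|lborel. fourier w (\<xi> - \<eta>) * fourier U \<eta>))"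
      unfolding integral_mult_right_zero
        Bochner_Integration.integral_diff[OF conv_integrable[OF fourier_sqi[OF Hs_sqi[OF w]] sU]
          integrable_mult_right[OF conv_integrable[OF fourier_sqi[OF Hs_sqi[OF w]] fourier_sqi[OF Hs_sqi[OF U]]]]] ..
    finally show ?thesis unfolding conv_def by (simp add: right_diff_distrib diff_divide_distrib)
  qed
  have cd: "AE \<xi> in lborel. ?c \<xi> = complex_of_real (jweight 1 \<xi>) * ?d \<xi>"
    using Hs_mult_fourier(2)[OF w1 Hs_sqi[OF U]] by eventually_elim (simp add: c)
  have sa: "square_integrable (\<lambda>\<xi>. complex_of_real (jweight (-1) \<xi>) * a \<xi>)"
    by (rule sqi_bound[OF a, where c = 1]) (use a in \<open>auto simp: norm_mult jweight_neg_le_1 intro!: AE_I2 mult_left_le_one_le\<close>)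
  have sc: "square_integrable ?c" by (rule kernel_fun_bound(1)[OF k sw sU])
  have "kernel_op op_kernel (sob 1 w) (sob r U) - sob r (\<lambda>x. w x * U x) = abs_l2 ?d"
    unfolding sob_def[of r U] op_fun(2)[OF w1 sU] unfolding sob_def
    by (rule abs_l2_diff[OF op_fun(1)[OF w1 sU] Hs_weighted[OF wU]])
  then have "abs_l2 a \<bullet> (kernel_op op_kernel (sob 1 w) (sob r U) - sob r (\<lambda>x. w x * U x)) = (LINT \<xi>|lborel. a \<xi> \<bullet> ?d \<xi>)"
    by (simp only: abs_l2_inner[OF a sd])
  also have "\<dots> = (LINT \<xi>|lborel. (complex_of_real (jweight (-1) \<xi>) * a \<xi>) \<bullet> ?c \<xi>)"
  proof (rule integral_cong_AE)
    show "AE \<xi> in lborel. a \<xi> \<bullet> ?d \<xi> = (complex_of_real (jweight (-1) \<xi>) * a \<xi>) \<bullet> ?c \<xi>"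
      using cd
    proof eventually_elim
      case (elim \<xi>)
      have "(complex_of_real (jweight (-1) \<xi>) * a \<xi>) \<bullet> (complex_of_real (jweight 1 \<xi>) * ?d \<xi>) = (jweight (-1) \<xi> * jweight 1 \<xi>) * (a \<xi> \<bullet> ?d \<xi>)"
        by (simp only: scaleR_conv_of_real[symmetric] inner_scaleR_left inner_scaleR_right mult.assoc mult.left_commute)
      then show ?case unfolding elim by simp
    qed
  qed (rule borel_measurable_integrable, rule sqi_inner_integrable, fact, fact)+
  also have "\<dots> = abs_l2 (\<lambda>\<xi>. complex_of_real (jweight (-1) \<xi>) * a \<xi>) \<bullet> kernel_op (comm_kernel r) (sob (r + 1) w) (sob r U)"
    unfolding sob_def kernel_op_abs[OF k sw sU] by (rule abs_l2_inner[OF sa sc, symmetric])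
  finally show ?thesis .
qed

text \<open>The derivative is characterised by its transform, together with square integrability.
  Both systems are translated into this form, in which the product and chain rules follow from the
  convolution formula without further test functions.\<close>

definition fourier_deriv :: "(real \<Rightarrow> real) \<Rightarrow> (real \<Rightarrow> real) \<Rightarrow> bool"
  where "fourier_deriv f f' \<longleftrightarrow> square_integrable f' \<and> (AE \<xi> in lborel. fourier f' \<xi> = \<i> * \<xi> * fourier f \<xi>)"

text \<open>Under the convolution integral the frequency splits as
  \<open>\<xi> = (\<xi> - \<eta>) + \<eta>\<close>; the two summands are the symbols of the
  derivatives of the two factors.\<close>

lemma fourier_deriv_mult:
  assumes f: "f \<in> Hs 1" and g: "g \<in> Hs 1" and f': "fourier_deriv f f'" and g': "fourier_deriv g g'"
  shows "fourier_deriv (\<lambda>x. f x * g x) (\<lambda>x. f' x * g x + f x * g' x)"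
proof -
  have sf': "square_integrable f'" and sg': "square_integrable g'"
    and ef: "AE \<xi> in lborel. fourier f' \<xi> = \<i> * \<xi> * fourier f \<xi>" and eg: "AE \<xi> in lborel. fourier g' \<xi> = \<i> * \<xi> * fourier g \<xi>"
    using f' g' by (auto simp: fourier_deriv_def)
  note m = Hs_mult_fourier[OF f Hs_sqi[OF g]] and m1 = Hs_mult_fourier[OF g sf'] and m2 = Hs_mult_fourier[OF f sg']
  have [measurable]: "fourier f \<in> borel_measurable borel" "fourier g \<in> borel_measurable borel"
    "fourier f' \<in> borel_measurable borel" "fourier g' \<in> borel_measurable borel"
    using fourier_measurable Hs_sqi[OF f] Hs_sqi[OF g] sf' sg' by auto
  have s: "square_integrable (\<lambda>x. f' x * g x + f x * g' x)"
    using sqi_add[OF m1(1) m2(1)] by (simp add: mult.commute)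
  have key: "conv (fourier g) (fourier f') \<xi> + conv (fourier f) (fourier g') \<xi> = \<i> * \<xi> * conv (fourier f) (fourier g) \<xi>" for \<xi>
  proof -
    have "conv (fourier g) (fourier f') \<xi> + conv (fourier f) (fourier g') \<xi> = (LINT \<eta>|lborel. fourier f' (\<xi> - \<eta>) * fourier g \<eta> + fourier f (\<xi> - \<eta>) * fourier g' \<eta>)"
      unfolding conv_commute[of "fourier g" "fourier f'"] unfolding conv_def
      by (rule Bochner_Integration.integral_add[OF conv_integrable[OF fourier_sqi[OF sf'] fourier_sqi[OF Hs_sqi[OF g]]]
        conv_integrable[OF fourier_sqi[OF Hs_sqi[OF f]] fourier_sqi[OF sg']], symmetric])
    also have "\<dots> = (LINT \<eta>|lborel. \<i> * \<xi> * (fourier f (\<xi> - \<eta>) * fourier g \<eta>))"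
    proof (rule integral_cong_AE)
      have "AE \<eta> in lborel. fourier f' (\<xi> - \<eta>) = \<i> * complex_of_real (\<xi> - \<eta>) * fourier f (\<xi> - \<eta>)"
        by (rule AE_reflect[OF ef]) measurable
      with eg show "AE \<eta> in lborel. fourier f' (\<xi> - \<eta>) * fourier g \<eta> + fourier f (\<xi> - \<eta>) * fourier g' \<eta> = \<i> * \<xi> * (fourier f (\<xi> - \<eta>) * fourier g \<eta>)"
      proof eventually_elim
        case (elim \<eta>)
        have "(\<i> * complex_of_real (\<xi> - \<eta>) * F) * G + F * (\<i> * \<eta> * G) = \<i> * \<xi> * (F * G)" for F G :: complex
          by (simp add: algebra_simps)
        then show ?case unfolding elim .
      qed
    qed measurable
    also have "\<dots> = \<i> * \<xi> * conv (fourier f) (fourier g) \<xi>"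
      unfolding conv_def by (rule integral_mult_right_zero)
    finally show ?thesis .
  qed
  have "AE \<xi> in lborel. fourier (\<lambda>x. f' x * g x + f x * g' x) \<xi> = \<i> * \<xi> * fourier (\<lambda>x. f x * g x) \<xi>"
    using fourier_add[OF m1(1) m2(1)] m(2) m1(2) m2(2)
  proof eventually_elim
    case (elim \<xi>)
    have "fourier (\<lambda>x. f' x * g x + f x * g' x) \<xi> = (conv (fourier g) (fourier f') \<xi> + conv (fourier f) (fourier g') \<xi>) / (2 * pi)"
      using elim by (simp add: add_divide_distrib mult.commute[of "f' _"])
    then show ?case unfolding key elim by simp
  qed
  with s show ?thesis by (simp add: fourier_deriv_def)
qed

lemma fourier_deriv_add:
  assumes "fourier_deriv f f'" "fourier_deriv g g'" "square_integrable f" "square_integrable g"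
  shows "fourier_deriv (\<lambda>x. f x + g x) (\<lambda>x. f' x + g' x)"
proof -
  have s: "square_integrable f'" "square_integrable g'"
    and e: "AE \<xi> in lborel. fourier f' \<xi> = \<i> * \<xi> * fourier f \<xi>" "AE \<xi> in lborel. fourier g' \<xi> = \<i> * \<xi> * fourier g \<xi>"
    using assms by (auto simp: fourier_deriv_def)
  have "AE \<xi> in lborel. fourier (\<lambda>x. f' x + g' x) \<xi> = \<i> * \<xi> * fourier (\<lambda>x. f x + g x) \<xi>"
    using fourier_add[OF s] fourier_add[OF assms(3,4)] e by eventually_elim (simp add: algebra_simps)
  then show ?thesis using s by (simp add: fourier_deriv_def sqi_add)
qed

lemma fourier_deriv_scale:
  assumes "fourier_deriv f f'" "square_integrable f"
  shows "fourier_deriv (\<lambda>x. a * f x) (\<lambda>x. a * f' x)"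
proof -
  have s: "square_integrable f'" and e: "AE \<xi> in lborel. fourier f' \<xi> = \<i> * \<xi> * fourier f \<xi>"
    using assms by (auto simp: fourier_deriv_def)
  have "AE \<xi> in lborel. fourier (\<lambda>x. a * f' x) \<xi> = \<i> * \<xi> * fourier (\<lambda>x. a * f x) \<xi>"
    using fourier_scale[OF s, of a] fourier_scale[OF assms(2), of a] e by eventually_elim simp
  then show ?thesis using s by (simp add: fourier_deriv_def sqi_mult_const)
qed

lemma fourier_deriv_power:
  assumes f: "f \<in> Hs 1" and f': "fourier_deriv f f'"
  shows "fourier_deriv (\<lambda>x. f x ^ Suc n) (\<lambda>x. real (Suc n) * f x ^ n * f' x)"
proof (induction n)
  case 0
  then show ?case using f' by simp
next
  case (Suc n)
  have "(\<lambda>x. f x ^ Suc n) \<in> Hs 1" by (rule Hs_power[OF _ f]) simp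
  from fourier_deriv_mult[OF f this f' Suc] show ?case
    by (simp add: algebra_simps)
qed

lemma fourier_deriv_cong:
  assumes f: "fourier_deriv f f'" and g: "g' \<in> borel_measurable borel" and eq: "AE x in lborel. f' x = g' x"
  shows "fourier_deriv f g'"
proof -
  have s: "square_integrable f'" using f by (simp add: fourier_deriv_def)
  have "fourier f' = fourier g'" by (rule fourier_cong_AE[OF sqi_measurable_borel[OF s] g eq])
  then show ?thesis
    using f sqi_cong_AE[OF s g eq] by (simp add: fourier_deriv_def)
qed

lemma weak_deriv_fourier_deriv:
  "weak_deriv f g \<Longrightarrow> square_integrable f \<Longrightarrow> square_integrable g \<Longrightarrow> fourier_deriv f g"
  by (simp add: fourier_deriv_def weak_deriv_fourier)

text \<open>The definition only provides integrability on bounded intervals; the restrictions to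
  growing intervals converge pointwise.\<close>

lemma weak_deriv_measurable:
  assumes "weak_deriv f g"
  shows "g \<in> borel_measurable borel"
proof (rule borel_measurable_LIMSEQ_real)
  show "(\<lambda>x. indicator {- real n..real n} x * g x) \<in> borel_measurable borel" for n
  proof -
    have "set_integrable lborel {- real n..real n} g" using assms by (simp add: weak_deriv_def)
    from borel_measurable_integrable[OF this[unfolded set_integrable_def]] show ?thesis by simp
  qed
  fix x
  have "eventually (\<lambda>n. indicator {- real n..real n} x * g x = g x) sequentially"
    using eventually_ge_at_top[of "nat \<lceil>\<bar>x\<bar>\<rceil>"] by eventually_elim (auto simp: indicator_def)
  then show "(\<lambda>n. indicator {- real n..real n} x * g x) \<longlonglongrightarrow> g x" by (rule tendsto_eventually)
qed

section \<open>The symbol of \<open>K\<^sub>\<delta>\<close>\<close>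

lemma one_minus_cos_le: "\<bar>cos y - 1\<bar> \<le> (y::real)\<^sup>2 / 2"
proof -
  have "cos y = 1 - 2 * (sin (y / 2))\<^sup>2" using cos_double_sin[of "y / 2"] by simp
  moreover have "(sin (y / 2))\<^sup>2 \<le> (y / 2)\<^sup>2"
    by (rule abs_le_square_iff[THEN iffD1]) (rule abs_sin_x_le_abs_x)
  ultimately show ?thesis by (simp add: power_divide)
qed

text \<open>The real part replaces the exponential by a cosine, which has no first order term. Hence
  the error is quadratic and the second moment controls it.\<close>

lemma Re_char_bound:
  assumes M: "finite_borel_measure M" and m2: "integrable M (\<lambda>x. x\<^sup>2)"
  shows "\<bar>Re (char M (- \<zeta>)) - measure M UNIV\<bar> \<le> \<zeta>\<^sup>2 * (LINT x|M. x\<^sup>2)"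
proof -
  interpret finite_borel_measure M by fact
  have [measurable_cong]: "sets M = sets borel" by (rule M_is_borel)
  have sp: "space M = UNIV" using sets_eq_imp_space_eq[OF M_is_borel] by simp
  have i: "integrable M (\<lambda>x. iexp (- \<zeta> * x))"
    by (rule integrable_const_bound[where B = 1]) auto
  have ic: "integrable M (\<lambda>x. cos (\<zeta> * x))"
    by (rule integrable_const_bound[where B = 1]) auto
  have "Re (char M (- \<zeta>)) = (LINT x|M. Re (iexp (- \<zeta> * x)))"
    unfolding char_def using i by simp
  also have "\<dots> = (LINT x|M. cos (\<zeta> * x))"
    by (intro Bochner_Integration.integral_cong) (auto simp: Re_exp)
  finally have "Re (char M (- \<zeta>)) - measure M UNIV = (LINT x|M. cos (\<zeta> * x) - 1)"
    using ic by (simp add: sp)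
  also have "\<bar>\<dots>\<bar> \<le> (LINT x|M. \<bar>cos (\<zeta> * x) - 1\<bar>)"
    by (rule integral_abs_bound)
  also have "\<dots> \<le> (LINT x|M. \<zeta>\<^sup>2 * x\<^sup>2)"
  proof (rule integral_mono')
    show "integrable M (\<lambda>x. \<zeta>\<^sup>2 * x\<^sup>2)" using m2 by simp
    show "\<bar>cos (\<zeta> * x) - 1\<bar> \<le> \<zeta>\<^sup>2 * x\<^sup>2" for x
    proof -
      have "\<bar>cos (\<zeta> * x) - 1\<bar> \<le> (\<zeta> * x)\<^sup>2 / 2" by (rule one_minus_cos_le)
      also have "\<dots> \<le> (\<zeta> * x)\<^sup>2" by simp
      finally show ?thesis by (simp add: power_mult_distrib)
    qed
  qed simp
  finally show ?thesis by simp
qed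

text \<open>For \<open>\<bar>\<zeta>\<bar> \<le> 1\<close> the quadratic bound from the second
  moments suffices, as \<open>\<zeta>\<^sup>2 \<le> \<bar>\<zeta>\<bar> powr \<theta>\<close> for
  \<open>\<theta> \<le> 2\<close>. For larger \<open>\<zeta>\<close> the bound \<open>B\<close> of
  the transform suffices. The square root passes through because
  \<open>\<bar>sqrt a - 1\<bar> \<le> \<bar>a - 1\<bar>\<close>. The constant \<open>?C\<close> adds
  up what the cases require.\<close>

lemma kernel_symbol_bounds:
  assumes kernel: "finite_signed_measure bp bm"
    and bdd: "bdd_above (range (\<lambda>\<eta>. \<bar>kernel_hat bp bm \<eta>\<bar>))"
    and nonneg: "\<And>\<xi>. 0 \<le> kernel_hat bp bm \<xi>"
    and mass: "measure bp UNIV - measure bm UNIV = 1"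
    and m2: "integrable bp (\<lambda>x. x\<^sup>2)" "integrable bm (\<lambda>x. x\<^sup>2)"
    and \<theta>: "0 < \<theta>" "\<theta> \<le> 2"
  obtains C where "C > 0" "\<And>\<zeta>. sqrt (kernel_hat bp bm \<zeta>) \<le> C" "\<And>\<zeta>. \<bar>sqrt (kernel_hat bp bm \<zeta>) - 1\<bar> \<le> C * \<bar>\<zeta>\<bar> powr \<theta>"
proof -
  obtain B where B: "\<And>\<eta>. \<bar>kernel_hat bp bm \<eta>\<bar> \<le> B" using bdd by (auto simp: bdd_above_def)
  then have B0: "B \<ge> 0" by (meson abs_ge_zero order_trans)
  define C2 where "C2 = (LINT x|bp. x\<^sup>2) + (LINT x|bm. x\<^sup>2)"
  have C2: "C2 \<ge> 0" unfolding C2_def by (intro add_nonneg_nonneg integral_nonneg_AE) auto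
  have quad: "\<bar>kernel_hat bp bm \<zeta> - 1\<bar> \<le> C2 * \<zeta>\<^sup>2" for \<zeta>
  proof -
    have "finite_borel_measure bp" "finite_borel_measure bm" using kernel by (auto simp: finite_signed_measure_def)
    from Re_char_bound[OF this(1) m2(1), of \<zeta>] Re_char_bound[OF this(2) m2(2), of \<zeta>] mass
    show ?thesis by (simp add: kernel_hat_def C2_def algebra_simps)
  qed
  have sq: "\<bar>sqrt a - 1\<bar> \<le> \<bar>a - 1\<bar>" if "a \<ge> 0" for a :: real
  proof -
    have "a - 1 = (sqrt a - 1) * (sqrt a + 1)" using that by (simp add: algebra_simps)
    then have "\<bar>a - 1\<bar> = \<bar>sqrt a - 1\<bar> * (sqrt a + 1)" using that by (simp add: abs_mult)
    moreover have "\<bar>sqrt a - 1\<bar> * 1 \<le> \<bar>sqrt a - 1\<bar> * (sqrt a + 1)" using that by (intro mult_left_mono) auto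
    ultimately show ?thesis by simp
  qed
  let ?C = "C2 + B + 1"
  show ?thesis
  proof
    show "?C > 0" using C2 B0 by simp
    fix \<zeta>
    have k: "0 \<le> kernel_hat bp bm \<zeta>" "kernel_hat bp bm \<zeta> \<le> B" using nonneg[of \<zeta>] B[of \<zeta>] by auto
    have a: "\<bar>sqrt (kernel_hat bp bm \<zeta>) - 1\<bar> \<le> \<bar>kernel_hat bp bm \<zeta> - 1\<bar>" by (rule sq[OF k(1)])
    also have b: "\<dots> \<le> B + 1" using k B0 by (simp add: abs_if)
    finally have "\<bar>sqrt (kernel_hat bp bm \<zeta>) - 1\<bar> \<le> B + 1" .
    moreover have "sqrt (kernel_hat bp bm \<zeta>) \<le> sqrt (B + 1) " using k by simp
    moreover have "sqrt (B + 1) \<le> B + 1" using B0 by (intro real_le_lsqrt) (auto simp: power2_eq_square algebra_simps)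
    ultimately show "sqrt (kernel_hat bp bm \<zeta>) \<le> ?C" using C2 by linarith
    show "\<bar>sqrt (kernel_hat bp bm \<zeta>) - 1\<bar> \<le> ?C * \<bar>\<zeta>\<bar> powr \<theta>"
    proof (cases "\<bar>\<zeta>\<bar> \<le> 1")
      case True
      have "\<zeta>\<^sup>2 \<le> \<bar>\<zeta>\<bar> powr \<theta>"
      proof (cases "\<zeta> = 0")
        case False
        have "\<zeta>\<^sup>2 = \<bar>\<zeta>\<bar> powr 2" using False by simp
        also have "\<dots> \<le> \<bar>\<zeta>\<bar> powr \<theta>" using True False \<theta> by (intro powr_mono') auto
        finally show ?thesis .
      qed simp
      then have "C2 * \<zeta>\<^sup>2 \<le> C2 * \<bar>\<zeta>\<bar> powr \<theta>" using C2 by (rule mult_left_mono)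
      also have "\<dots> \<le> ?C * \<bar>\<zeta>\<bar> powr \<theta>" using B0 by (intro mult_right_mono) auto
      finally show ?thesis using a quad[of \<zeta>] by linarith
    next
      case False
      have "1 \<le> \<bar>\<zeta>\<bar> powr \<theta>" using False \<theta> by (intro ge_one_powr_ge_zero) auto
      then have "?C * 1 \<le> ?C * \<bar>\<zeta>\<bar> powr \<theta>" using C2 B0 by (intro mult_left_mono) auto
      moreover have "\<bar>sqrt (kernel_hat bp bm \<zeta>) - 1\<bar> \<le> ?C * 1"
        using order_trans[OF a b] C2 by simp
      ultimately show ?thesis by (rule order_trans[rotated])
    qed
  qed
qed

subsection \<open>The energy estimate\<close>

text \<open>Linearity of \<open>sob\<close> on the Sobolev space carries the difference quotients of
  functions to difference quotients in \<open>l2\<close>. Lowering the order from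
  \<open>\<rho>\<close> to \<open>p\<close> only decreases norms.\<close>

lemma C1_path_sob_derivative:
  assumes u: "C1_path I \<rho> u u'" and t: "t \<in> I" and p: "p \<le> \<rho>"
  shows "((\<lambda>\<tau>. sob p (u \<tau>)) has_vector_derivative sob p (u' t)) (at t within I)"
proof -
  have uH: "\<And>\<tau>. \<tau> \<in> I \<Longrightarrow> u \<tau> \<in> Hs \<rho>" and u'H: "u' t \<in> Hs \<rho>"
    and lim: "((\<lambda>\<tau>. Hs_norm \<rho> (\<lambda>x. (u \<tau> x - u t x) / (\<tau> - t) - u' t x)) \<longlongrightarrow> 0) (at t within I)"
    using u t by (auto simp: C1_path_def C_path_def)
  let ?Q = "\<lambda>\<tau>. (1 / (\<tau> - t)) *\<^sub>R (sob p (u \<tau>) - sob p (u t)) - sob p (u' t)"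
  have "norm (?Q \<tau>) \<le> Hs_norm \<rho> (\<lambda>x. (u \<tau> x - u t x) / (\<tau> - t) - u' t x)" if "\<tau> \<in> I" for \<tau>
  proof -
    let ?g = "\<lambda>x. (1 / (\<tau> - t)) * (u \<tau> x - u t x) - u' t x"
    have g: "?g \<in> Hs q" "sob q ?g = (1 / (\<tau> - t)) *\<^sub>R (sob q (u \<tau>) - sob q (u t)) - sob q (u' t)"
      if "u \<tau> \<in> Hs q" "u t \<in> Hs q" "u' t \<in> Hs q" for q
      using Hs_diff[OF Hs_scale(1)[OF Hs_diff(1)[OF that(1,2)]] that(3), of "1 / (\<tau> - t)"]
        Hs_scale(2)[OF Hs_diff(1)[OF that(1,2)], of "1 / (\<tau> - t)"] Hs_diff(2)[OF that(1,2)] by simp_all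
    have g1: "?g \<in> Hs \<rho>" by (rule g(1)[OF uH[OF that] uH[OF t] u'H])
    have "sob p ?g = ?Q \<tau>"
      by (rule g(2)) (use Hs_mono(1)[OF uH[OF that] p] Hs_mono(1)[OF uH[OF t] p] Hs_mono(1)[OF u'H p] in auto)
    moreover have "norm (sob p ?g) \<le> Hs_norm \<rho> ?g"
      using Hs_mono(2)[OF g1 p] Hs_norm_sob[OF g1] by simp
    ultimately show ?thesis by (simp add: divide_inverse mult.commute)
  qed
  then have "(?Q \<longlongrightarrow> 0) (at t within I)"
    by (intro Lim_null_comparison[OF _ lim]) (auto simp: eventually_at_filter)
  then have Q: "((\<lambda>\<tau>. norm (?Q \<tau>)) \<longlongrightarrow> 0) (at t within I)" by (simp add: tendsto_norm_zero)
  have "((\<lambda>\<tau>. (1 / norm (\<tau> - t)) *\<^sub>R (sob p (u \<tau>) - (sob p (u t) + (\<tau> - t) *\<^sub>R sob p (u' t)))) \<longlongrightarrow> 0) (at t within I)"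
  proof (rule Lim_null_comparison[OF _ Q])
    have "norm ((1 / norm (\<tau> - t)) *\<^sub>R (sob p (u \<tau>) - (sob p (u t) + (\<tau> - t) *\<^sub>R sob p (u' t)))) = norm (?Q \<tau>)" if "\<tau> \<noteq> t" for \<tau>
    proof -
      have "sob p (u \<tau>) - (sob p (u t) + (\<tau> - t) *\<^sub>R sob p (u' t)) = (\<tau> - t) *\<^sub>R ?Q \<tau>"
      proof -
        have "(\<tau> - t) *\<^sub>R ((1 / (\<tau> - t)) *\<^sub>R X - Y) = X - (\<tau> - t) *\<^sub>R Y" for X Y :: l2
          using that by (simp add: scaleR_diff_right)
        then show ?thesis by (simp only: diff_diff_eq)
      qed
      then show ?thesis using that by simp
    qed
    then show "\<forall>\<^sub>F \<tau> in at t within I. norm ((1 / norm (\<tau> - t)) *\<^sub>R (sob p (u \<tau>) - (sob p (u t) + (\<tau> - t) *\<^sub>R sob p (u' t)))) \<le> norm (?Q \<tau>)"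
      by (auto simp: eventually_at_filter)
  qed
  then show ?thesis
    unfolding has_vector_derivative_def has_derivative_within by (simp add: bounded_linear_scaleR_left)
qed

text \<open>The square root is not differentiable where \<open>E\<close> vanishes, in particular at
  time 0, so it is regularised to \<open>y = sqrt (E + \<eta>\<^sup>2)\<close>, which satisfies
  \<open>y' \<le> \<alpha> + \<kappa> * y\<close>. Estimating the exponential in front of
  \<open>\<alpha>\<close> by 1 makes \<open>z\<close> nonincreasing; this produces the factor
  \<open>t\<close> and also covers \<open>\<kappa> = 0\<close>. Finally \<open>\<eta>\<close> tends
  to 0.\<close>

lemma gronwall_sqrt:
  fixes E E' :: "real \<Rightarrow> real"
  assumes deriv: "\<And>t. t \<in> {0..L} \<Longrightarrow> (E has_real_derivative E' t) (at t within {0..L})"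
    and nonneg: "\<And>t. t \<in> {0..L} \<Longrightarrow> 0 \<le> E t" and E0: "E 0 = 0"
    and le: "\<And>t. t \<in> {0..L} \<Longrightarrow> E' t \<le> 2 * \<alpha> * sqrt (E t) + 2 * \<kappa> * E t"
    and pos: "0 \<le> \<alpha>" "0 \<le> \<kappa>" and t: "t \<in> {0..L}"
  shows "sqrt (E t) \<le> \<alpha> * t * exp (\<kappa> * t)"
proof -
  have main: "sqrt (E t) \<le> (\<eta> + \<alpha> * t) * exp (\<kappa> * t)" if \<eta>: "\<eta> > 0" for \<eta>
  proof -
    define y where "y s = sqrt (E s + \<eta>\<^sup>2)" for s
    define z where "z s = y s * exp (- \<kappa> * s) - \<alpha> * s" for s
    define z' where "z' s = (E' s / (2 * y s)) * exp (- \<kappa> * s) - \<kappa> * exp (- \<kappa> * s) * y s - \<alpha>" for s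
    have ypos: "0 < y s" if "s \<in> {0..L}" for s
      using nonneg[OF that] \<eta> by (simp add: y_def add_nonneg_pos)
    have dz: "(z has_real_derivative z' s) (at s within {0..L})" if s: "s \<in> {0..L}" for s
    proof -
      have "0 < E s + \<eta>\<^sup>2" using nonneg[OF s] \<eta> by (simp add: add_nonneg_pos)
      then have "(y has_real_derivative E' s / (2 * y s)) (at s within {0..L})"
        unfolding y_def by (auto intro!: derivative_eq_intros deriv s simp: field_simps)
      then show ?thesis
        unfolding z_def[abs_def] z'_def by (auto intro!: derivative_eq_intros)
    qed
    have z'_le: "z' s \<le> 0" if s: "s \<in> {0..L}" for s
    proof -
      have sE: "sqrt (E s) \<le> y s" using \<eta> by (simp add: y_def)
      have yy: "y s * y s = E s + \<eta>\<^sup>2" using nonneg[OF s] by (simp add: y_def)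
      have "E' s \<le> 2 * \<alpha> * y s + 2 * \<kappa> * (y s * y s)"
        using le[OF s] mult_left_mono[OF sE, of "2 * \<alpha>"] mult_left_mono[of "E s" "y s * y s" "2 * \<kappa>"] pos yy by simp
      also have "\<dots> = (\<alpha> + \<kappa> * y s) * (2 * y s)" by (simp add: algebra_simps)
      finally have "E' s / (2 * y s) \<le> \<alpha> + \<kappa> * y s"
        using ypos[OF s] by (simp add: pos_divide_le_eq)
      then have "(E' s / (2 * y s)) * exp (- \<kappa> * s) \<le> (\<alpha> + \<kappa> * y s) * exp (- \<kappa> * s)"
        by (rule mult_right_mono) simp
      moreover have "\<alpha> * exp (- \<kappa> * s) \<le> \<alpha> * 1"
        using pos s by (intro mult_left_mono) auto
      ultimately show ?thesis unfolding z'_def by (simp add: algebra_simps)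
    qed
    have "z t \<le> z 0"
    proof (cases "t = 0")
      case False
      then have t0: "0 < t" using t by simp
      show ?thesis
      proof (rule DERIV_nonpos_imp_decreasing_open[OF less_imp_le[OF t0]])
        show "continuous_on {0..t} z"
        proof (rule continuous_on_subset)
          show "continuous_on {0..L} z" by (rule DERIV_continuous_on[OF dz])
        qed (use t in auto)
        fix s assume s: "0 < s" "s < t"
        then have sL: "s \<in> {0..L}" "s \<in> {0<..<L}" using t by auto
        have "(z has_real_derivative z' s) (at s within {0<..<L})"
          by (rule DERIV_subset[OF dz[OF sL(1)]]) auto
        then have "(z has_real_derivative z' s) (at s)"
          using sL(2) at_within_open[of s "{0<..<L}"] by simp
        then show "\<exists>y. (z has_real_derivative y) (at s) \<and> y \<le> 0"
          using z'_le[OF sL(1)] by blast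
      qed
    qed simp
    also have "z 0 = \<eta>" using \<eta> by (simp add: z_def y_def E0)
    finally have "y t * exp (- \<kappa> * t) \<le> \<eta> + \<alpha> * t" by (simp add: z_def)
    then have "y t * exp (- \<kappa> * t) * exp (\<kappa> * t) \<le> (\<eta> + \<alpha> * t) * exp (\<kappa> * t)"
      by (rule mult_right_mono) simp
    then have "y t \<le> (\<eta> + \<alpha> * t) * exp (\<kappa> * t)"
      by (simp add: mult.assoc flip: exp_add)
    moreover have "sqrt (E t) \<le> y t" by (simp add: y_def)
    ultimately show ?thesis by linarith
  qed
  have "((\<lambda>\<eta>. (\<eta> + \<alpha> * t) * exp (\<kappa> * t)) \<longlongrightarrow> (0 + \<alpha> * t) * exp (\<kappa> * t)) (at_right 0)"
    by (intro tendsto_intros)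
  moreover have "\<forall>\<^sub>F \<eta> in at_right 0. sqrt (E t) \<le> (\<eta> + \<alpha> * t) * exp (\<kappa> * t)"
    using main eventually_at_right_less[of "0::real"] by (auto elim!: eventually_mono)
  ultimately have "sqrt (E t) \<le> (0 + \<alpha> * t) * exp (\<kappa> * t)"
    by (intro tendsto_lowerbound) auto
  then show ?thesis by simp
qed

text \<open>The derivative costs one weight and the factor \<open>k - 1\<close> costs \<theta>
  further ones, so an error measured in H^r needs \<open>v\<close> in H^(r+1+\<theta>). With the
  symbol scaled by \<delta>, the constant \<open>d\<close> carries the factor
  \<open>\<delta> powr \<theta>\<close>.\<close>

lemma symbol_error_bound:
  assumes k [measurable]: "k \<in> borel_measurable borel" and d: "d \<ge> 0" and \<theta>: "\<theta> \<ge> 0"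
    and kb: "\<And>\<xi>. \<bar>k \<xi> - 1\<bar> \<le> d * \<bar>\<xi>\<bar> powr \<theta>" and v: "v \<in> Hs (r + 1 + \<theta>)"
  shows "square_integrable (\<lambda>\<xi>. complex_of_real (jweight r \<xi>) * (complex_of_real (k \<xi> - 1) * (\<i> * \<xi> * fourier v \<xi>)))"
    and "norm (abs_l2 (\<lambda>\<xi>. complex_of_real (jweight r \<xi>) * (complex_of_real (k \<xi> - 1) * (\<i> * \<xi> * fourier v \<xi>)))) \<le> d * norm (sob (r + 1 + \<theta>) v)"
proof -
  let ?f = "\<lambda>\<xi>. complex_of_real (jweight r \<xi>) * (complex_of_real (k \<xi> - 1) * (\<i> * \<xi> * fourier v \<xi>))"
  have fm [measurable]: "fourier v \<in> borel_measurable borel" using Hs_sqi[OF v] by measurable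
  have m: "?f \<in> borel_measurable borel" by measurable
  have le: "norm (?f \<xi>) \<le> d * norm (weighted (r + 1 + \<theta>) v \<xi>)" for \<xi>
  proof -
    have "\<bar>\<xi>\<bar> powr \<theta> \<le> jweight 1 \<xi> powr \<theta>" using \<theta> by (intro powr_mono2 abs_le_jweight) auto
    then have "\<bar>k \<xi> - 1\<bar> \<le> d * jweight \<theta> \<xi>"
      using kb[of \<xi>] mult_left_mono[of "\<bar>\<xi>\<bar> powr \<theta>" "jweight \<theta> \<xi>" d] d by (simp flip: jweight_powr)
    then have "\<bar>k \<xi> - 1\<bar> * \<bar>\<xi>\<bar> \<le> (d * jweight \<theta> \<xi>) * jweight 1 \<xi>"
      using d by (intro mult_mono abs_le_jweight) auto
    then have "jweight r \<xi> * (\<bar>k \<xi> - 1\<bar> * \<bar>\<xi>\<bar>) * norm (fourier v \<xi>) \<le> jweight r \<xi> * ((d * jweight \<theta> \<xi>) * jweight 1 \<xi>) * norm (fourier v \<xi>)"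
      by (intro mult_right_mono mult_left_mono) auto
    then show ?thesis by (simp add: norm_mult jweight_add mult_ac del: of_real_diff)
  qed
  show "square_integrable ?f"
    by (rule sqi_bound[OF Hs_weighted[OF v] m]) (use le in auto)
  show "norm (abs_l2 ?f) \<le> d * norm (sob (r + 1 + \<theta>) v)"
    unfolding sob_def by (rule abs_l2_norm_le[OF Hs_weighted[OF v] m _ d]) (use le in auto)
qed

definition comm_const :: "real \<Rightarrow> real"
  where "comm_const r = 2 * (2 powr (r + 1) * (r + 1) / (2 * pi)) * weight_const"

definition mult_const :: "real \<Rightarrow> real"
  where "mult_const p = 2 * (2 powr p / (2 * pi)) * weight_const"

lemma comm_const_nonneg: "r \<ge> 1 \<Longrightarrow> comm_const r \<ge> 0"
  by (simp add: comm_const_def)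

lemma mult_const_nonneg [simp]: "mult_const p \<ge> 0"
  by (simp add: mult_const_def)

lemma op_bound: "norm (kernel_op op_kernel \<Omega> A) \<le> weight_const * norm \<Omega> * norm A"
proof -
  have "norm (kernel_op op_kernel \<Omega> A) \<le> 2 * (1 / (2 * pi)) * weight_const * norm \<Omega> * norm A"
    by (rule kernel_op_bound[OF op_kernel_admissible])
  also have "\<dots> \<le> 1 * weight_const * norm \<Omega> * norm A"
    using pi_gt3 by (intro mult_right_mono) auto
  finally show ?thesis by simp
qed

lemma comm_bound: "r \<ge> 1 \<Longrightarrow> norm (kernel_op (comm_kernel r) F G) \<le> comm_const r * norm F * norm G"
  using kernel_op_bound[OF comm_kernel_admissible] by (simp add: comm_const_def)

lemma mult_bound: "p \<ge> 1 \<Longrightarrow> norm (kernel_op (mult_kernel p) F G) \<le> mult_const p * norm F * norm G"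
  using kernel_op_bound[OF mult_kernel_admissible] by (simp add: mult_const_def)

text \<open>The left-hand side is the time derivative of the energy at a fixed time, with
  \<open>\<Omega>'\<close> the time derivative of \<open>w\<close> in H^1 coordinates.
  \<open>F\<close> and \<open>G\<close> denote the consistency errors. \<open>P\<close> applies the
  weight after multiplying by \<open>w\<close>, and \<open>Q\<close> applies it before. The
  equations produce \<open>P\<close> and the energy produces \<open>Q\<close>, so the commutator
  \<open>Q - P\<close> remains after the cancellation.\<close>

lemma energy_rate_bound:
  assumes r: "r \<ge> 1" and k [measurable]: "k \<in> borel_measurable borel"
    and K: "\<And>\<xi>. 0 \<le> k \<xi>" "\<And>\<xi>. k \<xi> \<le> K" and \<theta>: "\<theta> \<ge> 0" and d: "d \<ge> 0"
    and kb: "\<And>\<xi>. \<bar>k \<xi> - 1\<bar> \<le> K * d * \<bar>\<xi>\<bar> powr \<theta>"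
    and U: "U \<in> Hs r" and V: "V \<in> Hs r" and Ut: "Ut \<in> Hs r" and Vt: "Vt \<in> Hs r"
    and w: "w \<in> Hs (r + 1)" and v: "v \<in> Hs (r + 1 + \<theta>)" and q: "q \<in> Hs (r + 1 + \<theta>)"
    and eqU: "AE \<xi> in lborel. fourier Ut \<xi> = complex_of_real (k \<xi>) * (\<i> * \<xi> * fourier V \<xi>) + complex_of_real (k \<xi> - 1) * (\<i> * \<xi> * fourier v \<xi>)"
    and eqV: "AE \<xi> in lborel. fourier Vt \<xi> = complex_of_real (k \<xi>) * (\<i> * \<xi> * (fourier U \<xi> + complex_of_real e * fourier (\<lambda>x. w x * U x) \<xi>))
        + complex_of_real (k \<xi> - 1) * (\<i> * \<xi> * fourier q \<xi>)"
    and W: "norm (sob (r + 1) w) \<le> W" and N: "norm (sob (r + 1 + \<theta>) v) \<le> N" "norm (sob (r + 1 + \<theta>) q) \<le> N"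
    and e: "0 \<le> e" "e \<le> 1" and D: "norm \<Omega>' \<le> D"
  defines "A \<equiv> sob r U" and "B \<equiv> sob r V"
  shows "2 * (A \<bullet> sob r Ut) + 2 * (B \<bullet> sob r Vt) + e * (2 * (sob r Ut \<bullet> kernel_op op_kernel (sob 1 w) A) + A \<bullet> kernel_op op_kernel \<Omega>' A)
    \<le> (2 * K * N + 2 * comm_const r * W * K * N + 2 * mult_const r * W * K * N) * d * (norm A + norm B)
      + (K * comm_const r * W + weight_const * D) * e * ((norm A)\<^sup>2 + (norm B)\<^sup>2)"
proof -
  have K0: "K \<ge> 0" using K[of 0] by linarith
  have N0: "N \<ge> 0" "W \<ge> 0" "D \<ge> 0"
    using N(1) W D norm_ge_zero order_trans by blast+
  note cc = comm_const_nonneg[OF r]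
  have w1: "w \<in> Hs 1" by (rule Hs_mono[OF w]) (use r in simp)
  have wr: "w \<in> Hs r" and wr_le: "norm (sob r w) \<le> norm (sob (r + 1) w)" using Hs_mono[OF w, of r] by auto
  define wU where "wU x = w x * U x" for x
  have wU: "wU \<in> Hs r" unfolding wU_def by (rule Hs_mult(1)[OF r wr U])
  define P where "P = sob r wU"
  have P: "norm P \<le> mult_const r * W * norm A"
  proof -
    have "P = kernel_op (mult_kernel r) (sob r w) A"
      unfolding P_def wU_def A_def by (rule Hs_mult(2)[OF r wr U])
    then have "norm P \<le> mult_const r * norm (sob r w) * norm A" using mult_bound[OF r] by simp
    also have "\<dots> \<le> mult_const r * W * norm A"
      using wr_le W by (intro mult_right_mono mult_left_mono) auto
    finally show ?thesis .
  qed
  define f where "f \<xi> = complex_of_real (jweight r \<xi>) * (complex_of_real (k \<xi> - 1) * (\<i> * \<xi> * fourier v \<xi>))" for \<xi>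
  define g where "g \<xi> = complex_of_real (jweight r \<xi>) * (complex_of_real (k \<xi> - 1) * (\<i> * \<xi> * fourier q \<xi>))" for \<xi>
  have Kd: "K * d \<ge> 0" using K0 d by simp
  note fb = symbol_error_bound[OF k Kd \<theta> kb v] and gb = symbol_error_bound[OF k Kd \<theta> kb q]
  have sf: "square_integrable f" and sg: "square_integrable g" using fb(1) gb(1) unfolding f_def[abs_def] g_def[abs_def] by auto
  define F where "F = abs_l2 f"
  define G where "G = abs_l2 g"
  have F: "norm F \<le> K * d * N"
    using fb(2) mult_left_mono[OF N(1) Kd] unfolding F_def f_def[abs_def] by (rule order_trans)
  have G: "norm G \<le> K * d * N"
    using gb(2) mult_left_mono[OF N(2) Kd] unfolding G_def g_def[abs_def] by (rule order_trans)
  note sU = Hs_weighted[OF U] and sV = Hs_weighted[OF V] and sUt = Hs_weighted[OF Ut] and sVt = Hs_weighted[OF Vt] and swU = Hs_weighted[OF wU]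
  let ?m = "\<lambda>\<xi>. \<i> * complex_of_real (k \<xi> * \<xi>)"
  have a: "AE \<xi> in lborel. weighted r Ut \<xi> - f \<xi> = ?m \<xi> * weighted r V \<xi>"
    using eqU
  proof eventually_elim
    case (elim \<xi>)
    have "J * (h * (\<i> * x * y) + c * z) - J * (c * z) = \<i> * (h * x) * (J * y)" for J h x y c z :: complex
      by (simp add: algebra_simps)
    then show ?case unfolding f_def elim of_real_mult .
  qed
  have b: "AE \<xi> in lborel. weighted r Vt \<xi> - g \<xi> = ?m \<xi> * (weighted r U \<xi> + complex_of_real e * weighted r wU \<xi>)"
    using eqV unfolding wU_def[symmetric]
  proof eventually_elim
    case (elim \<xi>)
    have "J * (h * (\<i> * x * (y + a * b)) + c * z) - J * (c * z) = \<i> * (h * x) * (J * y + a * (J * b))" for J h x y a b c z :: complex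
      by (simp add: algebra_simps)
    then show ?case unfolding g_def elim of_real_mult .
  qed
  have dA: "sob r Ut - F = abs_l2 (\<lambda>\<xi>. weighted r Ut \<xi> - f \<xi>)" and dB: "sob r Vt - G = abs_l2 (\<lambda>\<xi>. weighted r Vt \<xi> - g \<xi>)"
    unfolding sob_def F_def G_def by (rule abs_l2_diff[OF sUt sf] abs_l2_diff[OF sVt sg])+
  have sa: "square_integrable (\<lambda>\<xi>. weighted r Ut \<xi> - f \<xi>)" and sb: "square_integrable (\<lambda>\<xi>. weighted r Vt \<xi> - g \<xi>)"
    by (rule sqi_diff[OF sUt sf] sqi_diff[OF sVt sg])+
  \<comment> \<open>Without \<open>F\<close> and \<open>G\<close> the time derivatives are the
    imaginary symbol \<open>?m\<close> times \<open>B\<close> and times \<open>A + e P\<close>. The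
    real part of the Hermitian product is skew for such a symbol, so the terms cancel pointwise in
    \<xi>, the last term of the energy being chosen to balance \<open>e P\<close>.\<close>
  have cancel: "A \<bullet> (sob r Ut - F) + B \<bullet> (sob r Vt - G) + e * ((sob r Ut - F) \<bullet> P) = 0"
  proof -
    have "A \<bullet> (sob r Ut - F) + B \<bullet> (sob r Vt - G) + e * ((sob r Ut - F) \<bullet> P)
      = (LINT \<xi>|lborel. weighted r U \<xi> \<bullet> (weighted r Ut \<xi> - f \<xi>)) + (LINT \<xi>|lborel. weighted r V \<xi> \<bullet> (weighted r Vt \<xi> - g \<xi>))
        + e * (LINT \<xi>|lborel. (weighted r Ut \<xi> - f \<xi>) \<bullet> weighted r wU \<xi>)"
      unfolding dA dB A_def B_def P_def unfolding sob_def abs_l2_inner[OF sU sa] abs_l2_inner[OF sV sb] abs_l2_inner[OF sa swU] ..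
    also have "\<dots> = (LINT \<xi>|lborel. weighted r U \<xi> \<bullet> (weighted r Ut \<xi> - f \<xi>) + weighted r V \<xi> \<bullet> (weighted r Vt \<xi> - g \<xi>)
        + e * ((weighted r Ut \<xi> - f \<xi>) \<bullet> weighted r wU \<xi>))"
      using sqi_inner_integrable[OF sU sa] sqi_inner_integrable[OF sV sb] sqi_inner_integrable[OF sa swU]
      by (simp only: Bochner_Integration.integral_add Bochner_Integration.integrable_add integrable_mult_right integral_mult_right_zero)
    also have "\<dots> = (LINT \<xi>|(lborel::real measure). (0::real))"
    proof (rule integral_cong_AE)
      show "AE \<xi> in lborel. weighted r U \<xi> \<bullet> (weighted r Ut \<xi> - f \<xi>) + weighted r V \<xi> \<bullet> (weighted r Vt \<xi> - g \<xi>)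
        + e * ((weighted r Ut \<xi> - f \<xi>) \<bullet> weighted r wU \<xi>) = 0"
        using a b
      proof eventually_elim
        case (elim \<xi>)
        have alg: "x \<bullet> (\<i> * complex_of_real m * y) + y \<bullet> (\<i> * complex_of_real m * (x + complex_of_real e * z)) + e * ((\<i> * complex_of_real m * y) \<bullet> z) = 0"
          for x y z m
          by (simp add: inner_complex_def algebra_simps)
        show ?case unfolding elim by (rule alg)
      qed
      show "(\<lambda>\<xi>. weighted r U \<xi> \<bullet> (weighted r Ut \<xi> - f \<xi>) + weighted r V \<xi> \<bullet> (weighted r Vt \<xi> - g \<xi>)
        + e * ((weighted r Ut \<xi> - f \<xi>) \<bullet> weighted r wU \<xi>)) \<in> borel_measurable lborel"
        by (intro borel_measurable_integrable Bochner_Integration.integrable_add integrable_mult_right sqi_inner_integrable sU sa sV sb swU)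
    qed simp
    finally show ?thesis by simp
  qed
  define Q where "Q = kernel_op op_kernel (sob 1 w) A"
  \<comment> \<open>\<open>Ut\<close> contains \<open>\<xi>\<close> times the transform of
    \<open>V\<close>, which \<open>norm B\<close> does not control. Shifting a weight of order -1
    onto it leaves a multiplier bounded by \<open>K\<close>, and the commutator bears the opposite
    weight.\<close>
  have comm: "\<bar>sob r Ut \<bullet> (Q - P)\<bar> \<le> (K * norm B + K * d * N) * (comm_const r * W * norm A)"
  proof -
    let ?J = "\<lambda>\<xi>. complex_of_real (jweight (-1) \<xi>)"
    have sm: "square_integrable (\<lambda>\<xi>. ?J \<xi> * h \<xi>)" "norm (abs_l2 (\<lambda>\<xi>. ?J \<xi> * h \<xi>)) \<le> norm (abs_l2 h)" if h: "square_integrable h" for h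
    proof -
      have hm: "(\<lambda>\<xi>. ?J \<xi> * h \<xi>) \<in> borel_measurable borel" using h by measurable
      have le: "AE \<xi> in lborel. norm (?J \<xi> * h \<xi>) \<le> norm (h \<xi>)"
        by (auto simp: norm_mult jweight_neg_le_1 intro!: AE_I2 mult_left_le_one_le)
      show "square_integrable (\<lambda>\<xi>. ?J \<xi> * h \<xi>)" by (rule sqi_bound[OF h hm, where c = 1]) (use le in simp)
      show "norm (abs_l2 (\<lambda>\<xi>. ?J \<xi> * h \<xi>)) \<le> norm (abs_l2 h)" by (rule abs_l2_norm_mono[OF h hm le])
    qed
    have "sob r Ut \<bullet> (Q - P) = abs_l2 (\<lambda>\<xi>. ?J \<xi> * weighted r Ut \<xi>) \<bullet> kernel_op (comm_kernel r) (sob (r + 1) w) A"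
      using comm_inner[OF r w U sUt] unfolding Q_def P_def wU_def A_def sob_def[of r Ut] .
    then have "\<bar>sob r Ut \<bullet> (Q - P)\<bar> \<le> norm (abs_l2 (\<lambda>\<xi>. ?J \<xi> * weighted r Ut \<xi>)) * norm (kernel_op (comm_kernel r) (sob (r + 1) w) A)"
      by (simp add: Cauchy_Schwarz_ineq2)
    also have "\<dots> \<le> (K * norm B + K * d * N) * (comm_const r * W * norm A)"
    proof (rule mult_mono)
      have "abs_l2 (\<lambda>\<xi>. ?J \<xi> * weighted r Ut \<xi>) = abs_l2 (\<lambda>\<xi>. ?J \<xi> * (weighted r Ut \<xi> - f \<xi>)) + abs_l2 (\<lambda>\<xi>. ?J \<xi> * f \<xi>)"
        unfolding abs_l2_add[OF sm(1)[OF sa] sm(1)[OF sf]] by (simp add: right_diff_distrib)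
      then have "norm (abs_l2 (\<lambda>\<xi>. ?J \<xi> * weighted r Ut \<xi>)) \<le> norm (abs_l2 (\<lambda>\<xi>. ?J \<xi> * (weighted r Ut \<xi> - f \<xi>))) + norm (abs_l2 (\<lambda>\<xi>. ?J \<xi> * f \<xi>))"
        using norm_triangle_ineq by simp
      also have "\<dots> \<le> K * norm B + K * d * N"
      proof (rule add_mono)
        show "norm (abs_l2 (\<lambda>\<xi>. ?J \<xi> * f \<xi>)) \<le> K * d * N" using sm(2)[OF sf] F unfolding F_def by simp
        show "norm (abs_l2 (\<lambda>\<xi>. ?J \<xi> * (weighted r Ut \<xi> - f \<xi>))) \<le> K * norm B"
          unfolding B_def sob_def
        proof (rule abs_l2_norm_le[OF sV _ _ K0])
          show "(\<lambda>\<xi>. ?J \<xi> * (weighted r Ut \<xi> - f \<xi>)) \<in> borel_measurable borel" using sm(1)[OF sa] by (rule sqi_measurable_borel)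
          show "AE \<xi> in lborel. norm (?J \<xi> * (weighted r Ut \<xi> - f \<xi>)) \<le> K * norm (weighted r V \<xi>)"
            using a
          proof eventually_elim
            case (elim \<xi>)
            have "jweight (-1) \<xi> * \<bar>\<xi>\<bar> \<le> jweight (-1) \<xi> * jweight 1 \<xi>" by (intro mult_left_mono abs_le_jweight) simp
            then have j: "jweight (-1) \<xi> * \<bar>\<xi>\<bar> \<le> 1" by simp
            have "norm (?J \<xi> * (weighted r Ut \<xi> - f \<xi>)) = norm (?J \<xi> * (?m \<xi> * weighted r V \<xi>))" unfolding elim ..
            also have "\<dots> = k \<xi> * (jweight (-1) \<xi> * \<bar>\<xi>\<bar>) * norm (weighted r V \<xi>)"
              using K(1)[of \<xi>] by (simp only: norm_mult norm_of_real norm_ii abs_mult abs_of_nonneg[OF jweight_nonneg] abs_of_nonneg) (simp only: mult_ac mult_1_left)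
            also have "\<dots> \<le> K * 1 * norm (weighted r V \<xi>)"
              using K[of \<xi>] j K0 by (intro mult_right_mono mult_mono) auto
            finally show ?case by simp
          qed
        qed
      qed
      finally show "norm (abs_l2 (\<lambda>\<xi>. ?J \<xi> * weighted r Ut \<xi>)) \<le> K * norm B + K * d * N" .
      have "norm (kernel_op (comm_kernel r) (sob (r + 1) w) A) \<le> comm_const r * norm (sob (r + 1) w) * norm A"
        by (rule comm_bound[OF r])
      also have "\<dots> \<le> comm_const r * W * norm A"
        using W cc by (intro mult_right_mono mult_left_mono) auto
      finally show "norm (kernel_op (comm_kernel r) (sob (r + 1) w) A) \<le> comm_const r * W * norm A" .
      show "0 \<le> K * norm B + K * d * N" using K0 d N0 by simp
    qed simp
    finally show ?thesis .
  qed
  let ?x = "norm A" and ?y = "norm B"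
  let ?X = "(K * ?y + K * d * N) * (comm_const r * W * ?x)"
  have "2 * (A \<bullet> sob r Ut) + 2 * (B \<bullet> sob r Vt) + e * (2 * (sob r Ut \<bullet> Q) + A \<bullet> kernel_op op_kernel \<Omega>' A)
      = 2 * (A \<bullet> (sob r Ut - F) + B \<bullet> (sob r Vt - G) + e * ((sob r Ut - F) \<bullet> P))
        + 2 * (A \<bullet> F) + 2 * (B \<bullet> G) + 2 * e * (sob r Ut \<bullet> (Q - P)) + 2 * e * (F \<bullet> P) + e * (A \<bullet> kernel_op op_kernel \<Omega>' A)"
    by (simp add: inner_diff_left inner_diff_right algebra_simps)
  also have "\<dots> = 2 * (A \<bullet> F) + 2 * (B \<bullet> G) + 2 * e * (sob r Ut \<bullet> (Q - P)) + 2 * e * (F \<bullet> P) + e * (A \<bullet> kernel_op op_kernel \<Omega>' A)"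
    unfolding cancel by simp
  also have "\<dots> \<le> 2 * (?x * (K * d * N)) + 2 * (?y * (K * d * N)) + 2 * e * ?X + 2 * e * (K * d * N * (mult_const r * W * ?x)) + e * (?x * (weight_const * D * ?x))"
  proof (intro add_mono mult_left_mono)
    show "A \<bullet> F \<le> ?x * (K * d * N)" using norm_cauchy_schwarz[of A F] mult_left_mono[OF F, of ?x] by simp
    show "B \<bullet> G \<le> ?y * (K * d * N)" using norm_cauchy_schwarz[of B G] mult_left_mono[OF G, of ?y] by simp
    show "sob r Ut \<bullet> (Q - P) \<le> ?X" using comm by simp
    have "F \<bullet> P \<le> norm F * norm P" by (rule norm_cauchy_schwarz)
    also have "\<dots> \<le> K * d * N * (mult_const r * W * ?x)" using F P K0 d N0 by (intro mult_mono) auto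
    finally show "F \<bullet> P \<le> K * d * N * (mult_const r * W * ?x)" .
    have "A \<bullet> kernel_op op_kernel \<Omega>' A \<le> ?x * norm (kernel_op op_kernel \<Omega>' A)" by (rule norm_cauchy_schwarz)
    also have "\<dots> \<le> ?x * (weight_const * norm \<Omega>' * ?x)" by (intro mult_left_mono op_bound) simp
    also have "\<dots> \<le> ?x * (weight_const * D * ?x)" using D by (intro mult_left_mono mult_right_mono) auto
    finally show "A \<bullet> kernel_op op_kernel \<Omega>' A \<le> ?x * (weight_const * D * ?x)" .
  qed (use e in auto)
  \<comment> \<open>In the terms with \<open>d\<close>, which are linear in the norms,
    \<open>e\<close> is replaced by 1; in the quadratic terms it is kept, since it becomes the rate
    in the exponential.\<close>
  also have "\<dots> \<le> (2 * K * N + 2 * comm_const r * W * K * N + 2 * mult_const r * W * K * N) * d * (?x + ?y) + (K * comm_const r * W + weight_const * D) * e * (?x\<^sup>2 + ?y\<^sup>2)"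
  proof -
    have xy: "2 * (?x * ?y) \<le> ?x\<^sup>2 + ?y\<^sup>2" using sum_squares_bound[of ?x ?y] by simp
    let ?c = "comm_const r * W * K" and ?p = "mult_const r * W * K * N * d"
    have "e * (?c * (2 * (?x * ?y))) \<le> e * (?c * (?x\<^sup>2 + ?y\<^sup>2))"
      using e cc N0 K0 xy by (intro mult_left_mono) auto
    moreover have "e * (?c * N * d * ?x) \<le> 1 * (?c * N * d * (?x + ?y))"
      using e cc N0 K0 d by (intro mult_mono mult_left_mono) auto
    moreover have "e * (?p * ?x) \<le> 1 * (?p * (?x + ?y))"
      using e N0 K0 d by (intro mult_mono mult_left_mono) auto
    moreover have "e * (weight_const * D * ?x\<^sup>2) \<le> e * (weight_const * D * (?x\<^sup>2 + ?y\<^sup>2))"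
      using e N0 by (intro mult_left_mono) auto
    ultimately show ?thesis by (simp add: algebra_simps power2_eq_square)
  qed
  finally show ?thesis unfolding Q_def .
qed

subsection \<open>Products of paths and the two systems\<close>

text \<open>\<open>power_quot m a b\<close> is \<open>\<Sum>j\<le>m + 1. a\<^sup>j * b\<^sup>m\<^sup>+\<^sup>1\<^sup>-\<^sup>j\<close>; the sum of degree \<open>0\<close> is the constant
  \<open>1\<close>, which is not square integrable, hence the shifted index.\<close>

primrec power_quot :: "nat \<Rightarrow> real \<Rightarrow> real \<Rightarrow> real" where
  "power_quot 0 a b = a + b"
| "power_quot (Suc m) a b = a ^ Suc (Suc m) + b * power_quot m a b"

lemma power_quot_identity: "a ^ Suc (Suc m) - b ^ Suc (Suc m) = power_quot m a b * (a - b)"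
proof (induction m)
  case 0
  show ?case by (simp add: algebra_simps)
next
  case (Suc m)
  have "a ^ Suc (Suc (Suc m)) - b ^ Suc (Suc (Suc m)) = a ^ Suc (Suc m) * (a - b) + b * (a ^ Suc (Suc m) - b ^ Suc (Suc m))"
    by (simp add: algebra_simps)
  then show ?case unfolding Suc by (simp add: algebra_simps)
qed

lemma Hs_power_bound:
  assumes p: "p \<ge> 1" and f: "f \<in> Hs p" and N: "norm (sob p f) \<le> N"
  shows "norm (sob p (\<lambda>x. f x ^ Suc m)) \<le> (mult_const p * N) ^ m * N"
proof (induction m)
  case 0
  then show ?case using N by simp
next
  case (Suc m)
  have N0: "0 \<le> N" using N norm_ge_zero order_trans by blast
  have "norm (sob p (\<lambda>x. f x * f x ^ Suc m)) \<le> mult_const p * norm (sob p f) * norm (sob p (\<lambda>x. f x ^ Suc m))"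
    unfolding Hs_mult(2)[OF p f Hs_power[OF p f]] by (rule mult_bound[OF p])
  also have "\<dots> \<le> mult_const p * N * ((mult_const p * N) ^ m * N)"
    by (intro mult_mono Suc N) (auto simp: N0)
  finally show ?case by (simp add: mult_ac)
qed

text \<open>The bound \<open>W\<close> is quantified before the two functions: it depends on
  \<open>p\<close>, \<open>N\<close> and \<open>m\<close> alone, as independence of \<delta> and
  \<epsilon> requires.\<close>

lemma Hs_power_quot:
  assumes p: "p \<ge> 1"
  shows "\<exists>W. \<forall>f g. f \<in> Hs p \<longrightarrow> g \<in> Hs p \<longrightarrow> norm (sob p f) \<le> N \<longrightarrow> norm (sob p g) \<le> N \<longrightarrow>
    (\<lambda>x. power_quot m (f x) (g x)) \<in> Hs p \<and> norm (sob p (\<lambda>x. power_quot m (f x) (g x))) \<le> W"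
proof (induction m)
  case 0
  show ?case
  proof (intro exI[of _ "N + N"] allI impI)
    fix f g assume "f \<in> Hs p" "g \<in> Hs p" "norm (sob p f) \<le> N" "norm (sob p g) \<le> N"
    then show "(\<lambda>x. power_quot 0 (f x) (g x)) \<in> Hs p \<and> norm (sob p (\<lambda>x. power_quot 0 (f x) (g x))) \<le> N + N"
      using Hs_add[of f p g] norm_triangle_ineq[of "sob p f" "sob p g"] by simp
  qed
next
  case (Suc m)
  then obtain W where W: "\<And>f g. f \<in> Hs p \<Longrightarrow> g \<in> Hs p \<Longrightarrow> norm (sob p f) \<le> N \<Longrightarrow> norm (sob p g) \<le> N \<Longrightarrow>
    (\<lambda>x. power_quot m (f x) (g x)) \<in> Hs p \<and> norm (sob p (\<lambda>x. power_quot m (f x) (g x))) \<le> W" by blast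
  show ?case
  proof (intro exI[of _ "(mult_const p * N) ^ Suc m * N + mult_const p * N * W"] allI impI)
    fix f g assume fg: "f \<in> Hs p" "g \<in> Hs p" "norm (sob p f) \<le> N" "norm (sob p g) \<le> N"
    have N0: "0 \<le> N" using fg(3) norm_ge_zero order_trans by blast
    note w = W[OF fg]
    note pw = Hs_power[OF p fg(1), of "Suc m"]
    note m = Hs_mult[OF p fg(2) conjunct1[OF w]]
    have "norm (sob p (\<lambda>x. f x ^ Suc (Suc m) + g x * power_quot m (f x) (g x)))
        \<le> norm (sob p (\<lambda>x. f x ^ Suc (Suc m))) + norm (sob p (\<lambda>x. g x * power_quot m (f x) (g x)))"
      unfolding Hs_add(2)[OF pw m(1)] by (rule norm_triangle_ineq)
    also have "\<dots> \<le> (mult_const p * N) ^ Suc m * N + mult_const p * N * W"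
    proof (rule add_mono)
      show "norm (sob p (\<lambda>x. f x ^ Suc (Suc m))) \<le> (mult_const p * N) ^ Suc m * N"
        by (rule Hs_power_bound[OF p fg(1,3)])
      have "norm (sob p (\<lambda>x. g x * power_quot m (f x) (g x))) \<le> mult_const p * norm (sob p g) * norm (sob p (\<lambda>x. power_quot m (f x) (g x)))"
        unfolding m(2) by (rule mult_bound[OF p])
      also have "\<dots> \<le> mult_const p * N * W"
        using fg(4) w N0 by (intro mult_mono) auto
      finally show "norm (sob p (\<lambda>x. g x * power_quot m (f x) (g x))) \<le> mult_const p * N * W" .
    qed
    finally show "(\<lambda>x. power_quot (Suc m) (f x) (g x)) \<in> Hs p \<and>
        norm (sob p (\<lambda>x. power_quot (Suc m) (f x) (g x))) \<le> (mult_const p * N) ^ Suc m * N + mult_const p * N * W"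
      using Hs_add(1)[OF pw m(1)] by simp
  qed
qed

text \<open>Differentiability at one time together with bounds at that time, so that the constants
  are not tied to the interval, whose length depends on \<epsilon>. The order is 1 because
  \<open>op_kernel\<close> measures the multiplier in H^1.\<close>

definition sob_path :: "real set \<Rightarrow> real \<Rightarrow> real \<Rightarrow> real \<Rightarrow> (real \<Rightarrow> real \<Rightarrow> real) \<Rightarrow> l2 \<Rightarrow> bool"
  where "sob_path I t N D f F \<longleftrightarrow> t \<in> I \<and> (\<forall>\<tau>\<in>I. f \<tau> \<in> Hs 1) \<and> norm (sob 1 (f t)) \<le> N \<and> norm F \<le> D \<and>
    ((\<lambda>\<tau>. sob 1 (f \<tau>)) has_vector_derivative F) (at t within I)"

lemma sob_path_add:
  assumes f: "sob_path I t N D f F" and g: "sob_path I t N' D' g G"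
  shows "sob_path I t (N + N') (D + D') (\<lambda>\<tau> x. f \<tau> x + g \<tau> x) (F + G)"
proof -
  have H: "f \<tau> \<in> Hs 1" "g \<tau> \<in> Hs 1" if "\<tau> \<in> I" for \<tau> using f g that by (auto simp: sob_path_def)
  have t: "t \<in> I" using f by (simp add: sob_path_def)
  have "((\<lambda>\<tau>. sob 1 (f \<tau>) + sob 1 (g \<tau>)) has_vector_derivative F + G) (at t within I)"
    using f g by (intro has_vector_derivative_add) (auto simp: sob_path_def)
  then have "((\<lambda>\<tau>. sob 1 (\<lambda>x. f \<tau> x + g \<tau> x)) has_vector_derivative F + G) (at t within I)"
    by (rule has_vector_derivative_transform[OF t, rotated]) (simp add: Hs_add(2) H)
  moreover have "norm (sob 1 (\<lambda>x. f t x + g t x)) \<le> N + N'"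
    unfolding Hs_add(2)[OF H[OF t]] using f g by (intro norm_triangle_mono) (auto simp: sob_path_def)
  moreover have "norm (F + G) \<le> D + D'"
    using f g by (intro norm_triangle_mono) (auto simp: sob_path_def)
  ultimately show ?thesis
    using t H by (auto simp: sob_path_def intro: Hs_add(1))
qed

text \<open>The product of two functions is a bounded bilinear map of their H^1 coordinates, so its
  derivative and both bounds follow from the product rule.\<close>

lemma sob_path_mult:
  assumes f: "sob_path I t N D f F" and g: "sob_path I t N' D' g G"
  shows "\<exists>H. sob_path I t (mult_const 1 * N * N') (mult_const 1 * N * D' + mult_const 1 * D * N') (\<lambda>\<tau> x. f \<tau> x * g \<tau> x) H"
proof -
  let ?K = "kernel_op (mult_kernel 1)"
  have H: "f \<tau> \<in> Hs 1" "g \<tau> \<in> Hs 1" if "\<tau> \<in> I" for \<tau> using f g that by (auto simp: sob_path_def)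
  have t: "t \<in> I" using f by (simp add: sob_path_def)
  have b: "norm (sob 1 (f t)) \<le> N" "norm F \<le> D" "norm (sob 1 (g t)) \<le> N'" "norm G \<le> D'"
    using f g by (auto simp: sob_path_def)
  have nn: "0 \<le> N" "0 \<le> D" using b norm_ge_zero order_trans by blast+
  have Kb: "norm (?K X Y) \<le> mult_const 1 * a * c" if "norm X \<le> a" "norm Y \<le> c" "0 \<le> a" for X Y a c
  proof -
    have "norm (?K X Y) \<le> mult_const 1 * norm X * norm Y" by (rule mult_bound) simp
    also have "\<dots> \<le> mult_const 1 * a * c" using that by (intro mult_mono) auto
    finally show ?thesis .
  qed
  let ?H = "?K (sob 1 (f t)) G + ?K F (sob 1 (g t))"
  have "((\<lambda>\<tau>. ?K (sob 1 (f \<tau>)) (sob 1 (g \<tau>))) has_vector_derivative ?H) (at t within I)"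
    using f g by (intro bounded_bilinear.has_vector_derivative[OF kernel_op_bilinear[OF mult_kernel_admissible]]) (auto simp: sob_path_def)
  then have "((\<lambda>\<tau>. sob 1 (\<lambda>x. f \<tau> x * g \<tau> x)) has_vector_derivative ?H) (at t within I)"
    by (rule has_vector_derivative_transform[OF t, rotated]) (simp add: Hs_mult(2) H)
  moreover have "norm (sob 1 (\<lambda>x. f t x * g t x)) \<le> mult_const 1 * N * N'"
    unfolding Hs_mult(2)[OF order_refl H[OF t]] by (rule Kb[OF b(1,3) nn(1)])
  moreover have "norm ?H \<le> mult_const 1 * N * D' + mult_const 1 * D * N'"
    by (intro norm_triangle_mono Kb b nn)
  ultimately have "sob_path I t (mult_const 1 * N * N') (mult_const 1 * N * D' + mult_const 1 * D * N') (\<lambda>\<tau> x. f \<tau> x * g \<tau> x) ?H"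
    using t H by (auto simp: sob_path_def intro: Hs_mult(1))
  then show ?thesis ..
qed

lemma sob_path_power:
  "\<exists>N' D'. \<forall>I t f F. sob_path I t N D f F \<longrightarrow> (\<exists>W. sob_path I t N' D' (\<lambda>\<tau> x. f \<tau> x ^ Suc m) W)"
proof (induction m)
  case 0
  show ?case by (rule exI[of _ N], rule exI[of _ D]) auto
next
  case (Suc m)
  then obtain N' D' where IH: "\<And>I t f F. sob_path I t N D f F \<Longrightarrow> \<exists>W. sob_path I t N' D' (\<lambda>\<tau> x. f \<tau> x ^ Suc m) W" by blast
  show ?case
  proof (rule exI[of _ "mult_const 1 * N * N'"], rule exI[of _ "mult_const 1 * N * D' + mult_const 1 * D * N'"], intro allI impI)
    fix I t f F assume f: "sob_path I t N D f F"
    obtain W where "sob_path I t N' D' (\<lambda>\<tau> x. f \<tau> x ^ Suc m) W" using IH[OF f] by blast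
    from sob_path_mult[OF f this]
    show "\<exists>W. sob_path I t (mult_const 1 * N * N') (mult_const 1 * N * D' + mult_const 1 * D * N') (\<lambda>\<tau> x. f \<tau> x ^ Suc (Suc m)) W"
      by simp
  qed
qed

lemma sob_path_power_quot:
  "\<exists>N' D'. \<forall>I t f F g G. sob_path I t N D f F \<longrightarrow> sob_path I t N D g G \<longrightarrow> (\<exists>W. sob_path I t N' D' (\<lambda>\<tau> x. power_quot m (f \<tau> x) (g \<tau> x)) W)"
proof (induction m)
  case 0
  show ?case
    by (rule exI[of _ "N + N"], rule exI[of _ "D + D"]) (use sob_path_add in fastforce)
next
  case (Suc m)
  then obtain N1 D1 where IH: "\<And>I t f F g G. sob_path I t N D f F \<Longrightarrow> sob_path I t N D g G \<Longrightarrow>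
    \<exists>W. sob_path I t N1 D1 (\<lambda>\<tau> x. power_quot m (f \<tau> x) (g \<tau> x)) W" by blast
  obtain N2 D2 where pw: "\<And>I t f F. sob_path I t N D f F \<Longrightarrow> \<exists>W. sob_path I t N2 D2 (\<lambda>\<tau> x. f \<tau> x ^ Suc (Suc m)) W"
    using sob_path_power[of N D "Suc m"] by blast
  show ?case
  proof (rule exI[of _ "N2 + mult_const 1 * N * N1"], rule exI[of _ "D2 + (mult_const 1 * N * D1 + mult_const 1 * D * N1)"], intro allI impI)
    fix I t f F g G assume f: "sob_path I t N D f F" and g: "sob_path I t N D g G"
    obtain W1 where "sob_path I t N1 D1 (\<lambda>\<tau> x. power_quot m (f \<tau> x) (g \<tau> x)) W1" using IH[OF f g] by blast
    then obtain W2 where W2: "sob_path I t (mult_const 1 * N * N1) (mult_const 1 * N * D1 + mult_const 1 * D * N1) (\<lambda>\<tau> x. g \<tau> x * power_quot m (f \<tau> x) (g \<tau> x)) W2"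
      using sob_path_mult[OF g] by blast
    obtain W3 where W3: "sob_path I t N2 D2 (\<lambda>\<tau> x. f \<tau> x ^ Suc (Suc m)) W3" using pw[OF f] by blast
    from sob_path_add[OF W3 W2]
    show "\<exists>W. sob_path I t (N2 + mult_const 1 * N * N1) (D2 + (mult_const 1 * N * D1 + mult_const 1 * D * N1)) (\<lambda>\<tau> x. power_quot (Suc m) (f \<tau> x) (g \<tau> x)) W"
      by auto
  qed
qed

text \<open>A bound on time derivatives obtained from the equation: the derivative in space costs
  one order, and the symbol only the constant \<open>K\<close>. Thus bounds on the solutions suffice
  to control how fast \<open>w\<close> varies.\<close>

lemma sob_symbol_bound:
  assumes f: "f \<in> Hs 1" and v: "v \<in> Hs 2" and c: "\<And>\<xi>. \<bar>c \<xi>\<bar> \<le> K" and K: "K \<ge> 0"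
    and eq: "AE \<xi> in lborel. fourier f \<xi> = complex_of_real (c \<xi>) * (\<i> * \<xi> * fourier v \<xi>)"
  shows "norm (sob 1 f) \<le> K * norm (sob 2 v)"
  unfolding sob_def
proof (rule abs_l2_norm_le[OF Hs_weighted[OF v] _ _ K])
  show "weighted 1 f \<in> borel_measurable borel" using Hs_weighted[OF f] by auto
  show "AE \<xi> in lborel. norm (weighted 1 f \<xi>) \<le> K * norm (weighted 2 v \<xi>)"
    using eq
  proof eventually_elim
    case (elim \<xi>)
    have "jweight 2 \<xi> = jweight 1 \<xi> * jweight 1 \<xi>" using jweight_add[of 1 1 \<xi>] by simp
    moreover have "\<bar>c \<xi>\<bar> * (jweight 1 \<xi> * \<bar>\<xi>\<bar>) * norm (fourier v \<xi>) \<le> K * (jweight 1 \<xi> * jweight 1 \<xi>) * norm (fourier v \<xi>)"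
      using c K by (intro mult_right_mono mult_mono mult_left_mono abs_le_jweight) auto
    ultimately show ?case unfolding elim by (simp add: norm_mult mult_ac)
  qed
qed

section \<open>The two systems on the Fourier side\<close>

lemma char_measurable_finite:
  assumes M: "finite_borel_measure M"
  shows "char M \<in> borel_measurable borel"
proof -
  interpret finite_borel_measure M by fact
  have [measurable_cong]: "sets M = sets borel" by (rule M_is_borel)
  have "(\<lambda>t. CLINT x|M. iexp (t * x)) \<in> borel_measurable borel"
    by (rule borel_measurable_lebesgue_integral) measurable
  then show ?thesis unfolding char_def[abs_def] .
qed

lemma kernel_hat_measurable:
  assumes "finite_signed_measure bp bm"
  shows "kernel_hat bp bm \<in> borel_measurable borel"
proof -
  have [measurable]: "char bp \<in> borel_measurable borel" "char bm \<in> borel_measurable borel"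
    using assms by (auto simp: finite_signed_measure_def intro: char_measurable_finite)
  show ?thesis unfolding kernel_hat_def[abs_def] by measurable
qed

text \<open>The quasilinear right-hand side is rewritten as the derivative of the flux, the form in
  which the nonlocal system is given. The chain rule is available only once \<open>ux\<close> is
  known to be square integrable; the sup bound on \<open>u\<close> and \<open>small\<close> keep the
  coefficient above 1/2, whence the constant 2.\<close>

lemma local_flux_fourier_deriv:
  assumes u: "u \<in> Hs 1" and N: "norm (sob 1 u) \<le> N" and vt: "square_integrable vt"
    and wd: "weak_deriv u ux" and e: "0 \<le> e" and small: "real (Suc n) * e * (weight_const * N) ^ n \<le> 1/2"
    and eq: "AE x in lborel. vt x = (1 + real (Suc n) * e * u x ^ n) * ux x"
  shows "fourier_deriv (\<lambda>x. u x + e * u x ^ Suc n) vt"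
proof -
  have su: "square_integrable u" by (rule Hs_sqi[OF u])
  have uxm: "ux \<in> borel_measurable borel" by (rule weak_deriv_measurable[OF wd])
  have sux: "square_integrable ux"
  proof (rule sqi_bound[OF vt uxm, where c = 2])
    show "AE x in lborel. norm (ux x) \<le> 2 * norm (vt x)"
      using eq Hs_sup_bound[OF u]
    proof eventually_elim
      case (elim x)
      have "\<bar>u x\<bar> \<le> weight_const * N" using elim(2) mult_left_mono[OF N weight_const_nonneg] by linarith
      then have "\<bar>u x\<bar> ^ n \<le> (weight_const * N) ^ n" by (intro power_mono) auto
      then have "real (Suc n) * e * \<bar>u x\<bar> ^ n \<le> 1/2"
        using order_trans[OF mult_left_mono[of "\<bar>u x\<bar> ^ n" "(weight_const * N) ^ n" "real (Suc n) * e"] small] e by simp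
      moreover have "\<bar>real (Suc n) * e * u x ^ n\<bar> = real (Suc n) * e * \<bar>u x\<bar> ^ n"
        using e by (simp only: abs_mult power_abs abs_of_nonneg of_nat_0_le_iff)
      ultimately have "1/2 \<le> \<bar>1 + real (Suc n) * e * u x ^ n\<bar>" by linarith
      then have "1/2 * \<bar>ux x\<bar> \<le> \<bar>1 + real (Suc n) * e * u x ^ n\<bar> * \<bar>ux x\<bar>" by (rule mult_right_mono) simp
      then show ?case unfolding elim(1) by (simp only: real_norm_def abs_mult)
    qed
  qed
  have d: "fourier_deriv u ux" by (rule weak_deriv_fourier_deriv[OF wd su sux])
  have p: "fourier_deriv (\<lambda>x. u x ^ Suc n) (\<lambda>x. real (Suc n) * u x ^ n * ux x)" by (rule fourier_deriv_power[OF u d])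
  have sp: "square_integrable (\<lambda>x. u x ^ Suc n)" by (rule Hs_sqi[OF Hs_power[OF order_refl u]])
  have "fourier_deriv (\<lambda>x. u x + e * u x ^ Suc n) (\<lambda>x. ux x + e * (real (Suc n) * u x ^ n * ux x))"
    by (intro fourier_deriv_add d fourier_deriv_scale p sp su sqi_mult_const)
  then show ?thesis
  proof (rule fourier_deriv_cong)
    show "vt \<in> borel_measurable borel" using vt by auto
    show "AE x in lborel. ux x + e * (real (Suc n) * u x ^ n * ux x) = vt x"
      using eq by eventually_elim (simp add: algebra_simps)
  qed
qed

text \<open>The difference of the right-hand sides splits as
  \<open>a y - z = a (y - z) + (a - 1) z\<close>: the nonlocal operator acts on the difference, and
  the consistency error falls on the local solution, whose high norm is bounded.\<close>

lemma difference_equation_u: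
  assumes fd: "fourier_deriv vd vdx" and K: "AE \<xi> in lborel. fourier udt \<xi> = complex_of_real (k \<xi>) * fourier vdx \<xi>"
    and f: "fourier_deriv v ut" and s: "square_integrable udt" "square_integrable vd" "square_integrable v"
  shows "AE \<xi> in lborel. fourier (\<lambda>x. udt x - ut x) \<xi> = complex_of_real (k \<xi>) * (\<i> * \<xi> * fourier (\<lambda>x. vd x - v x) \<xi>)
    + complex_of_real (k \<xi> - 1) * (\<i> * \<xi> * fourier v \<xi>)"
proof -
  have sut: "square_integrable ut" and e1: "AE \<xi> in lborel. fourier ut \<xi> = \<i> * \<xi> * fourier v \<xi>"
    and e2: "AE \<xi> in lborel. fourier vdx \<xi> = \<i> * \<xi> * fourier vd \<xi>"
    using fd f by (auto simp: fourier_deriv_def)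
  show ?thesis
    using fourier_diff[OF s(1) sut] fourier_diff[OF s(2,3)] e1 e2 K
  proof eventually_elim
    case (elim \<xi>)
    have "a * (\<i> * x * y) - \<i> * x * z = a * (\<i> * x * (y - z)) + (a - 1) * (\<i> * x * z)" for a x y z :: complex
      by (simp add: algebra_simps)
    then show ?case unfolding elim of_real_diff of_real_1 .
  qed
qed

subsection \<open>The convergence rate\<close>

text \<open>The coefficient of the linear terms in \<open>energy_rate_bound\<close>. Its summands
  come from the consistency errors paired with \<open>A\<close> and \<open>B\<close>, from the
  commutator paired with the error in \<open>Ut\<close>, and from that error paired with
  \<open>P\<close>.\<close>

definition rate_const :: "real \<Rightarrow> real \<Rightarrow> real \<Rightarrow> real \<Rightarrow> real"
  where "rate_const r K W N = 2 * K * N + 2 * comm_const r * W * K * N + 2 * mult_const r * W * K * N"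

text \<open>All constants are parameters here, while \<delta>, \<epsilon> and the solutions are
  fixed; the two smallness conditions appear as hypotheses. The Gronwall argument is applied to the
  energy of the difference.\<close>

lemma difference_estimate:
  fixes bp bm :: "real measure" and m :: nat
  defines "n \<equiv> Suc m"
  assumes kernel: "finite_signed_measure bp bm"
    and Kb: "\<And>\<zeta>. 0 \<le> kernel_hat bp bm \<zeta>" "\<And>\<zeta>. sqrt (kernel_hat bp bm \<zeta>) \<le> K"
      "\<And>\<zeta>. \<bar>sqrt (kernel_hat bp bm \<zeta>) - 1\<bar> \<le> K * \<bar>\<zeta>\<bar> powr \<theta>"
    and r: "r \<ge> 1" and \<theta>: "\<theta> > 0" and \<delta>: "\<delta> > 0" and \<epsilon>: "\<epsilon> > 0"
    and e1: "\<epsilon> ^ n \<le> 1" and smallW: "\<epsilon> ^ n * (weight_const * W) \<le> 1/2"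
    and smallN: "real (Suc n) * \<epsilon> ^ n * (weight_const * N) ^ n \<le> 1/2"
    and W: "\<And>f g. f \<in> Hs (r + 1) \<Longrightarrow> g \<in> Hs (r + 1) \<Longrightarrow> norm (sob (r + 1) f) \<le> N \<Longrightarrow> norm (sob (r + 1) g) \<le> N \<Longrightarrow>
      (\<lambda>x. power_quot m (f x) (g x)) \<in> Hs (r + 1) \<and> norm (sob (r + 1) (\<lambda>x. power_quot m (f x) (g x))) \<le> W"
    and D: "\<And>I t f F g G. sob_path I t N ((K + 1) * N) f F \<Longrightarrow> sob_path I t N ((K + 1) * N) g G \<Longrightarrow>
      \<exists>\<Omega>. sob_path I t N' D (\<lambda>\<tau> x. power_quot m (f \<tau> x) (g \<tau> x)) \<Omega>"
    and Nq: "N + (mult_const (r + 1 + \<theta>) * N) ^ n * N \<le> Nq"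
    and nonlocal: "nonlocal_solution bp bm n \<delta> \<epsilon> {0..L} (r + 1 + \<theta>) u0 v0 ud vd"
    and local: "local_solution n \<epsilon> {0..L} (r + 1 + \<theta>) u0 v0 u v"
    and bound: "\<And>f \<tau>. f \<in> {ud, vd, u, v} \<Longrightarrow> \<tau> \<in> {0..L} \<Longrightarrow> norm (sob (r + 1 + \<theta>) (f \<tau>)) \<le> N"
    and t: "t \<in> {0..L}" and D': "D \<le> D'" "0 \<le> D'"
  shows "norm (sob r (\<lambda>x. ud t x - u t x)) + norm (sob r (\<lambda>x. vd t x - v t x))
    \<le> 2 * rate_const r K W Nq * \<delta> powr \<theta> * t * exp ((K * comm_const r * W + weight_const * D') * \<epsilon> ^ n * t)"
proof -
  let ?I = "{0..L}" and ?\<sigma> = "r + 1 + \<theta>" and ?d = "\<delta> powr \<theta>"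
  define e where "e = \<epsilon> ^ n"
  define k where "k \<xi> = sqrt (kernel_hat bp bm (\<delta> * \<xi>))" for \<xi>
  have e: "0 \<le> e" "e \<le> 1" using \<epsilon> e1 by (auto simp: e_def)
  have n1: "n \<ge> 1" by (simp add: n_def)
  obtain udt vdt where Cd: "C_path ?I ?\<sigma> ud" "C_path ?I ?\<sigma> vd" "C1_path ?I (?\<sigma> - 1) ud udt" "C1_path ?I (?\<sigma> - 1) vd vdt"
    and eqd: "\<And>\<tau>. \<tau> \<in> ?I \<Longrightarrow> \<exists>vx wx. weak_deriv (vd \<tau>) vx \<and> is_K bp bm \<delta> vx (udt \<tau>) \<and>
          weak_deriv (\<lambda>x. ud \<tau> x + \<epsilon> ^ n * ud \<tau> x ^ (n + 1)) wx \<and> is_K bp bm \<delta> wx (vdt \<tau>)"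
    and id: "AE x in lborel. ud 0 x = u0 x" "AE x in lborel. vd 0 x = v0 x"
    using nonlocal unfolding nonlocal_solution_def by blast
  obtain ut vt where C: "C_path ?I ?\<sigma> u" "C_path ?I ?\<sigma> v" "C1_path ?I (?\<sigma> - 1) u ut" "C1_path ?I (?\<sigma> - 1) v vt"
    and eq: "\<And>\<tau>. \<tau> \<in> ?I \<Longrightarrow> \<exists>vx ux. weak_deriv (v \<tau>) vx \<and> (AE x in lborel. ut \<tau> x = vx x) \<and>
          weak_deriv (u \<tau>) ux \<and> (AE x in lborel. vt \<tau> x = (1 + real (n + 1) * \<epsilon> ^ n * u \<tau> x ^ n) * ux x)"
    and ii: "AE x in lborel. u 0 x = u0 x" "AE x in lborel. v 0 x = v0 x"
    using local unfolding local_solution_def by blast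
  have H: "ud \<tau> \<in> Hs ?\<sigma>" "vd \<tau> \<in> Hs ?\<sigma>" "u \<tau> \<in> Hs ?\<sigma>" "v \<tau> \<in> Hs ?\<sigma>" if "\<tau> \<in> ?I" for \<tau>
    using Cd(1,2) C(1,2) that unfolding C_path_def by blast+
  have Ht: "udt \<tau> \<in> Hs (?\<sigma> - 1)" "vdt \<tau> \<in> Hs (?\<sigma> - 1)" "ut \<tau> \<in> Hs (?\<sigma> - 1)" "vt \<tau> \<in> Hs (?\<sigma> - 1)" if "\<tau> \<in> ?I" for \<tau>
    using Cd(3,4) C(3,4) that unfolding C1_path_def C_path_def by blast+
  have Hp: "ud \<tau> \<in> Hs p" "vd \<tau> \<in> Hs p" "u \<tau> \<in> Hs p" "v \<tau> \<in> Hs p"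
    and Np: "norm (sob p (ud \<tau>)) \<le> N" "norm (sob p (vd \<tau>)) \<le> N" "norm (sob p (u \<tau>)) \<le> N" "norm (sob p (v \<tau>)) \<le> N"
    if "\<tau> \<in> ?I" "p \<le> ?\<sigma>" for \<tau> p
    using Hs_mono[OF H(1)[OF that(1)] that(2)] Hs_mono[OF H(2)[OF that(1)] that(2)]
      Hs_mono[OF H(3)[OF that(1)] that(2)] Hs_mono[OF H(4)[OF that(1)] that(2)]
      bound[of ud, OF _ that(1)] bound[of vd, OF _ that(1)] bound[of u, OF _ that(1)] bound[of v, OF _ that(1)]
    by auto
  have Htp: "udt \<tau> \<in> Hs p" "vdt \<tau> \<in> Hs p" "ut \<tau> \<in> Hs p" "vt \<tau> \<in> Hs p" if "\<tau> \<in> ?I" "p \<le> r + \<theta>" for \<tau> p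
    using Hs_mono(1)[OF Ht(1)[OF that(1)], of p] Hs_mono(1)[OF Ht(2)[OF that(1)], of p]
      Hs_mono(1)[OF Ht(3)[OF that(1)], of p] Hs_mono(1)[OF Ht(4)[OF that(1)], of p] that(2) by auto
  have K0: "K \<ge> 0" using Kb(1)[of 0] Kb(2)[of 0] real_sqrt_ge_zero[of "kernel_hat bp bm 0"] by linarith
  have N0: "N \<ge> 0" by (rule order_trans[OF norm_ge_zero Np(1)[OF t order_refl]])
  have km: "k \<in> borel_measurable borel"
    using kernel_hat_measurable[OF kernel] unfolding k_def[abs_def] by measurable
  have kK: "0 \<le> k \<xi>" "k \<xi> \<le> K" "\<bar>k \<xi> - 1\<bar> \<le> K * ?d * \<bar>\<xi>\<bar> powr \<theta>" for \<xi>
    using Kb(1)[of "\<delta> * \<xi>"] Kb(2)[of "\<delta> * \<xi>"] Kb(3)[of "\<delta> * \<xi>"] \<delta> by (auto simp: k_def abs_mult powr_mult)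
  define U where "U \<tau> x = ud \<tau> x - u \<tau> x" for \<tau> x
  define V where "V \<tau> x = vd \<tau> x - v \<tau> x" for \<tau> x
  define Ut where "Ut \<tau> x = udt \<tau> x - ut \<tau> x" for \<tau> x
  define Vt where "Vt \<tau> x = vdt \<tau> x - vt \<tau> x" for \<tau> x
  define w where "w \<tau> x = power_quot m (ud \<tau> x) (u \<tau> x)" for \<tau> x
  \<comment> \<open>\<open>q\<close> and \<open>qd\<close> are the fluxes of the two systems. In
    terms of them the second equations have the shape of the first, so
    \<open>difference_equation_u\<close> serves both.\<close>
  define q where "q \<tau> x = u \<tau> x + e * u \<tau> x ^ Suc n" for \<tau> x
  define qd where "qd \<tau> x = ud \<tau> x + e * ud \<tau> x ^ Suc n" for \<tau> x
  have r\<sigma>: "r \<le> ?\<sigma>" "r + 1 \<le> ?\<sigma>" "1 \<le> ?\<sigma>" "2 \<le> ?\<sigma>" "r \<le> r + \<theta>" "1 \<le> r + \<theta>" using r \<theta> by auto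
  have UV: "U \<tau> \<in> Hs r" "V \<tau> \<in> Hs r" "sob r (U \<tau>) = sob r (ud \<tau>) - sob r (u \<tau>)" "sob r (V \<tau>) = sob r (vd \<tau>) - sob r (v \<tau>)" if "\<tau> \<in> ?I" for \<tau>
    unfolding U_def[abs_def] V_def[abs_def]
    by (rule Hs_diff[OF Hp(1)[OF that r\<sigma>(1)] Hp(3)[OF that r\<sigma>(1)]] Hs_diff[OF Hp(2)[OF that r\<sigma>(1)] Hp(4)[OF that r\<sigma>(1)]])+
  have UVt: "Ut \<tau> \<in> Hs r" "Vt \<tau> \<in> Hs r" "sob r (Ut \<tau>) = sob r (udt \<tau>) - sob r (ut \<tau>)" "sob r (Vt \<tau>) = sob r (vdt \<tau>) - sob r (vt \<tau>)" if "\<tau> \<in> ?I" for \<tau>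
    unfolding Ut_def[abs_def] Vt_def[abs_def]
    by (rule Hs_diff[OF Htp(1)[OF that r\<sigma>(5)] Htp(3)[OF that r\<sigma>(5)]] Hs_diff[OF Htp(2)[OF that r\<sigma>(5)] Htp(4)[OF that r\<sigma>(5)]])+
  have w: "w \<tau> \<in> Hs (r + 1)" "norm (sob (r + 1) (w \<tau>)) \<le> W" if "\<tau> \<in> ?I" for \<tau>
    using W[OF Hp(1,3)[OF that r\<sigma>(2)] Np(1,3)[OF that r\<sigma>(2)]] unfolding w_def[abs_def] by simp_all
  have w1: "w \<tau> \<in> Hs 1" "norm (sob 1 (w \<tau>)) \<le> W" if "\<tau> \<in> ?I" for \<tau>
    using Hs_mono[OF w(1)[OF that], of 1] w(2)[OF that] r by auto
  have q: "q \<tau> \<in> Hs ?\<sigma>" "norm (sob ?\<sigma> (q \<tau>)) \<le> Nq" and qd: "square_integrable (qd \<tau>)" if "\<tau> \<in> ?I" for \<tau>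
  proof -
    note pu = Hs_power[OF r\<sigma>(3) H(3)[OF that], of n]
    note s = Hs_scale[OF pu, of e]
    show "q \<tau> \<in> Hs ?\<sigma>" unfolding q_def[abs_def] by (rule Hs_add(1)[OF H(3)[OF that] s(1)])
    have "norm (sob ?\<sigma> (q \<tau>)) \<le> norm (sob ?\<sigma> (u \<tau>)) + norm (e *\<^sub>R sob ?\<sigma> (\<lambda>x. u \<tau> x ^ Suc n))"
      unfolding q_def[abs_def] Hs_add(2)[OF H(3)[OF that] s(1)] s(2) by (rule norm_triangle_ineq)
    also have "\<dots> \<le> N + 1 * ((mult_const ?\<sigma> * N) ^ n * N)"
    proof (rule add_mono)
      show "norm (sob ?\<sigma> (u \<tau>)) \<le> N" by (rule Np(3)[OF that]) simp
      show "norm (e *\<^sub>R sob ?\<sigma> (\<lambda>x. u \<tau> x ^ Suc n)) \<le> 1 * ((mult_const ?\<sigma> * N) ^ n * N)"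
        unfolding norm_scaleR
        by (rule mult_mono) (use e Hs_power_bound[OF r\<sigma>(3) H(3)[OF that] Np(3)[OF that order_refl]] in auto)
    qed
    finally show "norm (sob ?\<sigma> (q \<tau>)) \<le> Nq" using Nq by simp
    show "square_integrable (qd \<tau>)"
      unfolding qd_def[abs_def] by (intro sqi_add sqi_mult_const Hs_sqi[OF H(1)[OF that]] Hs_sqi[OF Hs_power[OF r\<sigma>(3) H(1)[OF that]]])
  qed
  have NNq: "N \<le> Nq"
  proof -
    have "0 \<le> (mult_const ?\<sigma> * N) ^ n * N" using N0 by simp
    then show ?thesis using Nq by linarith
  qed
  \<comment> \<open>Since \<open>n = Suc m\<close>, the exponent \<open>Suc n\<close> is
    \<open>Suc (Suc m)\<close>, for which \<open>power_quot m\<close> is the difference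
    quotient.\<close>
  have qdiff: "qd \<tau> x - q \<tau> x = U \<tau> x + e * (w \<tau> x * U \<tau> x)" for \<tau> x
    unfolding qd_def q_def U_def w_def n_def power_quot_identity[symmetric] by (simp only: right_diff_distrib)
  \<comment> \<open>\<open>is_K\<close> includes square integrability of its argument, so the weak
    derivatives in the nonlocal system can be transformed directly.\<close>
  have kernel_rel: "square_integrable g \<and> (AE \<xi> in lborel. fourier h \<xi> = complex_of_real (k \<xi>) * fourier g \<xi>)" if "is_K bp bm \<delta> g h" for g h
    using that by (simp add: is_K_def k_def)
  have rel: "\<exists>vdx. fourier_deriv (vd \<tau>) vdx \<and> (AE \<xi> in lborel. fourier (udt \<tau>) \<xi> = complex_of_real (k \<xi>) * fourier vdx \<xi>)"
    "\<exists>wdx. fourier_deriv (qd \<tau>) wdx \<and> (AE \<xi> in lborel. fourier (vdt \<tau>) \<xi> = complex_of_real (k \<xi>) * fourier wdx \<xi>)"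
    "fourier_deriv (v \<tau>) (ut \<tau>)" "fourier_deriv (q \<tau>) (vt \<tau>)" if \<tau>: "\<tau> \<in> ?I" for \<tau>
  proof -
    obtain vx wx where x: "weak_deriv (vd \<tau>) vx" "is_K bp bm \<delta> vx (udt \<tau>)"
      "weak_deriv (\<lambda>x. ud \<tau> x + \<epsilon> ^ n * ud \<tau> x ^ (n + 1)) wx" "is_K bp bm \<delta> wx (vdt \<tau>)"
      using eqd[OF \<tau>] by blast
    have "fourier_deriv (vd \<tau>) vx" using x kernel_rel Hs_sqi[OF H(2)[OF \<tau>]] by (intro weak_deriv_fourier_deriv) auto
    then show "\<exists>vdx. fourier_deriv (vd \<tau>) vdx \<and> (AE \<xi> in lborel. fourier (udt \<tau>) \<xi> = complex_of_real (k \<xi>) * fourier vdx \<xi>)"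
      using kernel_rel[OF x(2)] by blast
    have "weak_deriv (qd \<tau>) wx" using x(3) unfolding qd_def[abs_def] e_def by simp
    then have "fourier_deriv (qd \<tau>) wx" using kernel_rel[OF x(4)] qd[OF \<tau>] by (intro weak_deriv_fourier_deriv) auto
    then show "\<exists>wdx. fourier_deriv (qd \<tau>) wdx \<and> (AE \<xi> in lborel. fourier (vdt \<tau>) \<xi> = complex_of_real (k \<xi>) * fourier wdx \<xi>)"
      using kernel_rel[OF x(4)] by blast
    obtain vx' ux where y: "weak_deriv (v \<tau>) vx'" "AE x in lborel. ut \<tau> x = vx' x" "weak_deriv (u \<tau>) ux"
      "AE x in lborel. vt \<tau> x = (1 + real (n + 1) * \<epsilon> ^ n * u \<tau> x ^ n) * ux x"
      using eq[OF \<tau>] by blast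
    have sut: "square_integrable (ut \<tau>)" and svt: "square_integrable (vt \<tau>)"
      using Hs_sqi[OF Ht(3)[OF \<tau>]] Hs_sqi[OF Ht(4)[OF \<tau>]] by auto
    have y2: "AE x in lborel. vx' x = ut \<tau> x" using y(2) by eventually_elim simp
    have svx: "square_integrable vx'" by (rule sqi_cong_AE[OF sut weak_deriv_measurable[OF y(1)] y(2)])
    show "fourier_deriv (v \<tau>) (ut \<tau>)"
      by (rule fourier_deriv_cong[OF weak_deriv_fourier_deriv[OF y(1) Hs_sqi[OF H(4)[OF \<tau>]] svx] sqi_measurable_borel[OF sut] y2])
    show "fourier_deriv (q \<tau>) (vt \<tau>)"
      unfolding q_def[abs_def]
    proof (rule local_flux_fourier_deriv[OF Hp(3)[OF \<tau> r\<sigma>(3)] Np(3)[OF \<tau> r\<sigma>(3)] svt y(3) e(1)])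
      show "real (Suc n) * e * (weight_const * N) ^ n \<le> 1/2" using smallN by (simp add: e_def)
      show "AE x in lborel. vt \<tau> x = (1 + real (Suc n) * e * u \<tau> x ^ n) * ux x" using y(4) by (simp add: e_def)
    qed
  qed
  have eqU: "AE \<xi> in lborel. fourier (Ut \<tau>) \<xi> = complex_of_real (k \<xi>) * (\<i> * \<xi> * fourier (V \<tau>) \<xi>) + complex_of_real (k \<xi> - 1) * (\<i> * \<xi> * fourier (v \<tau>) \<xi>)"
    if \<tau>: "\<tau> \<in> ?I" for \<tau>
  proof -
    obtain vdx where "fourier_deriv (vd \<tau>) vdx" "AE \<xi> in lborel. fourier (udt \<tau>) \<xi> = complex_of_real (k \<xi>) * fourier vdx \<xi>"
      using rel(1)[OF \<tau>] by blast
    from difference_equation_u[OF this rel(3)[OF \<tau>] Hs_sqi[OF Ht(1)[OF \<tau>]] Hs_sqi[OF H(2)[OF \<tau>]] Hs_sqi[OF H(4)[OF \<tau>]]]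
    show ?thesis unfolding Ut_def[abs_def] V_def[abs_def] .
  qed
  have eqV: "AE \<xi> in lborel. fourier (Vt \<tau>) \<xi> = complex_of_real (k \<xi>) * (\<i> * \<xi> * (fourier (U \<tau>) \<xi> + complex_of_real e * fourier (\<lambda>x. w \<tau> x * U \<tau> x) \<xi>))
        + complex_of_real (k \<xi> - 1) * (\<i> * \<xi> * fourier (q \<tau>) \<xi>)"
    if \<tau>: "\<tau> \<in> ?I" for \<tau>
  proof -
    obtain wdx where wd: "fourier_deriv (qd \<tau>) wdx" "AE \<xi> in lborel. fourier (vdt \<tau>) \<xi> = complex_of_real (k \<xi>) * fourier wdx \<xi>"
      using rel(2)[OF \<tau>] by blast
    have sU: "square_integrable (U \<tau>)" by (rule Hs_sqi[OF UV(1)[OF \<tau>]])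
    have swU: "square_integrable (\<lambda>x. w \<tau> x * U \<tau> x)"
      by (rule Hs_mult_fourier(1)[OF w1(1)[OF \<tau>] sU])
    have "AE \<xi> in lborel. fourier (\<lambda>x. qd \<tau> x - q \<tau> x) \<xi> = fourier (U \<tau>) \<xi> + complex_of_real e * fourier (\<lambda>x. w \<tau> x * U \<tau> x) \<xi>"
      unfolding qdiff using fourier_add[OF sU sqi_mult_const[OF swU, of e]] fourier_scale[OF swU, of e] by eventually_elim simp
    with difference_equation_u[OF wd rel(4)[OF \<tau>] Hs_sqi[OF Ht(2)[OF \<tau>]] qd[OF \<tau>] Hs_sqi[OF q(1)[OF \<tau>]]]
    show ?thesis unfolding Vt_def[abs_def] by eventually_elim simp
  qed
  have pathI: "\<exists>\<Omega>'. norm \<Omega>' \<le> D' \<and> ((\<lambda>\<tau>. sob 1 (w \<tau>)) has_vector_derivative \<Omega>') (at \<tau> within ?I)" if \<tau>: "\<tau> \<in> ?I" for \<tau>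
  proof -
    have p: "1 \<le> ?\<sigma> - 1" using r\<sigma> by simp
    \<comment> \<open>The time derivative is at most \<open>K * N\<close> for the nonlocal and
      \<open>N\<close> for the local solution; \<open>(K + 1) * N\<close> is a common bound.\<close>
    have "sob_path ?I \<tau> N ((K + 1) * N) ud (sob 1 (udt \<tau>))"
      unfolding sob_path_def
    proof (intro conjI ballI)
      show "((\<lambda>\<tau>. sob 1 (ud \<tau>)) has_vector_derivative sob 1 (udt \<tau>)) (at \<tau> within ?I)"
        by (rule C1_path_sob_derivative[OF Cd(3) \<tau> p])
      obtain vdx where vdx: "fourier_deriv (vd \<tau>) vdx" "AE \<xi> in lborel. fourier (udt \<tau>) \<xi> = complex_of_real (k \<xi>) * fourier vdx \<xi>"
        using rel(1)[OF \<tau>] by blast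
      have "AE \<xi> in lborel. fourier vdx \<xi> = \<i> * \<xi> * fourier (vd \<tau>) \<xi>" using vdx(1) by (simp add: fourier_deriv_def)
      with vdx(2) have "AE \<xi> in lborel. fourier (udt \<tau>) \<xi> = complex_of_real (k \<xi>) * (\<i> * \<xi> * fourier (vd \<tau>) \<xi>)"
        by eventually_elim simp
      then have "norm (sob 1 (udt \<tau>)) \<le> K * norm (sob 2 (vd \<tau>))"
        using kK by (intro sob_symbol_bound[OF Htp(1)[OF \<tau> r\<sigma>(6)] Hp(2)[OF \<tau> r\<sigma>(4)] _ K0]) (auto simp: abs_of_nonneg)
      also have "\<dots> \<le> K * N" by (intro mult_left_mono K0 Np(2)[OF \<tau> r\<sigma>(4)])
      also have "\<dots> \<le> (K + 1) * N" using N0 by (intro mult_right_mono) auto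
      finally show "norm (sob 1 (udt \<tau>)) \<le> (K + 1) * N" .
    qed (use \<tau> Hp(1) Np(1)[OF \<tau> r\<sigma>(3)] r\<sigma>(3) in auto)
    moreover have "sob_path ?I \<tau> N ((K + 1) * N) u (sob 1 (ut \<tau>))"
      unfolding sob_path_def
    proof (intro conjI ballI)
      show "((\<lambda>\<tau>. sob 1 (u \<tau>)) has_vector_derivative sob 1 (ut \<tau>)) (at \<tau> within ?I)"
        by (rule C1_path_sob_derivative[OF C(3) \<tau> p])
      have "AE \<xi> in lborel. fourier (ut \<tau>) \<xi> = complex_of_real 1 * (\<i> * \<xi> * fourier (v \<tau>) \<xi>)"
        using rel(3)[OF \<tau>] by (simp add: fourier_deriv_def)
      then have "norm (sob 1 (ut \<tau>)) \<le> 1 * norm (sob 2 (v \<tau>))"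
        by (intro sob_symbol_bound[OF Htp(3)[OF \<tau> r\<sigma>(6)] Hp(4)[OF \<tau> r\<sigma>(4)]]) auto
      also have "\<dots> \<le> 1 * N" by (intro mult_left_mono Np(4)[OF \<tau> r\<sigma>(4)]) simp
      also have "\<dots> \<le> (K + 1) * N" using N0 K0 by (intro mult_right_mono) auto
      finally show "norm (sob 1 (ut \<tau>)) \<le> (K + 1) * N" .
    qed (use \<tau> Hp(3) Np(3)[OF \<tau> r\<sigma>(3)] r\<sigma>(3) in auto)
    ultimately obtain \<Omega> where "sob_path ?I \<tau> N' D (\<lambda>\<tau> x. power_quot m (ud \<tau> x) (u \<tau> x)) \<Omega>" using D by blast
    then show ?thesis
      using D' unfolding sob_path_def w_def[abs_def] by (auto intro!: exI[of _ \<Omega>])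
  qed
  then obtain \<Omega>' where \<Omega>': "\<And>\<tau>. \<tau> \<in> ?I \<Longrightarrow> norm (\<Omega>' \<tau>) \<le> D'"
    "\<And>\<tau>. \<tau> \<in> ?I \<Longrightarrow> ((\<lambda>\<tau>. sob 1 (w \<tau>)) has_vector_derivative \<Omega>' \<tau>) (at \<tau> within ?I)" by metis
  let ?Op = "kernel_op op_kernel"
  define A where "A \<tau> = sob r (U \<tau>)" for \<tau>
  define B where "B \<tau> = sob r (V \<tau>)" for \<tau>
  define \<Omega> where "\<Omega> \<tau> = sob 1 (w \<tau>)" for \<tau>
  define E where "E \<tau> = A \<tau> \<bullet> A \<tau> + B \<tau> \<bullet> B \<tau> + e * (A \<tau> \<bullet> ?Op (\<Omega> \<tau>) (A \<tau>))" for \<tau>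
  define E' where "E' \<tau> = 2 * (A \<tau> \<bullet> sob r (Ut \<tau>)) + 2 * (B \<tau> \<bullet> sob r (Vt \<tau>))
    + e * (2 * (sob r (Ut \<tau>) \<bullet> ?Op (\<Omega> \<tau>) (A \<tau>)) + A \<tau> \<bullet> ?Op (\<Omega>' \<tau>) (A \<tau>))" for \<tau>
  let ?c2 = "K * comm_const r * W + weight_const * D'"
  have W0: "W \<ge> 0" using w(2)[OF t] norm_ge_zero order_trans by blast
  have Nq0: "Nq \<ge> 0" using NNq N0 by simp
  have c1: "rate_const r K W Nq \<ge> 0"
    unfolding rate_const_def using K0 Nq0 W0 comm_const_nonneg[OF r] by simp
  have c2: "?c2 \<ge> 0" using K0 W0 comm_const_nonneg[OF r] D' by simp
  \<comment> \<open>By \<open>smallW\<close> the indefinite last term of \<open>E\<close> is at most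
    half of the squared norm of \<open>A\<close>, which explains the factor 2.\<close>
  have coercive: "(norm (A \<tau>))\<^sup>2 + (norm (B \<tau>))\<^sup>2 \<le> 2 * E \<tau>" if \<tau>: "\<tau> \<in> ?I" for \<tau>
  proof -
    have "\<bar>A \<tau> \<bullet> ?Op (\<Omega> \<tau>) (A \<tau>)\<bar> \<le> norm (A \<tau>) * norm (?Op (\<Omega> \<tau>) (A \<tau>))" by (rule Cauchy_Schwarz_ineq2)
    also have "\<dots> \<le> norm (A \<tau>) * (weight_const * norm (\<Omega> \<tau>) * norm (A \<tau>))" by (intro mult_left_mono op_bound) simp
    also have "\<dots> \<le> norm (A \<tau>) * (weight_const * W * norm (A \<tau>))"
      unfolding \<Omega>_def using w1(2)[OF \<tau>] by (intro mult_left_mono mult_right_mono) auto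
    finally have "e * \<bar>A \<tau> \<bullet> ?Op (\<Omega> \<tau>) (A \<tau>)\<bar> \<le> e * (norm (A \<tau>) * (weight_const * W * norm (A \<tau>)))"
      using e by (intro mult_left_mono) auto
    also have "\<dots> = (e * (weight_const * W)) * (norm (A \<tau>))\<^sup>2" by (simp add: power2_eq_square)
    also have "\<dots> \<le> 1/2 * (norm (A \<tau>))\<^sup>2" using smallW by (intro mult_right_mono) (auto simp: e_def)
    finally have "\<bar>e * (A \<tau> \<bullet> ?Op (\<Omega> \<tau>) (A \<tau>))\<bar> \<le> 1/2 * (norm (A \<tau>))\<^sup>2" using e by (simp add: abs_mult)
    moreover have "a + b \<le> 2 * (a + b + x)" if "\<bar>x\<bar> \<le> 1/2 * a" "0 \<le> b" for a b x :: real
      using abs_le_D2[OF that(1)] that(2) by (simp add: field_simps)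
    ultimately show ?thesis
      unfolding E_def power2_norm_eq_inner[symmetric] by simp
  qed
  have sqrtE: "norm (A \<tau>) + norm (B \<tau>) \<le> 2 * sqrt (E \<tau>)" if \<tau>: "\<tau> \<in> ?I" for \<tau>
  proof -
    have "(norm (A \<tau>) + norm (B \<tau>))\<^sup>2 \<le> 2 * ((norm (A \<tau>))\<^sup>2 + (norm (B \<tau>))\<^sup>2)"
      using sum_squares_bound[of "norm (A \<tau>)" "norm (B \<tau>)"] by (simp add: power2_sum)
    also have "\<dots> \<le> 4 * E \<tau>" using coercive[OF \<tau>] by simp
    finally have "norm (A \<tau>) + norm (B \<tau>) \<le> sqrt (4 * E \<tau>)" by (rule real_le_rsqrt)
    then show ?thesis by (simp add: real_sqrt_mult)
  qed
  have "sqrt (E t) \<le> (rate_const r K W Nq * ?d) * t * exp ((?c2 * e) * t)"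
  proof (rule gronwall_sqrt[of L E E'])
    show "0 \<le> E \<tau>" if \<tau>: "\<tau> \<in> ?I" for \<tau>
      using coercive[OF \<tau>] zero_le_power2[of "norm (A \<tau>)"] zero_le_power2[of "norm (B \<tau>)"] by linarith
    show "E 0 = 0"
    proof -
      have I0: "0 \<in> ?I" using t by simp
      have u: "AE x in lborel. u 0 x = ud 0 x" using id(1) ii(1) by eventually_elim simp
      have v: "AE x in lborel. v 0 x = vd 0 x" using id(2) ii(2) by eventually_elim simp
      have "sob r (ud 0) = sob r (u 0)" "sob r (vd 0) = sob r (v 0)"
        using Hs_cong_AE(2)[OF Hp(3)[OF I0 r\<sigma>(1)] _ u] Hs_cong_AE(2)[OF Hp(4)[OF I0 r\<sigma>(1)] _ v]
          sqi_measurable_borel[OF Hs_sqi[OF H(1)[OF I0]]] sqi_measurable_borel[OF Hs_sqi[OF H(2)[OF I0]]] by auto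
      then have "A 0 = 0" "B 0 = 0" using UV(3,4)[OF I0] by (auto simp: A_def B_def)
      then show ?thesis by (simp add: E_def)
    qed
    fix \<tau> assume \<tau>: "\<tau> \<in> ?I"
    have rp: "r \<le> ?\<sigma> - 1" using \<theta> by simp
    have dA: "(A has_vector_derivative sob r (Ut \<tau>)) (at \<tau> within ?I)"
    proof (rule has_vector_derivative_transform[OF \<tau>])
      show "((\<lambda>\<tau>. sob r (ud \<tau>) - sob r (u \<tau>)) has_vector_derivative sob r (Ut \<tau>)) (at \<tau> within ?I)"
        unfolding UVt(3)[OF \<tau>]
        by (intro has_vector_derivative_diff C1_path_sob_derivative[OF Cd(3) \<tau> rp] C1_path_sob_derivative[OF C(3) \<tau> rp])
    qed (simp add: A_def UV)
    have dB: "(B has_vector_derivative sob r (Vt \<tau>)) (at \<tau> within ?I)"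
    proof (rule has_vector_derivative_transform[OF \<tau>])
      show "((\<lambda>\<tau>. sob r (vd \<tau>) - sob r (v \<tau>)) has_vector_derivative sob r (Vt \<tau>)) (at \<tau> within ?I)"
        unfolding UVt(4)[OF \<tau>]
        by (intro has_vector_derivative_diff C1_path_sob_derivative[OF Cd(4) \<tau> rp] C1_path_sob_derivative[OF C(4) \<tau> rp])
    qed (simp add: B_def UV)
    have d\<Omega>: "(\<Omega> has_vector_derivative \<Omega>' \<tau>) (at \<tau> within ?I)"
      unfolding \<Omega>_def[abs_def] by (rule \<Omega>'(2)[OF \<tau>])
    note dOp = bounded_bilinear.has_vector_derivative[OF kernel_op_bilinear[OF op_kernel_admissible] d\<Omega> dA]
    note ip = bounded_bilinear.has_vector_derivative[OF bounded_bilinear_inner]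
    note dE = has_vector_derivative_add[OF has_vector_derivative_add[OF ip[OF dA dA] ip[OF dB dB]]
        bounded_linear.has_vector_derivative[OF bounded_linear_mult_right[of e] ip[OF dA dOp]]]
    \<comment> \<open>Symmetry of multiplication by \<open>w\<close> merges the two terms of the
      product rule that contain the derivative of \<open>A\<close>, which gives the factor 2 in the
      last term of \<open>E'\<close>.\<close>
    have sym: "A \<tau> \<bullet> ?Op (\<Omega> \<tau>) (sob r (Ut \<tau>)) = sob r (Ut \<tau>) \<bullet> ?Op (\<Omega> \<tau>) (A \<tau>)"
      unfolding \<Omega>_def by (rule trans[OF op_symmetric[OF w1(1)[OF \<tau>], symmetric] inner_commute])
    show "(E has_real_derivative E' \<tau>) (at \<tau> within ?I)"
      unfolding has_real_derivative_iff_has_vector_derivative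
    proof (rule has_vector_derivative_eq_rhs)
      show "(E has_vector_derivative (A \<tau> \<bullet> sob r (Ut \<tau>) + sob r (Ut \<tau>) \<bullet> A \<tau> + (B \<tau> \<bullet> sob r (Vt \<tau>) + sob r (Vt \<tau>) \<bullet> B \<tau>)
        + e * (A \<tau> \<bullet> (?Op (\<Omega> \<tau>) (sob r (Ut \<tau>)) + ?Op (\<Omega>' \<tau>) (A \<tau>)) + sob r (Ut \<tau>) \<bullet> ?Op (\<Omega> \<tau>) (A \<tau>)))) (at \<tau> within ?I)"
        unfolding E_def[abs_def] by (rule dE)
      show "A \<tau> \<bullet> sob r (Ut \<tau>) + sob r (Ut \<tau>) \<bullet> A \<tau> + (B \<tau> \<bullet> sob r (Vt \<tau>) + sob r (Vt \<tau>) \<bullet> B \<tau>)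
        + e * (A \<tau> \<bullet> (?Op (\<Omega> \<tau>) (sob r (Ut \<tau>)) + ?Op (\<Omega>' \<tau>) (A \<tau>)) + sob r (Ut \<tau>) \<bullet> ?Op (\<Omega> \<tau>) (A \<tau>)) = E' \<tau>"
        unfolding E'_def inner_add_right sym by (simp add: inner_commute)
    qed
    have "E' \<tau> \<le> rate_const r K W Nq * ?d * (norm (A \<tau>) + norm (B \<tau>)) + ?c2 * e * ((norm (A \<tau>))\<^sup>2 + (norm (B \<tau>))\<^sup>2)"
      unfolding E'_def A_def B_def \<Omega>_def rate_const_def
    proof (rule energy_rate_bound[OF r km kK(1,2) less_imp_le[OF \<theta>] _ kK(3) UV(1,2)[OF \<tau>] UVt(1,2)[OF \<tau>] w(1)[OF \<tau>]
        H(4)[OF \<tau>] q(1)[OF \<tau>] eqU[OF \<tau>] eqV[OF \<tau>] w(2)[OF \<tau>] _ q(2)[OF \<tau>] e \<Omega>'(1)[OF \<tau>]])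
      show "norm (sob ?\<sigma> (v \<tau>)) \<le> Nq" using Np(4)[OF \<tau> order_refl] NNq by simp
    qed simp
    also have "\<dots> \<le> rate_const r K W Nq * ?d * (2 * sqrt (E \<tau>)) + ?c2 * e * (2 * E \<tau>)"
      using c1 c2 e by (intro add_mono mult_left_mono sqrtE coercive \<tau>) auto
    finally show "E' \<tau> \<le> 2 * (rate_const r K W Nq * ?d) * sqrt (E \<tau>) + 2 * (?c2 * e) * E \<tau>"
      by (simp add: algebra_simps)
  qed (use c1 c2 e t in auto)
  then have "norm (A t) + norm (B t) \<le> 2 * ((rate_const r K W Nq * ?d) * t * exp ((?c2 * e) * t))"
    using sqrtE[OF t] by linarith
  then show ?thesis
    by (simp add: A_def B_def U_def[abs_def] V_def[abs_def] e_def mult_ac)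
qed

theorem theorem6p2:
  fixes bp bm :: "real measure" and n :: nat and s \<theta> T M :: real and u0 v0 :: "real \<Rightarrow> real"
  assumes kernel: "finite_signed_measure bp bm" "even_kernel bp bm"
    and hat_bounded: "bdd_above (range (\<lambda>\<eta>. \<bar>kernel_hat bp bm \<eta>\<bar>))"
    and hat_range: "\<forall>\<xi>. 0 \<le> kernel_hat bp bm \<xi> \<and> kernel_hat bp bm \<xi> \<le> (SUP \<eta>. \<bar>kernel_hat bp bm \<eta>\<bar>)"
    and total_mass: "measure bp UNIV - measure bm UNIV = 1"
    and second_moment: "integrable bp (\<lambda>x. x\<^sup>2)" "integrable bm (\<lambda>x. x\<^sup>2)"
    and parameters: "n \<ge> 1" "T > 0" "s > 5/2" "0 < \<theta>" "\<theta> \<le> 2"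
    and initial: "u0 \<in> Hs (s + \<theta>)" "v0 \<in> Hs (s + \<theta>)"
  shows "\<exists>C>0. \<exists>\<epsilon>0>0. \<forall>\<delta> \<epsilon>. 0 < \<delta> \<longrightarrow> 0 < \<epsilon> \<longrightarrow> \<epsilon> \<le> \<epsilon>0 \<longrightarrow>
    (\<forall>u\<delta> v\<delta> u v.
      nonlocal_solution bp bm n \<delta> \<epsilon> {0..T / \<epsilon> ^ n} (s + \<theta>) u0 v0 u\<delta> v\<delta> \<longrightarrow>
      local_solution n \<epsilon> {0..T / \<epsilon> ^ n} (s + \<theta>) u0 v0 u v \<longrightarrow>
      (\<forall>f\<in>{u\<delta>, v\<delta>, u, v}. Hs_bounded {0..T / \<epsilon> ^ n} (s + \<theta>) M f) \<longrightarrow>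
      (\<forall>t\<in>{0..T / \<epsilon> ^ n}.
        Hs_norm (s - 1) (\<lambda>x. u\<delta> t x - u t x) + Hs_norm (s - 1) (\<lambda>x. v\<delta> t x - v t x)
          \<le> C * \<delta> powr \<theta> * t * exp (C * \<epsilon> ^ n * t)))"
proof -
  define r where "r = s - 1"
  have r: "r \<ge> 1" and rs: "r + 1 = s" "r + 1 + \<theta> = s + \<theta>" using parameters by (auto simp: r_def)
  \<comment> \<open>The index \<open>m\<close> is the one of \<open>power_quot\<close>, shifted by
    one against the exponent \<open>n\<close>.\<close>
  obtain m where m: "n = Suc m" using parameters(1) by (cases n) auto
  \<comment> \<open>\<open>M\<close> is an arbitrary real number; the maximum makes the derived
    constants nonnegative.\<close>
  define N where "N = max M 1"
  have N1: "N \<ge> 1" by (simp add: N_def)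
  obtain K where K: "K > 0" "\<And>\<zeta>. sqrt (kernel_hat bp bm \<zeta>) \<le> K" "\<And>\<zeta>. \<bar>sqrt (kernel_hat bp bm \<zeta>) - 1\<bar> \<le> K * \<bar>\<zeta>\<bar> powr \<theta>"
    using kernel_symbol_bounds[OF kernel(1) hat_bounded _ total_mass second_moment parameters(4,5)] hat_range by blast
  obtain W0 where W0: "\<And>f g. f \<in> Hs (r + 1) \<Longrightarrow> g \<in> Hs (r + 1) \<Longrightarrow> norm (sob (r + 1) f) \<le> N \<Longrightarrow> norm (sob (r + 1) g) \<le> N \<Longrightarrow>
      (\<lambda>x. power_quot m (f x) (g x)) \<in> Hs (r + 1) \<and> norm (sob (r + 1) (\<lambda>x. power_quot m (f x) (g x))) \<le> W0"
    using Hs_power_quot[of "r + 1" N m] r by auto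
  \<comment> \<open>The obtained bound comes without a sign, which the estimates need;
    \<open>D'\<close> is formed from \<open>D\<close> for the same reason.\<close>
  define W where "W = max W0 0"
  have W: "(\<lambda>x. power_quot m (f x) (g x)) \<in> Hs (r + 1) \<and> norm (sob (r + 1) (\<lambda>x. power_quot m (f x) (g x))) \<le> W"
    if "f \<in> Hs (r + 1)" "g \<in> Hs (r + 1)" "norm (sob (r + 1) f) \<le> N" "norm (sob (r + 1) g) \<le> N" for f g
    using W0[OF that] by (auto simp: W_def)
  obtain N' D where D: "\<And>I t f F g G. sob_path I t N ((K + 1) * N) f F \<Longrightarrow> sob_path I t N ((K + 1) * N) g G \<Longrightarrow>
      \<exists>\<Omega>. sob_path I t N' D (\<lambda>\<tau> x. power_quot m (f \<tau> x) (g \<tau> x)) \<Omega>"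
    using sob_path_power_quot[of N "(K + 1) * N" m] by blast
  define D' where "D' = max D 0"
  define Nq where "Nq = N + (mult_const (r + 1 + \<theta>) * N) ^ n * N"
  define c1 where "c1 = rate_const r K W Nq"
  define c2 where "c2 = K * comm_const r * W + weight_const * D'"
  have Nq0: "Nq \<ge> 0" unfolding Nq_def using N1 by simp
  have c1: "c1 \<ge> 0" unfolding c1_def rate_const_def using K Nq0 comm_const_nonneg[OF r] by (simp add: W_def)
  have c2: "c2 \<ge> 0" unfolding c2_def using K comm_const_nonneg[OF r] by (simp add: W_def D'_def)
  \<comment> \<open>One constant dominates both the prefactor \<open>2 * c1\<close> and the rate
    \<open>c2\<close>; the summand 1 makes it positive.\<close>
  define C where "C = 2 * c1 + c2 + 1"
  \<comment> \<open>\<open>Z\<close> dominates each of the two quantities that must be at most 1/2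
    after multiplication by \<open>\<epsilon> ^ n\<close>. The summand 1 ensures
    \<open>\<epsilon>0 \<le> 1/2\<close>, so that
    \<open>\<epsilon> ^ n \<le> \<epsilon>\<close>.\<close>
  define Z where "Z = 1 + weight_const * W + real (Suc n) * (weight_const * N) ^ n"
  have nn: "0 \<le> weight_const * W" "0 \<le> real (Suc n) * (weight_const * N) ^ n" using N1 by (auto simp: W_def)
  then have Z: "Z \<ge> 1" by (simp add: Z_def)
  define \<epsilon>0 where "\<epsilon>0 = 1 / (2 * Z)"
  show ?thesis
  proof (rule exI[of _ C], intro conjI, goal_cases)
    case 1
    show ?case using c1 c2 by (simp add: C_def)
  next
    case 2
    show ?case
    proof (rule exI[of _ \<epsilon>0], intro conjI allI impI ballI, goal_cases)
      case 1
      show ?case using Z by (simp add: \<epsilon>0_def)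
    next
      case (2 \<delta> \<epsilon> u\<delta> v\<delta> u v t)
      note sol = 2
      let ?L = "T / \<epsilon> ^ n"
      have "\<epsilon>0 \<le> 1" using Z by (simp add: \<epsilon>0_def)
      then have "\<epsilon> ^ n \<le> \<epsilon>"
        using sol(2,3) power_decreasing[of 1 n \<epsilon>] parameters(1) by simp
      then have e: "\<epsilon> ^ n \<le> \<epsilon>0" using sol(3) by simp
      have eZ: "\<epsilon> ^ n * y \<le> 1/2" if "0 \<le> y" "y \<le> Z" for y
      proof -
        have "\<epsilon> ^ n * y \<le> \<epsilon>0 * Z" using e that sol(2) Z by (intro mult_mono) (auto simp: \<epsilon>0_def)
        also have "\<dots> = 1/2" using Z by (simp add: \<epsilon>0_def)
        finally show ?thesis .
      qed
      have H: "f \<tau> \<in> Hs (s + \<theta>)" if "f \<in> {u\<delta>, v\<delta>, u, v}" "\<tau> \<in> {0..?L}" for f \<tau>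
        using sol(4,5) that unfolding nonlocal_solution_def local_solution_def C_path_def by auto
      have bnd: "norm (sob (s + \<theta>) (f \<tau>)) \<le> N" if "f \<in> {u\<delta>, v\<delta>, u, v}" "\<tau> \<in> {0..?L}" for f \<tau>
      proof -
        have "Hs_norm (s + \<theta>) (f \<tau>) \<le> M" using sol(6) that unfolding Hs_bounded_def by blast
        then show ?thesis unfolding Hs_norm_sob[OF H[OF that]] by (simp add: N_def)
      qed
      have "norm (sob r (\<lambda>x. u\<delta> t x - u t x)) + norm (sob r (\<lambda>x. v\<delta> t x - v t x))
          \<le> 2 * rate_const r K W Nq * \<delta> powr \<theta> * t * exp ((K * comm_const r * W + weight_const * D') * \<epsilon> ^ Suc m * t)"
      proof (rule difference_estimate[OF kernel(1) _ K(2,3) r parameters(4) sol(1,2) _ _ _ W D])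
        show "0 \<le> kernel_hat bp bm \<zeta>" for \<zeta> using hat_range by simp
        show "\<epsilon> ^ Suc m \<le> 1" unfolding m[symmetric] using e \<open>\<epsilon>0 \<le> 1\<close> by (rule order_trans)
        show "\<epsilon> ^ Suc m * (weight_const * W) \<le> 1/2"
          unfolding m[symmetric] using nn by (intro eZ) (auto simp: Z_def)
        show "real (Suc (Suc m)) * \<epsilon> ^ Suc m * (weight_const * N) ^ Suc m \<le> 1/2"
          using eZ[of "real (Suc n) * (weight_const * N) ^ n"] nn unfolding m[symmetric] by (simp add: Z_def mult_ac)
        show "N + (mult_const (r + 1 + \<theta>) * N) ^ Suc m * N \<le> Nq" by (simp add: Nq_def m)
        show "nonlocal_solution bp bm (Suc m) \<delta> \<epsilon> {0..?L} (r + 1 + \<theta>) u0 v0 u\<delta> v\<delta>"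
          using sol(4) unfolding rs m[symmetric] .
        show "local_solution (Suc m) \<epsilon> {0..?L} (r + 1 + \<theta>) u0 v0 u v"
          using sol(5) unfolding rs m[symmetric] .
        show "norm (sob (r + 1 + \<theta>) (f \<tau>)) \<le> N" if "f \<in> {u\<delta>, v\<delta>, u, v}" "\<tau> \<in> {0..?L}" for f \<tau>
          unfolding rs by (rule bnd[OF that])
        show "t \<in> {0..?L}" by (rule sol(7))
        show "D \<le> D'" "0 \<le> D'" by (auto simp: D'_def)
      qed
      also have "\<dots> = 2 * c1 * (\<delta> powr \<theta> * t * exp (c2 * \<epsilon> ^ n * t))"
        by (simp add: c1_def c2_def m)
      also have "\<dots> \<le> C * (\<delta> powr \<theta> * t * exp (C * \<epsilon> ^ n * t))"
      proof (intro mult_mono)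
        have t0: "0 \<le> t" using sol(7) by simp
        show "exp (c2 * \<epsilon> ^ n * t) \<le> exp (C * \<epsilon> ^ n * t)"
          unfolding exp_le_cancel_iff using t0 sol(2) c1 by (intro mult_right_mono) (auto simp: C_def)
        show "2 * c1 \<le> C" "0 \<le> C" using c1 c2 by (auto simp: C_def)
        show "0 \<le> \<delta> powr \<theta> * t" "0 \<le> t" "0 \<le> \<delta> powr \<theta> * t * exp (c2 * \<epsilon> ^ n * t)" using t0 by auto
      qed simp_all
      finally have main: "norm (sob r (\<lambda>x. u\<delta> t x - u t x)) + norm (sob r (\<lambda>x. v\<delta> t x - v t x))
          \<le> C * \<delta> powr \<theta> * t * exp (C * \<epsilon> ^ n * t)" by (simp add: mult.assoc)
      have rle: "r \<le> s + \<theta>" using parameters by (simp add: r_def)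
      have "(\<lambda>x. u\<delta> t x - u t x) \<in> Hs r" "(\<lambda>x. v\<delta> t x - v t x) \<in> Hs r"
        using H[OF _ sol(7)] by (auto intro!: Hs_diff(1) Hs_mono(1)[OF _ rle])
      then show ?case
        using main unfolding r_def[symmetric] by (simp add: Hs_norm_sob)
    qed
  qed
qed

end
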